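(* Let $f \colon V \rightarrow V$ denote a dynamically affine map over an algebraically closed field $K$ of characteristic $p$, such that the Artin--Mazur zeta function of the restriction $f|_C$ is rational, where $C:=\{x\in V(K)\mid \mathrm{Orb}_f(x)\cap\iota((\Gamma\backslash G)(K))=\emptyset\}$ and $\mathrm{Orb}_f(x)=\{f^n(x)\mid n\geqslant 0\}$ is the forward orbit. Then the zeta functions $\zeta_f(z)$ and $\zeta^*_f(z)$ converge to holomorphic functions on a nontrivial open disk centred at the origin.
   Context: A morphism $f\colon V\to V$ of a variety over an algebraically closed field $K$ of characteristic $p>0$ is confined if each iterate $f^n$ has finitely many fixed points $f_n$. It is dynamically affine if there are a connected commutative algebraic group $G$, an affine morphism $\psi(g)=\sigma(g)+h$ with $\sigma\in\mathrm{End}(G)$ a confined isogeny and $h\in G(K)$, a finite subgroup $\Gamma\subseteq\mathrm{Aut}(G)$, and a morphism $\iota\colon\Gamma\backslash G\to V$ identifying $\Gamma\backslash G$ with a Zariski-dense open subset of $V$, such that $f\circ\iota\circ\pi=\iota\circ\pi\circ\psi$ with $\pi\colon G\to\Gamma\backslash G$ the quotient map. Here $\zeta_f(z)=\exp(\sum_{n\geqslant1} f_n z^n/n)$ and $\zeta_f^*(z)=\exp(\sum_{p\nmid n} f_n z^n/n)$. *)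

theory Defs
  imports
    "HOL-Analysis.Analysis"
    "HOL-Algebra.Bij"
    "HOL-Algebra.Coset"
    "HOL-Computational_Algebra.Computational_Algebra"
begin

section \<open>Spaces with functions\<close>

text \<open>
  Varieties over an algebraically closed field are treated classically, as the sets of their
  rational points equipped with the Zariski topology and the sheaf of regular functions, a sheaf
  of functions with values in the field.  A section over an open set \<open>U\<close> is represented by
  every total function that agrees with it on \<open>U\<close>.  Only the values of \<open>sections\<close> at open
  sets are meaningful.
\<close>

record ('a, 'k) fun_space =
  space_top :: "'a topology"
  sections :: "'a set \<Rightarrow> ('a \<Rightarrow> 'k) set"

abbreviation points :: "('a, 'k, 'z) fun_space_scheme \<Rightarrow> 'a set" where
  "points X \<equiv> topspace (space_top X)"

abbreviation open_in_space :: "('a, 'k, 'z) fun_space_scheme \<Rightarrow> 'a set \<Rightarrow> bool" where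
  "open_in_space X U \<equiv> openin (space_top X) U"

definition space_with_functions :: "('a, 'k::field) fun_space \<Rightarrow> bool" where
  "space_with_functions X \<longleftrightarrow>
     (\<forall>U f g. open_in_space X U \<longrightarrow> f \<in> sections X U \<longrightarrow> (\<forall>x\<in>U. g x = f x) \<longrightarrow> g \<in> sections X U) \<and>
     (\<forall>U c. open_in_space X U \<longrightarrow> (\<lambda>_. c) \<in> sections X U) \<and>
     (\<forall>U f g. open_in_space X U \<longrightarrow> f \<in> sections X U \<longrightarrow> g \<in> sections X U \<longrightarrow>
        (\<lambda>x. f x + g x) \<in> sections X U \<and> (\<lambda>x. f x * g x) \<in> sections X U) \<and>
     (\<forall>U W f. open_in_space X U \<longrightarrow> open_in_space X W \<longrightarrow> W \<subseteq> U \<longrightarrow>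
        f \<in> sections X U \<longrightarrow> f \<in> sections X W) \<and>
     (\<forall>\<U> f. (\<forall>U\<in>\<U>. open_in_space X U \<and> f \<in> sections X U) \<longrightarrow> f \<in> sections X (\<Union>\<U>))"

definition morphism :: "('a, 'k) fun_space \<Rightarrow> ('b, 'k) fun_space \<Rightarrow> ('a \<Rightarrow> 'b) \<Rightarrow> bool" where
  "morphism X Y f \<longleftrightarrow>
     continuous_map (space_top X) (space_top Y) f \<and>
     (\<forall>W \<phi>. open_in_space Y W \<longrightarrow> \<phi> \<in> sections Y W \<longrightarrow>
        \<phi> \<circ> f \<in> sections X {x \<in> points X. f x \<in> W})"

definition isomorphism :: "('a, 'k) fun_space \<Rightarrow> ('b, 'k) fun_space \<Rightarrow> ('a \<Rightarrow> 'b) \<Rightarrow> bool" where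
  "isomorphism X Y f \<longleftrightarrow>
     bij_betw f (points X) (points Y) \<and> morphism X Y f \<and> morphism Y X (inv_into (points X) f)"

definition open_subspace :: "('a, 'k) fun_space \<Rightarrow> 'a set \<Rightarrow> ('a, 'k) fun_space" where
  "open_subspace X U = \<lparr>space_top = subtopology (space_top X) U, sections = sections X\<rparr>"

section \<open>Affine algebraic sets\<close>

definition affine_points :: "nat \<Rightarrow> (nat \<Rightarrow> 'k) set" where
  "affine_points n = ({..<n} \<rightarrow>\<^sub>E UNIV)"

text \<open>
  Polynomials enter only through their values at points, so the polynomial functions in the
  coordinates \<open>x 0, \<dots>, x (n - 1)\<close> suffice.
\<close>

inductive_set polynomial_functions :: "nat \<Rightarrow> ((nat \<Rightarrow> 'k::comm_ring_1) \<Rightarrow> 'k) set" for n where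
  const: "(\<lambda>_. c) \<in> polynomial_functions n"
| coord: "i < n \<Longrightarrow> (\<lambda>x. x i) \<in> polynomial_functions n"
| add: "P \<in> polynomial_functions n \<Longrightarrow> Q \<in> polynomial_functions n \<Longrightarrow>
    (\<lambda>x. P x + Q x) \<in> polynomial_functions n"
| mult: "P \<in> polynomial_functions n \<Longrightarrow> Q \<in> polynomial_functions n \<Longrightarrow>
    (\<lambda>x. P x * Q x) \<in> polynomial_functions n"

definition algebraic_set :: "nat \<Rightarrow> (nat \<Rightarrow> 'k::field) set \<Rightarrow> bool" where
  "algebraic_set n Z \<longleftrightarrow>
     (\<exists>S \<subseteq> polynomial_functions n. Z = {x \<in> affine_points n. \<forall>P\<in>S. P x = 0})"

definition zariski_open :: "nat \<Rightarrow> (nat \<Rightarrow> 'k::field) set \<Rightarrow> (nat \<Rightarrow> 'k) set \<Rightarrow> bool" where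
  "zariski_open n Z U \<longleftrightarrow>
     (\<exists>S \<subseteq> polynomial_functions n. U = Z - {x \<in> Z. \<forall>P\<in>S. P x = 0})"

lemma istopology_zariski_open: "istopology (zariski_open n Z)"
  unfolding istopology_def
proof (intro conjI allI impI)
  fix U W assume "zariski_open n Z U" "zariski_open n Z W"
  then obtain S T where S: "S \<subseteq> polynomial_functions n" "U = Z - {x \<in> Z. \<forall>P\<in>S. P x = 0}"
    and T: "T \<subseteq> polynomial_functions n" "W = Z - {x \<in> Z. \<forall>P\<in>T. P x = 0}"
    unfolding zariski_open_def by auto
  define R where "R = {(\<lambda>x. P x * Q x) | P Q. P \<in> S \<and> Q \<in> T}"
  have R: "R \<subseteq> polynomial_functions n"
    using S T by (auto simp: R_def intro: polynomial_functions.mult)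
  have "(\<exists>F\<in>R. F x \<noteq> 0) \<longleftrightarrow> (\<exists>P\<in>S. P x \<noteq> 0) \<and> (\<exists>Q\<in>T. Q x \<noteq> 0)" for x
    unfolding R_def by (auto, metis no_zero_divisors)
  then have "x \<in> U \<inter> W \<longleftrightarrow> x \<in> Z - {x \<in> Z. \<forall>P\<in>R. P x = 0}" for x
    unfolding S(2) T(2) by simp blast
  then have "U \<inter> W = Z - {x \<in> Z. \<forall>P\<in>R. P x = 0}"
    by (rule Set.set_eqI)
  with R show "zariski_open n Z (U \<inter> W)"
    unfolding zariski_open_def by blast
next
  fix \<U> assume "\<forall>U\<in>\<U>. zariski_open n Z U"
  then have "\<forall>U\<in>\<U>. \<exists>S. S \<subseteq> polynomial_functions n \<and> U = Z - {x \<in> Z. \<forall>P\<in>S. P x = 0}"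
    unfolding zariski_open_def .
  then obtain S where S': "\<forall>U\<in>\<U>. S U \<subseteq> polynomial_functions n \<and> U = Z - {x \<in> Z. \<forall>P\<in>S U. P x = 0}"
    by (rule bchoice[THEN exE])
  have S: "S U \<subseteq> polynomial_functions n" "U = Z - {x \<in> Z. \<forall>P\<in>S U. P x = 0}"
    if "U \<in> \<U>" for U
    using bspec[OF S' that] by (rule conjunct1, rule conjunct2)
  have mem: "x \<in> U \<longleftrightarrow> x \<in> Z \<and> (\<exists>P\<in>S U. P x \<noteq> 0)" if "U \<in> \<U>" for x U
  proof -
    have "x \<in> U \<longleftrightarrow> x \<in> Z - {x \<in> Z. \<forall>P\<in>S U. P x = 0}"
      by (rule arg_cong[OF S(2)[OF that]])
    then show ?thesis by (simp cong: conj_cong)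
  qed
  have "x \<in> \<Union>\<U> \<longleftrightarrow> x \<in> Z - {x \<in> Z. \<forall>P\<in>(\<Union>U\<in>\<U>. S U). P x = 0}" for x
    by (simp add: mem cong: bex_cong conj_cong)
  then have "\<Union>\<U> = Z - {x \<in> Z. \<forall>P\<in>(\<Union>U\<in>\<U>. S U). P x = 0}"
    by (rule Set.set_eqI)
  moreover have "(\<Union>U\<in>\<U>. S U) \<subseteq> polynomial_functions n" using S(1) by auto
  ultimately show "zariski_open n Z (\<Union>\<U>)"
    unfolding zariski_open_def by blast
qed

definition algebraic_set_space :: "nat \<Rightarrow> (nat \<Rightarrow> 'k::field) set \<Rightarrow> (nat \<Rightarrow> 'k, 'k) fun_space" where
  "algebraic_set_space n Z =
     \<lparr>space_top = topology (zariski_open n Z),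
      sections = (\<lambda>U. {f. \<forall>x\<in>U. \<exists>W P Q. zariski_open n Z W \<and> x \<in> W \<and> W \<subseteq> U \<and>
         P \<in> polynomial_functions n \<and> Q \<in> polynomial_functions n \<and>
         (\<forall>y\<in>W. Q y \<noteq> 0 \<and> f y = P y / Q y)})\<rparr>"

lemma open_in_algebraic_set_space:
  "open_in_space (algebraic_set_space n Z) U \<longleftrightarrow> zariski_open n Z U"
  by (simp add: algebraic_set_space_def istopology_zariski_open topology_inverse')

lemma points_algebraic_set_space: "points (algebraic_set_space n Z) = Z"
proof -
  have "zariski_open n Z Z"
    unfolding zariski_open_def
    by (rule exI[of _ "{\<lambda>_. 1}"]) (auto intro: polynomial_functions.const)
  then show ?thesis
    unfolding topspace_def open_in_algebraic_set_space by (auto simp: zariski_open_def)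
qed

definition affine_variety :: "('a, 'k::field) fun_space \<Rightarrow> bool" where
  "affine_variety X \<longleftrightarrow>
     (\<exists>n Z \<theta>. algebraic_set n Z \<and> isomorphism X (algebraic_set_space n Z) \<theta>)"

section \<open>Products and varieties\<close>

text \<open>
  Products of varieties: the nonvanishing loci of finite sums \<open>\<Sum>i. a i (x) * b i (y)\<close>, with
  \<open>a i\<close> and \<open>b i\<close> regular on open sets of the factors, form a base of the topology, and the
  regular functions are locally quotients of such sums.  This topology is in general finer than
  the product topology.
\<close>

definition tensor_functions ::
  "('a, 'k::field) fun_space \<Rightarrow> ('b, 'k) fun_space \<Rightarrow> 'a set \<Rightarrow> 'b set \<Rightarrow> ('a \<times> 'b \<Rightarrow> 'k) set" where
  "tensor_functions X Y U W =
     {(\<lambda>(x, y). \<Sum>i<m. a i x * b i y) | (m::nat) a b.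
        (\<forall>i<m. a i \<in> sections X U) \<and> (\<forall>i<m. b i \<in> sections Y W)}"

definition product_top :: "('a, 'k::field) fun_space \<Rightarrow> ('b, 'k) fun_space \<Rightarrow> ('a \<times> 'b) topology" where
  "product_top X Y = topology_generated_by
     {{p \<in> U \<times> W. t p \<noteq> 0} | U W t.
        open_in_space X U \<and> open_in_space Y W \<and> t \<in> tensor_functions X Y U W}"

definition product_space ::
  "('a, 'k::field) fun_space \<Rightarrow> ('b, 'k) fun_space \<Rightarrow> ('a \<times> 'b, 'k) fun_space" where
  "product_space X Y =
     \<lparr>space_top = product_top X Y,
      sections = (\<lambda>D. {f. \<forall>p\<in>D. \<exists>U W s t N.
         open_in_space X U \<and> open_in_space Y W \<and>
         s \<in> tensor_functions X Y U W \<and> t \<in> tensor_functions X Y U W \<and>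
         openin (product_top X Y) N \<and> p \<in> N \<and> N \<subseteq> D \<inter> (U \<times> W) \<and>
         (\<forall>q\<in>N. t q \<noteq> 0 \<and> f q = s q / t q)})\<rparr>"

definition prevariety :: "('a, 'k::field) fun_space \<Rightarrow> bool" where
  "prevariety X \<longleftrightarrow>
     space_with_functions X \<and>
     (\<exists>\<U>. finite \<U> \<and> \<Union>\<U> = points X \<and>
        (\<forall>U\<in>\<U>. open_in_space X U \<and> affine_variety (open_subspace X U)))"

definition variety :: "('a, 'k::field) fun_space \<Rightarrow> bool" where
  "variety X \<longleftrightarrow>
     prevariety X \<and> closedin (space_top (product_space X X)) {(x, x) | x. x \<in> points X}"

section \<open>Algebraic groups\<close>

definition algebraic_group :: "('g, 'k::field) fun_space \<Rightarrow> 'g monoid \<Rightarrow> bool" where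
  "algebraic_group X G \<longleftrightarrow>
     group G \<and> carrier G = points X \<and> variety X \<and>
     morphism (product_space X X) X (\<lambda>(x, y). x \<otimes>\<^bsub>G\<^esub> y) \<and>
     morphism X X (\<lambda>x. inv\<^bsub>G\<^esub> x)"

definition algebraic_End :: "('g, 'k::field) fun_space \<Rightarrow> 'g monoid \<Rightarrow> ('g \<Rightarrow> 'g) set" where
  "algebraic_End X G = {\<sigma> \<in> hom G G. morphism X X \<sigma>}"

definition algebraic_Aut :: "('g, 'k::field) fun_space \<Rightarrow> 'g monoid \<Rightarrow> ('g \<Rightarrow> 'g) set" where
  "algebraic_Aut X G = {\<gamma> \<in> auto G. isomorphism X X \<gamma>}"

definition isogeny :: "('g, 'k::field) fun_space \<Rightarrow> 'g monoid \<Rightarrow> ('g \<Rightarrow> 'g) \<Rightarrow> bool" where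
  "isogeny X G \<sigma> \<longleftrightarrow>
     \<sigma> \<in> algebraic_End X G \<and> \<sigma> ` carrier G = carrier G \<and> finite (kernel G G \<sigma>)"

definition affine_map :: "'g monoid \<Rightarrow> ('g \<Rightarrow> 'g) \<Rightarrow> 'g \<Rightarrow> 'g \<Rightarrow> 'g" where
  "affine_map G \<sigma> h g = \<sigma> g \<otimes>\<^bsub>G\<^esub> h"

definition orbit_map :: "('g \<Rightarrow> 'g) set \<Rightarrow> 'g \<Rightarrow> 'g set" where
  "orbit_map \<Gamma> g = (\<lambda>\<gamma>. \<gamma> g) ` \<Gamma>"

text \<open>
  The quotient by \<open>\<Gamma>\<close> has the orbits as points, the quotient topology, and as regular functions
  those whose pullback along the orbit map is regular.
\<close>

definition quotient_space ::
  "('g, 'k::field) fun_space \<Rightarrow> ('g \<Rightarrow> 'g) set \<Rightarrow> ('g set, 'k) fun_space" where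
  "quotient_space X \<Gamma> =
     \<lparr>space_top = topology (\<lambda>U. U \<subseteq> orbit_map \<Gamma> ` points X \<and>
         open_in_space X {x \<in> points X. orbit_map \<Gamma> x \<in> U}),
      sections = (\<lambda>U. {\<phi>. \<phi> \<circ> orbit_map \<Gamma> \<in> sections X {x \<in> points X. orbit_map \<Gamma> x \<in> U}})\<rparr>"

lemma open_in_quotient_space:
  "open_in_space (quotient_space X \<Gamma>) U \<longleftrightarrow>
     U \<subseteq> orbit_map \<Gamma> ` points X \<and> open_in_space X {x \<in> points X. orbit_map \<Gamma> x \<in> U}"
proof -
  have "istopology (\<lambda>U. U \<subseteq> orbit_map \<Gamma> ` points X \<and>
      open_in_space X {x \<in> points X. orbit_map \<Gamma> x \<in> U})"
    unfolding istopology_def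
  proof (intro conjI allI impI)
    fix S T
    assume "S \<subseteq> orbit_map \<Gamma> ` points X \<and> open_in_space X {x \<in> points X. orbit_map \<Gamma> x \<in> S}"
      and "T \<subseteq> orbit_map \<Gamma> ` points X \<and> open_in_space X {x \<in> points X. orbit_map \<Gamma> x \<in> T}"
    moreover have "{x \<in> points X. orbit_map \<Gamma> x \<in> S \<inter> T} =
        {x \<in> points X. orbit_map \<Gamma> x \<in> S} \<inter> {x \<in> points X. orbit_map \<Gamma> x \<in> T}" by auto
    ultimately show "S \<inter> T \<subseteq> orbit_map \<Gamma> ` points X"
      and "open_in_space X {x \<in> points X. orbit_map \<Gamma> x \<in> S \<inter> T}"
      by (auto intro: openin_Int)
  next
    fix \<K>
    assume K: "\<forall>S\<in>\<K>. S \<subseteq> orbit_map \<Gamma> ` points X \<and>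
      open_in_space X {x \<in> points X. orbit_map \<Gamma> x \<in> S}"
    then show "\<Union>\<K> \<subseteq> orbit_map \<Gamma> ` points X" by blast
    have "{x \<in> points X. orbit_map \<Gamma> x \<in> \<Union>\<K>} = (\<Union>S\<in>\<K>. {x \<in> points X. orbit_map \<Gamma> x \<in> S})"
      by auto
    then show "open_in_space X {x \<in> points X. orbit_map \<Gamma> x \<in> \<Union>\<K>}"
      using K by (auto intro: openin_Union)
  qed
  then show ?thesis
    by (simp add: quotient_space_def topology_inverse')
qed

lemma points_quotient_space: "points (quotient_space X \<Gamma>) = orbit_map \<Gamma> ` points X"
proof -
  have "{x \<in> points X. orbit_map \<Gamma> x \<in> orbit_map \<Gamma> ` points X} = points X" by auto
  then have "open_in_space (quotient_space X \<Gamma>) (orbit_map \<Gamma> ` points X)"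
    unfolding open_in_quotient_space by simp
  then show ?thesis
    using open_in_quotient_space openin_subset openin_topspace by (metis subset_antisym)
qed

section \<open>Dynamically affine maps\<close>

definition confined :: "'a set \<Rightarrow> ('a \<Rightarrow> 'a) \<Rightarrow> bool" where
  "confined S f \<longleftrightarrow> (\<forall>n\<ge>1. finite {x \<in> S. (f ^^ n) x = x})"

text \<open>
  The map \<open>\<iota>\<close> identifies the quotient with an open subset: it is an isomorphism onto its image,
  regarded as an open subspace.  Group laws are written multiplicatively.
\<close>

definition dynamically_affine ::
  "('v, 'k::field) fun_space \<Rightarrow> ('v \<Rightarrow> 'v) \<Rightarrow> ('g, 'k) fun_space \<Rightarrow> 'g monoid \<Rightarrow>
   ('g \<Rightarrow> 'g) \<Rightarrow> 'g \<Rightarrow> ('g \<Rightarrow> 'g) set \<Rightarrow> ('g set \<Rightarrow> 'v) \<Rightarrow> bool" where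
  "dynamically_affine V f X G \<sigma> h \<Gamma> \<iota> \<longleftrightarrow>
     variety V \<and> morphism V V f \<and>
     algebraic_group X G \<and> comm_group G \<and> connected_space (space_top X) \<and>
     isogeny X G \<sigma> \<and> confined (carrier G) \<sigma> \<and> h \<in> carrier G \<and>
     finite \<Gamma> \<and> subgroup \<Gamma> (AutoGroup G) \<and> \<Gamma> \<subseteq> algebraic_Aut X G \<and>
     morphism (quotient_space X \<Gamma>) V \<iota> \<and>
     open_in_space V (\<iota> ` points (quotient_space X \<Gamma>)) \<and>
     Abstract_Topology.closure_of (space_top V) (\<iota> ` points (quotient_space X \<Gamma>)) = points V \<and>
     isomorphism (quotient_space X \<Gamma>) (open_subspace V (\<iota> ` points (quotient_space X \<Gamma>))) \<iota> \<and>
     (\<forall>g\<in>carrier G. f (\<iota> (orbit_map \<Gamma> g)) = \<iota> (orbit_map \<Gamma> (affine_map G \<sigma> h g)))"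

definition forward_orbit :: "('a \<Rightarrow> 'a) \<Rightarrow> 'a \<Rightarrow> 'a set" where
  "forward_orbit f x = {(f ^^ n) x | n. True}"

section \<open>Zeta functions\<close>

definition fixed_point_count :: "'a set \<Rightarrow> ('a \<Rightarrow> 'a) \<Rightarrow> nat \<Rightarrow> nat" where
  "fixed_point_count S f n = card {x \<in> S. (f ^^ n) x = x}"

definition artin_mazur_zeta :: "'a set \<Rightarrow> ('a \<Rightarrow> 'a) \<Rightarrow> complex fps" where
  "artin_mazur_zeta S f = fps_exp 1 oo
     Abs_fps (\<lambda>n. if n = 0 then 0 else of_nat (fixed_point_count S f n) / of_nat n)"

definition tame_zeta :: "nat \<Rightarrow> 'a set \<Rightarrow> ('a \<Rightarrow> 'a) \<Rightarrow> complex fps" where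
  "tame_zeta p S f = fps_exp 1 oo
     Abs_fps (\<lambda>n. if p dvd n then 0 else of_nat (fixed_point_count S f n) / of_nat n)"

definition rational_fps :: "complex fps \<Rightarrow> bool" where
  "rational_fps F \<longleftrightarrow> (\<exists>P Q. Q \<noteq> 0 \<and> fps_of_poly Q * F = fps_of_poly P)"

definition converges_to_holomorphic_near_0 :: "complex fps \<Rightarrow> bool" where
  "converges_to_holomorphic_near_0 F \<longleftrightarrow>
     (\<exists>r>0. \<exists>H. H holomorphic_on ball 0 r \<and> (\<forall>z\<in>ball 0 r. (\<lambda>n. fps_nth F n * z ^ n) sums H z))"

end

theory Submission
  imports
    Defs
    "HOL-Library.Function_Algebras"
    "HOL-Complex_Analysis.Laurent_Convergence"
begin

text \<open>
  The coefficients of the logarithms of the zeta functions are the numbers of fixed points divided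
  by \<open>n\<close>, so it suffices to bound these numbers by an exponential function of \<open>n\<close>.  On \<open>C\<close> this
  follows from rationality.  A fixed point of \<open>f ^^ n\<close> in the image of \<open>\<iota>\<close> lifts to a fixed point
  of \<open>\<psi> ^^ (n * c)\<close> with \<open>c \<le> card \<Gamma>\<close>, and the fixed points of \<open>\<psi> ^^ m\<close> form a coset of those of
  \<open>\<sigma> ^^ m\<close>.

  The fixed points of \<open>\<tau> = \<sigma> ^^ m\<close> form the kernel \<open>H\<close> of \<open>g \<mapsto> \<tau> g * g\<inverse>\<close>.  On an affine chart with
  \<open>N\<close> coordinates a translate \<open>z\<close> of this map is given by fractions of degree \<open>D\<close>, which is at most
  exponential in \<open>m\<close>.  Let \<open>v s\<close> be the dimension of the space of polynomials of degree at most \<open>s\<close>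
  on the chart.  A polynomial \<open>e\<close> that separates a generic coset of \<open>H\<close> makes the functions
  \<open>e ^ j * (P \<circ> z)\<close>, \<open>j < card H\<close>, independent, so that \<open>card H * v s \<le> v ((D + 1) * s)\<close> for large
  \<open>s\<close>; as \<open>v s \<le> (s + 1) ^ N\<close>, this forces \<open>card H \<le> (D + 1) ^ N\<close>.  It is needed that \<open>z\<close> is dominant.
  As its fibres are finite, the coordinates are algebraic over the pullbacks along \<open>z\<close>, and if a
  nonzero function vanished on the image, then \<open>v\<close> would grow faster than any polynomial.
\<close>

section \<open>Convergence of the zeta functions\<close>

text \<open>Classically the count is a degree, bounded through dimension theory and Bezout's
  theorem. Both are replaced here by one asymptotic comparison: a function \<open>v\<close> of
  polynomial growth with \<open>h * v s \<le> v (M * s)\<close> for all large \<open>s\<close> has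
  \<open>h \<le> M ^ N\<close>, whatever the true dimension of the chart. The same principle yields
  dominance and the count of a fibre. Only an upper bound is sought, so inseparability is harmless:
  powers of a separating function see just the points of a fibre. The remaining obstacle is that a
  chart is stable neither under products nor under \<sigma>. Every map is therefore described by
  fractions near some point of the chart, and irreducibility of the group supplies a point where
  finitely many such descriptions hold at once. The translation by \<open>c\<close> serves this
  purpose; \<open>c\<close> varies with the iterate, but the degree bound does not depend on it.
  Degrees multiply under composition, which is the source of the exponential growth in
  \<open>m\<close>.\<close>

lemma conv_radius_pos_exp_bound:
  fixes a :: "nat \<Rightarrow> complex"
  assumes "B > 0" and "\<And>n. n \<ge> 1 \<Longrightarrow> norm (a n) \<le> C * B ^ n"
  shows "conv_radius a > 0"
proof -
  \<comment> \<open>At radius \<open>1 / (2 * B)\<close> the bound leaves a geometric series of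
    ratio 1/2.\<close>
  have "summable (\<lambda>n. a n * of_real (1 / (2 * B)) ^ n)"
  proof (rule summable_comparison_test)
    show "\<exists>N. \<forall>n\<ge>N. norm (a n * of_real (1 / (2 * B)) ^ n) \<le> C * (1 / 2) ^ n"
    proof (intro exI[of _ 1] allI impI)
      fix n :: nat assume "n \<ge> 1"
      have "norm (a n * of_real (1 / (2 * B)) ^ n) = norm (a n) * (1 / (2 * B)) ^ n"
        using assms(1) by (simp add: norm_mult norm_power norm_divide)
      also have "\<dots> \<le> (C * B ^ n) * (1 / (2 * B)) ^ n"
        using assms \<open>n \<ge> 1\<close> by (intro mult_right_mono) auto
      also have "\<dots> = C * (1 / 2) ^ n"
        using assms(1) by (simp add: power_mult_distrib power_divide field_simps)
      finally show "norm (a n * of_real (1 / (2 * B)) ^ n) \<le> C * (1 / 2) ^ n" .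
    qed
    show "summable (\<lambda>n. C * (1 / 2) ^ n :: real)"
      by (intro summable_mult summable_geometric) auto
  qed
  from conv_radius_geI[OF this] have "ereal (norm (complex_of_real (1 / (2 * B)))) \<le> conv_radius a" .
  moreover have "norm (complex_of_real (1 / (2 * B))) > 0" using assms(1) by simp
  ultimately show ?thesis by (metis ereal_less(2) less_le_trans)
qed

text \<open>The terms of a convergent series are bounded, so convergence at one radius
  \<open>r > 0\<close> gives exponential growth with base \<open>1 / r\<close>.\<close>

lemma fps_nth_exp_bound:
  fixes F :: "complex fps"
  assumes "fps_conv_radius F > 0"
  obtains C B where "C > 0" "B > 0" "\<And>n. norm (fps_nth F n) \<le> C * B ^ n"
proof -
  obtain r where r: "0 < r" "ereal r < fps_conv_radius F"
    using assms ereal_dense2[of 0 "fps_conv_radius F"] by (auto simp: zero_ereal_def)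
  have "summable (\<lambda>n. fps_nth F n * of_real r ^ n)"
    using r by (intro summable_in_conv_radius) (auto simp: fps_conv_radius_def)
  then have "bounded (range (\<lambda>n. fps_nth F n * of_real r ^ n))"
    by (metis summable_imp_bounded)
  then obtain C where C: "C > 0" "\<And>n. norm (fps_nth F n * of_real r ^ n) \<le> C"
    unfolding bounded_pos by auto
  show ?thesis
  proof (rule that[of C "1 / r"])
    fix n
    have "norm (fps_nth F n) * r ^ n \<le> C"
      using C(2)[of n] r by (simp add: norm_mult norm_power)
    then show "norm (fps_nth F n) \<le> C * (1 / r) ^ n"
      using r by (simp add: field_simps power_divide)
  qed (use C r in auto)
qed

lemma converges_to_holomorphic_near_0_if_conv_radius:
  assumes "fps_conv_radius F > 0"
  shows "converges_to_holomorphic_near_0 F"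
proof -
  obtain r where r: "0 < r" "ereal r < fps_conv_radius F"
    using assms ereal_dense2[of 0 "fps_conv_radius F"] by (auto simp: zero_ereal_def)
  have "eval_fps F holomorphic_on ball 0 r"
  proof (intro holomorphic_on_eval_fps subsetI)
    fix x :: complex assume "x \<in> ball 0 r"
    then have "ereal (norm x) < ereal r" by simp
    from less_trans[OF this r(2)] show "x \<in> eball 0 (fps_conv_radius F)"
      by (simp add: eball_def)
  qed
  moreover have "(\<lambda>n. fps_nth F n * z ^ n) sums eval_fps F z" if "z \<in> ball 0 r" for z
  proof (intro sums_eval_fps)
    have "ereal (norm z) < ereal r" using that by simp
    from less_trans[OF this r(2)] show "ereal (norm z) < fps_conv_radius F" .
  qed
  ultimately show ?thesis
    unfolding converges_to_holomorphic_near_0_def using r(1) by blast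
qed

text \<open>The condition \<open>a 0 = 0\<close> makes the formal composition with the exponential
  series agree with the composition of functions, so a positive radius for the logarithm passes to
  its exponential.\<close>

lemma converges_to_holomorphic_near_0_exp:
  assumes "B > 0" and "\<And>n. n \<ge> 1 \<Longrightarrow> norm (a n) \<le> C * B ^ n" and "a 0 = 0"
  shows "converges_to_holomorphic_near_0 (fps_exp 1 oo Abs_fps a)"
proof -
  have "fps_conv_radius (Abs_fps a) > 0"
    using conv_radius_pos_exp_bound[of B a C] assms by (simp add: fps_conv_radius_def)
  then have "eval_fps (Abs_fps a) has_fps_expansion Abs_fps a"
    by (auto simp: has_fps_expansion_def)
  moreover have "(\<lambda>z. exp (1 * z)) has_fps_expansion fps_exp (1 :: complex)"
    by (rule has_fps_expansion_exp)
  ultimately have "((\<lambda>z. exp (1 * z)) \<circ> eval_fps (Abs_fps a)) has_fps_expansion (fps_exp 1 oo Abs_fps a)"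
    using assms(3) by (intro has_fps_expansion_compose) auto
  then show ?thesis
    by (intro converges_to_holomorphic_near_0_if_conv_radius) (auto simp: has_fps_expansion_def)
qed

section \<open>Rational series and the coefficients of their logarithms\<close>

lemma rational_fps_conv_radius:
  assumes "rational_fps F"
  shows "fps_conv_radius F > 0"
proof -
  obtain P Q where Q: "Q \<noteq> 0" "fps_of_poly Q * F = fps_of_poly P"
    using assms unfolding rational_fps_def by blast
  define q where "q = fps_of_poly Q"
  have q0: "q \<noteq> 0" using Q(1) by (simp add: q_def)
  \<comment> \<open>\<open>Q\<close> may vanish at 0. As \<open>F\<close> is a power series, the
    power of X in \<open>Q\<close> also divides \<open>P\<close>, and only the unit part
    \<open>u\<close> has to be inverted.\<close>
  define k where "k = subdegree q"
  define u where "u = fps_shift k q"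
  have qu: "q = u * fps_X ^ k" unfolding u_def k_def by (rule subdegree_decompose)
  have u0: "fps_nth u 0 \<noteq> 0" using q0 by (simp add: u_def k_def)
  have "u * F = fps_shift k (fps_of_poly P)"
  proof -
    have "(u * F) * fps_X ^ k = fps_of_poly P"
      using Q(2) qu by (simp add: q_def mult_ac)
    then show ?thesis using fps_shift_times_fps_X_power'[of k "u * F"] by simp
  qed
  then have "inverse u * (u * F) = inverse u * fps_shift k (fps_of_poly P)" by simp
  then have F: "F = inverse u * fps_shift k (fps_of_poly P)"
    using u0 by (simp add: mult.assoc[symmetric] inverse_mult_eq_1)
  have u: "fps_conv_radius u > 0" unfolding u_def q_def by simp
  show ?thesis
    unfolding F using fps_conv_radius_inverse_pos[OF u0 u]
    by (intro less_le_trans[OF _ fps_conv_radius_mult]) auto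
qed

text \<open>Differentiating \<open>F = exp L\<close> expresses \<open>n\<close> times the
  coefficient of index \<open>n\<close> as a sum of products of earlier coefficients with values of
  \<open>a\<close>. All terms are nonnegative, and the one with index 0 is \<open>a n\<close>,
  because the constant term of \<open>F\<close> is 1.\<close>

lemma log_coeff_le_exp_coeff:
  fixes a :: "nat \<Rightarrow> real"
  assumes nonneg: "\<And>n. a n \<ge> 0"
  defines "F \<equiv> fps_exp 1 oo Abs_fps (\<lambda>n. if n = 0 then 0 else complex_of_real (a n) / of_nat n)"
  assumes "n \<ge> 1"
  shows "a n \<le> real n * norm (fps_nth F n)"
proof -
  let ?L = "Abs_fps (\<lambda>n. if n = 0 then 0 else complex_of_real (a n) / of_nat n)"
  have "fps_deriv F = (fps_exp 1 oo ?L) * fps_deriv ?L"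
    unfolding F_def by (subst fps_compose_deriv) auto
  then have D: "fps_deriv F = F * fps_deriv ?L" by (simp add: F_def)
  have DL: "fps_nth (fps_deriv ?L) m = of_real (a (Suc m))" for m
    by (simp del: of_nat_Suc)
  have rec: "of_nat (Suc m) * fps_nth F (Suc m) = (\<Sum>i=0..m. fps_nth F i * of_real (a (Suc (m - i))))" for m
  proof -
    have "of_nat (Suc m) * fps_nth F (Suc m) = fps_nth (fps_deriv F) m" by simp
    also have "\<dots> = (\<Sum>i=0..m. fps_nth F i * of_real (a (Suc (m - i))))"
      by (simp only: D fps_mult_nth DL)
    finally show ?thesis .
  qed
  have F0: "fps_nth F 0 = 1" by (simp add: F_def)
  have pos: "\<exists>x\<ge>0. fps_nth F m = of_real x" for m
  proof (induction m rule: less_induct)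
    case (less m)
    show ?case
    proof (cases m)
      case 0 then show ?thesis using F0 by (intro exI[of _ 1]) auto
    next
      case (Suc k)
      have "\<forall>i\<in>{0..k}. \<exists>x\<ge>0. fps_nth F i = of_real x" using less Suc by auto
      then obtain x where x: "\<And>i. i \<le> k \<Longrightarrow> x i \<ge> 0 \<and> fps_nth F i = of_real (x i)"
        by (metis atLeastAtMost_iff zero_le)
      have "of_nat (Suc k) * fps_nth F (Suc k) = of_real (\<Sum>i=0..k. x i * a (Suc (k - i)))"
        unfolding rec by (simp add: x)
      then have "fps_nth F (Suc k) = of_real ((\<Sum>i=0..k. x i * a (Suc (k - i))) / real (Suc k))"
        by (simp add: field_simps del: of_nat_Suc)
      moreover have "(\<Sum>i=0..k. x i * a (Suc (k - i))) / real (Suc k) \<ge> 0"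
        using x nonneg by (intro divide_nonneg_nonneg sum_nonneg mult_nonneg_nonneg) auto
      ultimately show ?thesis using Suc by blast
    qed
  qed
  obtain k where k: "n = Suc k" using \<open>n \<ge> 1\<close> by (cases n) auto
  obtain x where x: "\<And>i. x i \<ge> 0 \<and> fps_nth F i = of_real (x i)" using pos by metis
  have "of_real (real n * x n) = complex_of_real (\<Sum>i=0..k. x i * a (Suc (k - i)))"
    using rec[of k] by (simp add: x k)
  then have "real n * x n = (\<Sum>i=0..k. x i * a (Suc (k - i)))" using of_real_eq_iff by blast
  also have "\<dots> \<ge> x 0 * a (Suc (k - 0))"
    using x nonneg by (intro member_le_sum[of 0 _ "\<lambda>i. x i * a (Suc (k - i))"]) auto
  finally show ?thesis using x[of 0] x[of n] F0 k by simp
qed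

lemma rational_zeta_fixed_point_bound:
  assumes "rational_fps (artin_mazur_zeta S f)"
  obtains C B where "C > 0" "B > 0" "\<And>n. n \<ge> 1 \<Longrightarrow> real (fixed_point_count S f n) \<le> C * B ^ n"
proof -
  let ?F = "artin_mazur_zeta S f"
  obtain C B where CB: "C > 0" "B > 0" "\<And>n. norm (fps_nth ?F n) \<le> C * B ^ n"
    using fps_nth_exp_bound[OF rational_fps_conv_radius[OF assms]] by blast
  show ?thesis
  proof (rule that[of C "2 * B"])
    fix n :: nat assume n: "n \<ge> 1"
    have "real (fixed_point_count S f n) \<le> real n * norm (fps_nth ?F n)"
      using log_coeff_le_exp_coeff[of "\<lambda>n. real (fixed_point_count S f n)" n] n
      by (simp add: artin_mazur_zeta_def cong: if_cong)
    \<comment> \<open>The factor \<open>n\<close> left by the logarithmic derivative is absorbed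
      into the base, which doubles.\<close>
    also have "\<dots> \<le> 2 ^ n * (C * B ^ n)"
    proof (rule mult_mono)
      show "real n \<le> 2 ^ n" by (rule less_imp_le[OF of_nat_less_two_power])
    qed (use CB in auto)
    finally show "real (fixed_point_count S f n) \<le> C * (2 * B) ^ n"
      by (simp add: power_mult_distrib mult_ac)
  qed (use CB in auto)
qed

lemma zeta_converge_if_fixed_point_bound:
  assumes "B > 0" "\<And>n. n \<ge> 1 \<Longrightarrow> real (fixed_point_count S f n) \<le> C * B ^ n"
  shows "converges_to_holomorphic_near_0 (artin_mazur_zeta S f)"
    and "converges_to_holomorphic_near_0 (tame_zeta p S f)"
proof -
  have le: "real (fixed_point_count S f n) / real n \<le> C * B ^ n" if "n \<ge> 1" for n
  proof -
    have "real (fixed_point_count S f n) / real n \<le> real (fixed_point_count S f n)"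
      using that by (simp add: divide_le_eq mult_le_cancel_left1)
    with assms(2)[OF that] show ?thesis by linarith
  qed
  have nn: "0 \<le> C * B ^ n" if "n \<ge> 1" for n
    using le[OF that] by (meson divide_nonneg_nonneg of_nat_0_le_iff order_trans)
  show "converges_to_holomorphic_near_0 (artin_mazur_zeta S f)"
    unfolding artin_mazur_zeta_def
  proof (rule converges_to_holomorphic_near_0_exp[OF assms(1), where C = C])
    fix n :: nat assume "n \<ge> 1"
    with le[OF this] nn[OF this]
    show "norm (if n = 0 then 0 else of_nat (fixed_point_count S f n) / of_nat n :: complex) \<le> C * B ^ n"
      by (simp add: norm_divide)
  qed simp
  \<comment> \<open>Omitting terms keeps the bound. Every \<open>p\<close> divides 0, so the
    constant term is omitted too, as the composition requires.\<close>
  show "converges_to_holomorphic_near_0 (tame_zeta p S f)"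
    unfolding tame_zeta_def
  proof (rule converges_to_holomorphic_near_0_exp[OF assms(1), where C = C])
    fix n :: nat assume "n \<ge> 1"
    with le[OF this] nn[OF this]
    show "norm (if p dvd n then 0 else of_nat (fixed_point_count S f n) / of_nat n :: complex) \<le> C * B ^ n"
      by (simp add: norm_divide)
  qed simp
qed

section \<open>Subrings and polynomials over them\<close>

text \<open>Rings are subsets of one ambient ring, because the argument moves through towers of
  rings of functions on a fixed set. The type of all such functions has zero divisors, so
  integrality also has to be a property of subsets.\<close>

definition subring_set :: "'r::comm_ring_1 set \<Rightarrow> bool" where
  "subring_set R \<longleftrightarrow> 1 \<in> R \<and> (\<forall>a\<in>R. \<forall>b\<in>R. a - b \<in> R \<and> a * b \<in> R)"

definition poly_over :: "'r::comm_ring_1 set \<Rightarrow> 'r poly set" where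
  "poly_over R = {p. \<forall>i. coeff p i \<in> R}"

definition adjoin :: "'r::comm_ring_1 set \<Rightarrow> 'r \<Rightarrow> 'r set" where
  "adjoin R x = (\<lambda>p. poly p x) ` poly_over R"

lemma subring_setD:
  assumes "subring_set R"
  shows subring_one: "1 \<in> R" and subring_zero: "0 \<in> R"
    and subring_diff: "\<And>a b. a \<in> R \<Longrightarrow> b \<in> R \<Longrightarrow> a - b \<in> R"
    and subring_mult: "\<And>a b. a \<in> R \<Longrightarrow> b \<in> R \<Longrightarrow> a * b \<in> R"
    and subring_uminus: "\<And>a. a \<in> R \<Longrightarrow> - a \<in> R"
    and subring_add: "\<And>a b. a \<in> R \<Longrightarrow> b \<in> R \<Longrightarrow> a + b \<in> R"
    and subring_power: "\<And>a k. a \<in> R \<Longrightarrow> a ^ k \<in> R"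
    and subring_sum: "\<And>(f :: nat \<Rightarrow> _) A. (\<And>i. i \<in> A \<Longrightarrow> f i \<in> R) \<Longrightarrow> sum f A \<in> R"
proof -
  show 1: "1 \<in> R" using assms by (simp add: subring_set_def)
  show d: "a - b \<in> R" if "a \<in> R" "b \<in> R" for a b using assms that by (simp add: subring_set_def)
  show m: "a * b \<in> R" if "a \<in> R" "b \<in> R" for a b using assms that by (simp add: subring_set_def)
  show 0: "0 \<in> R" using d[OF 1 1] by simp
  show u: "- a \<in> R" if "a \<in> R" for a using d[OF 0 that] by simp
  show a: "a + b \<in> R" if "a \<in> R" "b \<in> R" for a b using d[OF that(1) u[OF that(2)]] by simp
  show "a ^ k \<in> R" if "a \<in> R" for a k using that by (induction k) (auto intro: 1 m)
  show "sum f A \<in> R" if "\<And>i. i \<in> A \<Longrightarrow> f i \<in> R" for f :: "nat \<Rightarrow> _" and A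
    using that by (induction A rule: infinite_finite_induct) (auto intro: 0 a)
qed

lemma poly_overD: "p \<in> poly_over R \<Longrightarrow> coeff p i \<in> R"
  by (simp add: poly_over_def)

lemma poly_over_intros:
  assumes "subring_set R"
  shows poly_over_diff: "\<And>p q. p \<in> poly_over R \<Longrightarrow> q \<in> poly_over R \<Longrightarrow> p - q \<in> poly_over R"
    and poly_over_add: "\<And>p q. p \<in> poly_over R \<Longrightarrow> q \<in> poly_over R \<Longrightarrow> p + q \<in> poly_over R"
    and poly_over_mult: "\<And>p q. p \<in> poly_over R \<Longrightarrow> q \<in> poly_over R \<Longrightarrow> p * q \<in> poly_over R"
    and poly_over_smult: "\<And>a p. a \<in> R \<Longrightarrow> p \<in> poly_over R \<Longrightarrow> smult a p \<in> poly_over R"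
    and poly_over_monom: "\<And>a k. a \<in> R \<Longrightarrow> monom a k \<in> poly_over R"
    and poly_over_0: "0 \<in> poly_over R"
    and poly_over_const: "\<And>a. a \<in> R \<Longrightarrow> [:a:] \<in> poly_over R"
  by (auto simp: poly_over_def coeff_mult coeff_pCons coeff_monom split: nat.splits
      intro!: subring_setD[OF assms] )

lemma adjoin_subring:
  assumes "subring_set R"
  shows "subring_set (adjoin R x)" "R \<subseteq> adjoin R x" "x \<in> adjoin R x"
proof -
  have 1: "poly [:1:] x \<in> adjoin R x"
    unfolding adjoin_def by (intro imageI poly_over_intros assms subring_setD[OF assms])
  show "R \<subseteq> adjoin R x"
  proof
    fix a assume "a \<in> R"
    then have "poly [:a:] x \<in> adjoin R x"
      unfolding adjoin_def by (intro imageI poly_over_intros assms)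
    then show "a \<in> adjoin R x" by simp
  qed
  have "poly (monom 1 1) x \<in> adjoin R x"
    unfolding adjoin_def by (intro imageI poly_over_intros assms subring_setD[OF assms])
  then show "x \<in> adjoin R x" by (simp add: poly_monom)
  show "subring_set (adjoin R x)"
    unfolding subring_set_def
  proof (intro conjI ballI)
    show "1 \<in> adjoin R x" using 1 by simp
  next
    fix a b assume "a \<in> adjoin R x" "b \<in> adjoin R x"
    then obtain p q where pq: "p \<in> poly_over R" "q \<in> poly_over R" "a = poly p x" "b = poly q x"
      by (auto simp: adjoin_def)
    have "poly (p - q) x \<in> adjoin R x" "poly (p * q) x \<in> adjoin R x"
      unfolding adjoin_def using pq by (auto intro!: imageI poly_over_intros assms simp del: poly_diff poly_mult)
    then show "a - b \<in> adjoin R x" "a * b \<in> adjoin R x" using pq by simp_all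
  qed
qed

lemma adjoin_least:
  assumes "subring_set S" "R \<subseteq> S" "x \<in> S"
  shows "adjoin R x \<subseteq> S"
proof
  fix a assume "a \<in> adjoin R x"
  then obtain p where p: "p \<in> poly_over R" "a = poly p x" by (auto simp: adjoin_def)
  have "a = (\<Sum>i\<le>degree p. coeff p i * x ^ i)" by (simp add: p(2) poly_altdef)
  also have "\<dots> \<in> S"
    using p(1) assms by (intro subring_setD[OF assms(1)]) (auto simp: poly_over_def)
  finally show "a \<in> S" .
qed

section \<open>Hilbert's basis theorem\<close>

definition ideal_in :: "'r::comm_ring_1 set \<Rightarrow> 'r set \<Rightarrow> bool" where
  "ideal_in R I \<longleftrightarrow> I \<subseteq> R \<and> 0 \<in> I \<and> (\<forall>a\<in>I. \<forall>b\<in>I. a + b \<in> I) \<and> (\<forall>r\<in>R. \<forall>a\<in>I. r * a \<in> I)"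

definition noetherian_set :: "'r::comm_ring_1 set \<Rightarrow> bool" where
  "noetherian_set R \<longleftrightarrow>
     (\<forall>I :: nat \<Rightarrow> _. (\<forall>n. ideal_in R (I n)) \<longrightarrow> mono I \<longrightarrow> (\<exists>m. \<forall>n\<ge>m. I n = I m))"

lemma ideal_inD:
  assumes "ideal_in R I" "subring_set R"
  shows "\<And>a. a \<in> I \<Longrightarrow> a \<in> R" "0 \<in> I" "\<And>a b. a \<in> I \<Longrightarrow> b \<in> I \<Longrightarrow> a + b \<in> I"
    "\<And>r a. r \<in> R \<Longrightarrow> a \<in> I \<Longrightarrow> r * a \<in> I" "\<And>a b. a \<in> I \<Longrightarrow> b \<in> I \<Longrightarrow> a - b \<in> I"
proof -
  show 1: "\<And>a. a \<in> I \<Longrightarrow> a \<in> R" "0 \<in> I" and 2: "\<And>a b. a \<in> I \<Longrightarrow> b \<in> I \<Longrightarrow> a + b \<in> I"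
    and 3: "\<And>r a. r \<in> R \<Longrightarrow> a \<in> I \<Longrightarrow> r * a \<in> I"
    using assms(1) by (auto simp: ideal_in_def)
  show "a - b \<in> I" if "a \<in> I" "b \<in> I" for a b
    using 2[OF that(1) 3[of "- 1" b]] that(2) subring_setD[OF assms(2)] by simp
qed

lemma noetherian_field:
  assumes "subring_set R" "\<And>a. a \<in> R \<Longrightarrow> a \<noteq> 0 \<Longrightarrow> \<exists>b\<in>R. b * a = 1"
  shows "noetherian_set R"
  unfolding noetherian_set_def
proof (intro allI impI)
  fix I :: "nat \<Rightarrow> 'a set" assume I: "\<forall>n. ideal_in R (I n)" "mono I"
  have full: "I n = R" if a: "a \<in> I n" "a \<noteq> 0" for n a
  proof -
    obtain b where "b \<in> R" "b * a = 1"
      using assms(2)[OF ideal_inD(1)[OF I(1)[rule_format] assms(1) a(1)] a(2)] by blast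
    then have "1 \<in> I n" using ideal_inD(4)[OF I(1)[rule_format] assms(1), of b a n] a by metis
    then have "r \<in> I n" if "r \<in> R" for r
      using ideal_inD(4)[OF I(1)[rule_format] assms(1) that, of 1 n] by simp
    then show ?thesis using I(1) unfolding ideal_in_def by blast
  qed
  show "\<exists>m. \<forall>n\<ge>m. I n = I m"
  proof (cases "\<exists>m. \<exists>a\<in>I m. a \<noteq> 0")
    case True
    then obtain m a where "a \<in> I m" "a \<noteq> 0" by auto
    then have "\<forall>n\<ge>m. I n = R" using full[OF subsetD[OF monoD[OF I(2)]]] by blast
    then show ?thesis by (intro exI[of _ m]) auto
  next
    case False
    have "I n = {0}" for n using False ideal_inD(2)[OF I(1)[rule_format] assms(1)] by blast
    then show ?thesis by auto
  qed
qed

definition lead_ideal :: "'r::comm_ring_1 set \<Rightarrow> 'r \<Rightarrow> 'r set \<Rightarrow> nat \<Rightarrow> 'r set" where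
  "lead_ideal R x I k = {coeff p k | p. p \<in> poly_over R \<and> degree p \<le> k \<and> poly p x \<in> I}"

lemma lead_ideal_ideal:
  assumes R: "subring_set R" and I: "ideal_in (adjoin R x) I"
  shows "ideal_in R (lead_ideal R x I k)"
  unfolding ideal_in_def
proof (intro conjI ballI subsetI)
  note I' = ideal_inD[OF I adjoin_subring(1)[OF R]]
  show "0 \<in> lead_ideal R x I k"
    unfolding lead_ideal_def by (rule CollectI, rule exI[of _ 0]) (use I' poly_over_0[OF R] in auto)
  fix a assume a: "a \<in> lead_ideal R x I k"
  then obtain p where p: "p \<in> poly_over R" "degree p \<le> k" "poly p x \<in> I" "a = coeff p k"
    by (auto simp: lead_ideal_def)
  show "a \<in> R" using p by (simp add: poly_over_def)
  {
    fix b assume "b \<in> lead_ideal R x I k"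
    then obtain q where q: "q \<in> poly_over R" "degree q \<le> k" "poly q x \<in> I" "b = coeff q k"
      by (auto simp: lead_ideal_def)
    show "a + b \<in> lead_ideal R x I k"
      unfolding lead_ideal_def
      by (rule CollectI, rule exI[of _ "p + q"])
        (use p q I' poly_over_add[OF R] in \<open>auto intro: degree_add_le\<close>)
  next
    fix r assume "r \<in> R"
    show "r * a \<in> lead_ideal R x I k"
      unfolding lead_ideal_def
      by (rule CollectI, rule exI[of _ "smult r p"])
        (use p \<open>r \<in> R\<close> I' poly_over_smult[OF R] adjoin_subring(2)[OF R, of x] in
          \<open>auto intro: order_trans[OF degree_smult_le]\<close>)
  }
qed

text \<open>Multiplication by \<open>x ^ (l - k)\<close> shifts the coefficient from
  \<open>k\<close> to \<open>l\<close> and stays in the ideal.\<close>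

lemma lead_ideal_mono:
  assumes R: "subring_set R" and I: "ideal_in (adjoin R x) I" and "I \<subseteq> J" "k \<le> l"
  shows "lead_ideal R x I k \<subseteq> lead_ideal R x J l"
proof
  fix a assume a: "a \<in> lead_ideal R x I k"
  then obtain p where p: "p \<in> poly_over R" "degree p \<le> k" "poly p x \<in> I" "a = coeff p k"
    by (auto simp: lead_ideal_def)
  note I' = ideal_inD[OF I adjoin_subring(1)[OF R]]
  let ?q = "monom 1 (l - k) * p"
  have "degree ?q \<le> (l - k) + k"
    by (rule order_trans[OF degree_mult_le]) (use p(2) in \<open>auto intro: add_mono degree_monom_le\<close>)
  moreover have "?q \<in> poly_over R" using p(1) by (intro poly_over_intros[OF R] subring_one[OF R])
  moreover have "poly ?q x \<in> I"
    using I'(4)[OF _ p(3), of "x ^ (l - k)"] adjoin_subring(3)[OF R] subring_power[OF adjoin_subring(1)[OF R]]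
    by (simp add: poly_monom)
  moreover have "coeff ?q l = a" using p(4) \<open>k \<le> l\<close> by (simp add: coeff_monom_mult)
  ultimately show "a \<in> lead_ideal R x J l"
    unfolding lead_ideal_def using assms(3,4) by force
qed

theorem hilbert_basis:
  assumes R: "subring_set R" and N: "noetherian_set R"
  shows "noetherian_set (adjoin R x)"
  unfolding noetherian_set_def
proof (intro allI impI)
  fix I :: "nat \<Rightarrow> 'a set" assume I: "\<forall>n. ideal_in (adjoin R x) (I n)" "mono I"
  let ?L = "\<lambda>n k. lead_ideal R x (I n) k"
  note S = adjoin_subring[OF R, of x]
  have mono: "?L n k \<subseteq> ?L m l" if "n \<le> m" "k \<le> l" for n m k l
    using lead_ideal_mono[OF R] I that by (auto simp: mono_def)
  have ideal: "ideal_in R (?L n k)" for n k using lead_ideal_ideal[OF R] I(1) by auto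
  have stab: "\<exists>m. \<forall>n\<ge>m. J n = J m" if "\<And>n. ideal_in R (J n)" "mono J" for J :: "nat \<Rightarrow> 'a set"
    using N that unfolding noetherian_set_def by blast
  \<comment> \<open>The diagonal chain settles all degrees \<open>k \<ge> n0\<close> at once. Only
    finitely many \<open>k < n0\<close> remain, so their stabilisation indices have a
    maximum.\<close>
  obtain n0 where n0: "\<And>n. n \<ge> n0 \<Longrightarrow> ?L n n = ?L n0 n0"
    using stab[of "\<lambda>n. ?L n n"] ideal mono by (auto simp: mono_def)
  have "\<exists>m. \<forall>n\<ge>m. ?L n k = ?L m k" for k
    using stab[of "\<lambda>n. ?L n k"] ideal mono by (auto simp: mono_def)
  then obtain nk where nk: "\<And>n k. n \<ge> nk k \<Longrightarrow> ?L n k = ?L (nk k) k" by metis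
  define m where "m = Max (insert n0 (nk ` {..<n0}))"
  have m: "n0 \<le> m" "\<And>k. k < n0 \<Longrightarrow> nk k \<le> m" unfolding m_def by auto
  have L: "?L n k \<subseteq> ?L m k" if "n \<ge> m" for n k
  proof (cases "k < n0")
    case True
    then show ?thesis using nk[of k n] nk[of k m] m(2)[of k] that by auto
  next
    case False
    have "?L n k \<subseteq> ?L (max n k) (max n k)" by (rule mono) auto
    also have "\<dots> = ?L n0 n0" using that m by (intro n0) auto
    also have "\<dots> \<subseteq> ?L m k" using m False by (intro mono) auto
    finally show ?thesis .
  qed
  \<comment> \<open>Descent on the degree: a polynomial with value in \<open>I m\<close> and the
    same coefficient at \<open>d\<close> is subtracted, and the difference still has its value in
    the larger ideal \<open>I n\<close>.\<close>
  have sub: "poly p x \<in> I m"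
    if nm: "n \<ge> m" and "p \<in> poly_over R" "poly p x \<in> I n" "degree p < d" for n p d
    using that(2-)
  proof (induction d arbitrary: p)
    case (Suc d)
    have Im: "I m \<subseteq> I n" using I(2) nm by (auto simp: mono_def)
    note In = ideal_inD[OF I(1)[rule_format] S(1)]
    have "coeff p d \<in> ?L n d" using Suc.prems by (auto simp: lead_ideal_def)
    then obtain q where q: "q \<in> poly_over R" "degree q \<le> d" "poly q x \<in> I m" "coeff p d = coeff q d"
      using subsetD[OF L[OF nm]] unfolding lead_ideal_def by blast
    have pq: "poly (p - q) x \<in> I m"
    proof (cases "p - q = 0")
      case True then show ?thesis using In(2) by simp
    next
      case False
      have "degree (p - q) \<le> d" using Suc.prems q by (intro degree_diff_le) auto
      moreover have "degree (p - q) \<noteq> d"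
        using q(4) False by (metis coeff_diff eq_iff_diff_eq_0 leading_coeff_0_iff)
      moreover have "p - q \<in> poly_over R" using Suc.prems q by (intro poly_over_intros[OF R])
      moreover have "poly (p - q) x \<in> I n" using Suc.prems q Im In(5) by auto
      ultimately show ?thesis by (intro Suc.IH) auto
    qed
    have "poly p x = poly (p - q) x + poly q x" by simp
    then show ?case using In(3)[OF pq q(3)] by metis
  qed simp
  show "\<exists>m. \<forall>n\<ge>m. I n = I m"
  proof (intro exI allI impI antisym)
    fix n assume n: "n \<ge> m"
    show "I m \<subseteq> I n" using I(2) n by (auto simp: mono_def)
    show "I n \<subseteq> I m"
    proof
      fix a assume a: "a \<in> I n"
      then have "a \<in> adjoin R x" using I(1) ideal_inD(1)[OF _ S(1)] by blast
      then obtain p where "p \<in> poly_over R" "a = poly p x" by (auto simp: adjoin_def)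
      then show "a \<in> I m" using sub[OF n, of p "Suc (degree p)"] a by auto
    qed
  qed
qed

section \<open>Extension of homomorphisms\<close>

definition domain_set :: "'r::comm_ring_1 set \<Rightarrow> bool" where
  "domain_set S \<longleftrightarrow> (\<forall>a\<in>S. \<forall>b\<in>S. a * b = 0 \<longrightarrow> a = 0 \<or> b = 0)"

definition hom_set :: "'r::comm_ring_1 set \<Rightarrow> ('r \<Rightarrow> 'k::comm_ring_1) \<Rightarrow> bool" where
  "hom_set R \<beta> \<longleftrightarrow> \<beta> 1 = 1 \<and> (\<forall>a\<in>R. \<forall>b\<in>R. \<beta> (a + b) = \<beta> a + \<beta> b \<and> \<beta> (a * b) = \<beta> a * \<beta> b)"

lemma hom_setD:
  assumes "hom_set R \<beta>" "subring_set R"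
  shows "\<beta> 1 = 1" "\<And>a b. a \<in> R \<Longrightarrow> b \<in> R \<Longrightarrow> \<beta> (a + b) = \<beta> a + \<beta> b"
    "\<And>a b. a \<in> R \<Longrightarrow> b \<in> R \<Longrightarrow> \<beta> (a * b) = \<beta> a * \<beta> b" "\<beta> 0 = 0"
    "\<And>a b. a \<in> R \<Longrightarrow> b \<in> R \<Longrightarrow> \<beta> (a - b) = \<beta> a - \<beta> b"
    "\<And>a k. a \<in> R \<Longrightarrow> \<beta> (a ^ k) = \<beta> a ^ k"
    "\<And>(f :: nat \<Rightarrow> _) A. (\<And>i. i \<in> A \<Longrightarrow> f i \<in> R) \<Longrightarrow> \<beta> (sum f A) = (\<Sum>i\<in>A. \<beta> (f i))"
proof -
  note R = subring_setD[OF assms(2)]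
  show 1: "\<beta> 1 = 1" using assms by (simp add: hom_set_def)
  show a: "\<beta> (a + b) = \<beta> a + \<beta> b" if "a \<in> R" "b \<in> R" for a b using assms that by (simp add: hom_set_def)
  show m: "\<beta> (a * b) = \<beta> a * \<beta> b" if "a \<in> R" "b \<in> R" for a b using assms that by (simp add: hom_set_def)
  show 0: "\<beta> 0 = 0" using a[OF R(2) R(2)] by simp
  show "\<beta> (a - b) = \<beta> a - \<beta> b" if "a \<in> R" "b \<in> R" for a b
    using a[OF R(3)[OF that] that(2)] by simp
  show "\<beta> (a ^ k) = \<beta> a ^ k" if "a \<in> R" for a k
    using that by (induction k) (auto simp: 1 m R)
  show "\<beta> (sum f A) = (\<Sum>i\<in>A. \<beta> (f i))" if "\<And>i. i \<in> A \<Longrightarrow> f i \<in> R" for f :: "nat \<Rightarrow> _" and A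
    using that by (induction A rule: infinite_finite_induct) (auto simp: 0 a R)
qed

lemma map_poly_hom:
  assumes \<beta>: "hom_set R \<beta>" and R: "subring_set R" and p: "p \<in> poly_over R" and q: "q \<in> poly_over R"
  shows "map_poly \<beta> (p + q) = map_poly \<beta> p + map_poly \<beta> q"
    and "map_poly \<beta> (p * q) = map_poly \<beta> p * map_poly \<beta> q"
  using poly_overD[OF p] poly_overD[OF q]
  by (auto intro!: poly_eqI sum.cong simp: coeff_map_poly coeff_mult hom_setD[OF \<beta> R] subring_setD[OF R])

lemma map_poly_hom_smult:
  assumes \<beta>: "hom_set R \<beta>" and R: "subring_set R" and "p \<in> poly_over R" "a \<in> R"
  shows "map_poly \<beta> (smult a p) = smult (\<beta> a) (map_poly \<beta> p)"
  using poly_overD[OF assms(3)] assms(4)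
  by (auto intro!: poly_eqI simp: coeff_map_poly hom_setD[OF \<beta> R] subring_setD[OF R])

text \<open>Division with remainder when leading coefficients are not units: each elimination of a
  top coefficient costs one factor \<open>lead_coeff P\<close>.\<close>

lemma poly_over_pseudo_div:
  assumes R: "subring_set R" and P: "P \<in> poly_over R"
  assumes "q \<in> poly_over R"
  shows "\<exists>k h r. h \<in> poly_over R \<and> r \<in> poly_over R \<and> smult (lead_coeff P ^ k) q = P * h + r \<and>
    (r = 0 \<or> degree r < degree P)"
  using assms(3)
proof (induction "degree q" arbitrary: q rule: less_induct)
  case less
  note intros = poly_over_intros[OF R] subring_setD[OF R] poly_overD[OF P] poly_overD[OF less.prems]
  show ?case
  proof (cases "q = 0 \<or> degree q < degree P")
    case True
    then show ?thesis using less.prems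
      by (intro exI[of _ 0] exI[of _ q]) (auto intro!: intros)
  next
    case False
    define m where "m = monom (lead_coeff q) (degree q - degree P)"
    define q' where "q' = smult (lead_coeff P) q - P * m"
    have m: "m \<in> poly_over R" unfolding m_def by (intro intros)
    have q': "q' \<in> poly_over R" unfolding q'_def using m P less.prems by (intro intros)
    have "degree (P * m) \<le> degree P + (degree q - degree P)"
      by (rule order_trans[OF degree_mult_le]) (auto simp: m_def intro: degree_monom_le)
    then have "degree q' \<le> degree q"
      unfolding q'_def using False by (intro degree_diff_le order_trans[OF degree_smult_le]) auto
    moreover have "coeff q' (degree q) = 0"
    proof -
      have "coeff (P * m) (degree q) = coeff P (degree q - (degree q - degree P)) * lead_coeff q"
        unfolding m_def by (subst mult.commute, subst coeff_monom_mult) (use False in \<open>simp add: mult.commute\<close>)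
      then show ?thesis using False by (simp add: q'_def)
    qed
    ultimately have "q' = 0 \<or> degree q' < degree q"
      by (metis leading_coeff_0_iff le_neq_implies_less)
    then have "\<exists>k h r. h \<in> poly_over R \<and> r \<in> poly_over R \<and> smult (lead_coeff P ^ k) q' = P * h + r \<and>
      (r = 0 \<or> degree r < degree P)"
    proof
      assume "q' = 0"
      then show ?thesis by (intro exI[of _ 0]) (auto intro!: intros)
    next
      assume "degree q' < degree q"
      from less.hyps[OF this q'] show ?thesis .
    qed
    then obtain k h r where IH: "h \<in> poly_over R" "r \<in> poly_over R" "smult (lead_coeff P ^ k) q' = P * h + r"
      "r = 0 \<or> degree r < degree P" by blast
    have "smult (lead_coeff P ^ Suc k) q = P * (h + smult (lead_coeff P ^ k) m) + r"
      using IH(3) by (simp add: q'_def smult_diff_right algebra_simps)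
    moreover have "h + smult (lead_coeff P ^ k) m \<in> poly_over R"
      using IH m by (intro intros)
    ultimately show ?thesis using IH(2,4) by blast
  qed
qed

text \<open>Over a finite field, 1 plus the product of all \<open>[:- a, 1:]\<close> has positive
  degree but no root.\<close>

lemma infinite_alg_closed_field: "infinite (UNIV :: 'k::alg_closed_field set)"
proof
  assume fin: "finite (UNIV :: 'k set)"
  define p :: "'k poly" where "p = (\<Prod>a\<in>UNIV. [:- a, 1:]) + 1"
  have "degree (\<Prod>a\<in>(UNIV :: 'k set). [:- a, 1:]) = card (UNIV :: 'k set)"
    by (subst degree_prod_eq_sum_degree) auto
  then have "degree p > 0"
    unfolding p_def using fin by (subst degree_add_eq_left) (auto simp: card_gt_0_iff)
  then obtain x where "poly p x = 0" using alg_closed_imp_poly_has_root by blast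
  moreover have "poly p x = 1" unfolding p_def using fin by (simp add: poly_prod prod_zero_iff)
  ultimately show False by simp
qed

text \<open>The extension evaluates the transported polynomial at \<open>c\<close>. Two polynomials
  with the same value at \<open>x\<close> differ by a relation, so \<open>root\<close> is exactly
  what makes the choice of a representative irrelevant.\<close>

lemma hom_extend_root:
  fixes \<beta> :: "'r::comm_ring_1 \<Rightarrow> 'k::field"
  assumes R: "subring_set R" and \<beta>: "hom_set R \<beta>"
    and root: "\<And>q. q \<in> poly_over R \<Longrightarrow> poly q x = 0 \<Longrightarrow> poly (map_poly \<beta> q) c = 0"
  shows "\<exists>\<beta>'. hom_set (adjoin R x) \<beta>' \<and> (\<forall>a\<in>R. \<beta>' a = \<beta> a) \<and> \<beta>' x = c \<and>
    (\<forall>q\<in>poly_over R. \<beta>' (poly q x) = poly (map_poly \<beta> q) c)"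
proof -
  define \<beta>' where "\<beta>' a = poly (map_poly \<beta> (SOME q. q \<in> poly_over R \<and> a = poly q x)) c" for a
  note b0 = hom_setD(4)[OF \<beta> R]
  have ev: "\<beta>' (poly q x) = poly (map_poly \<beta> q) c" if q: "q \<in> poly_over R" for q
  proof -
    define q' where "q' = (SOME q'. q' \<in> poly_over R \<and> poly q x = poly q' x)"
    have q': "q' \<in> poly_over R" "poly q x = poly q' x"
      using someI[of "\<lambda>q'. q' \<in> poly_over R \<and> poly q x = poly q' x" q] q by (auto simp: q'_def)
    have d: "q - q' \<in> poly_over R" using q q' poly_over_diff[OF R] by blast
    then have "poly (map_poly \<beta> (q - q')) c = 0" using q'(2) by (intro root) auto
    moreover have "map_poly \<beta> (q - q') + map_poly \<beta> q' = map_poly \<beta> q"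
      using map_poly_hom(1)[OF \<beta> R d q'(1)] by simp
    ultimately have "poly (map_poly \<beta> q) c = poly (map_poly \<beta> q') c"
      by (metis add_0 poly_add)
    then show ?thesis by (simp add: \<beta>'_def q'_def)
  qed
  note intros = poly_over_intros[OF R] subring_setD[OF R]
  show ?thesis
  proof (intro exI[of _ \<beta>'] conjI ballI)
    have const: "\<beta>' a = \<beta> a" if "a \<in> R" for a
      using ev[OF poly_over_const[OF R that]] b0 by (simp add: map_poly_pCons)
    show "\<beta>' a = \<beta> a" if "a \<in> R" for a using const[OF that] .
    show "\<beta>' x = c" using ev[OF poly_over_monom[OF R subring_one[OF R], of 1]] b0 hom_setD(1)[OF \<beta> R]
      by (simp add: map_poly_monom poly_monom)
    show "hom_set (adjoin R x) \<beta>'"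
      unfolding hom_set_def
    proof (intro conjI ballI)
      show "\<beta>' 1 = 1" using const[OF subring_one[OF R]] hom_setD(1)[OF \<beta> R] by simp
      fix a b assume "a \<in> adjoin R x" "b \<in> adjoin R x"
      then obtain p q where pq: "p \<in> poly_over R" "q \<in> poly_over R" "a = poly p x" "b = poly q x"
        by (auto simp: adjoin_def)
      show "\<beta>' (a + b) = \<beta>' a + \<beta>' b"
        using ev[OF poly_over_add[OF R pq(1,2)]] ev[OF pq(1)] ev[OF pq(2)] map_poly_hom[OF \<beta> R pq(1,2)]
        by (simp add: pq)
      show "\<beta>' (a * b) = \<beta>' a * \<beta>' b"
        using ev[OF poly_over_mult[OF R pq(1,2)]] ev[OF pq(1)] ev[OF pq(2)] map_poly_hom[OF \<beta> R pq(1,2)]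
        by (simp add: pq)
    qed
  qed (fact ev)
qed

lemma hom_extend_transcendental:
  fixes R :: "'r::comm_ring_1 set" and \<beta> :: "'r \<Rightarrow> 'k::field"
  assumes R: "subring_set R" and \<beta>: "hom_set R \<beta>"
    and trans: "\<And>q. q \<in> poly_over R \<Longrightarrow> poly q x = 0 \<Longrightarrow> q = 0"
  shows "\<exists>\<beta>'. hom_set (adjoin R x) \<beta>' \<and> (\<forall>a\<in>R. \<beta>' a = \<beta> a) \<and> \<beta>' x = c \<and>
    (\<forall>q\<in>poly_over R. \<beta>' (poly q x) = poly (map_poly \<beta> q) c)"
proof -
  have root: "poly (map_poly \<beta> q) c = 0" if "q \<in> poly_over R" "poly q x = 0" for q
    using trans[OF that] by simp
  show ?thesis by (rule hom_extend_root[OF R \<beta> root])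
qed

text \<open>If \<open>x\<close> is transcendental, \<open>b'\<close> is a polynomial in
  \<open>x\<close>, and \<open>x\<close> can be sent to any value off finitely many roots. If
  \<open>x\<close> is algebraic, a nonzero multiple of \<open>b'\<close> lies in \<open>R\<close>.
  Turning \<open>b'\<close> into an element of the smaller ring lets the nonvanishing condition be
  passed down a tower.\<close>

lemma hom_extension_step:
  fixes R :: "'r::comm_ring_1 set"
  assumes R: "subring_set R" and dom: "domain_set (adjoin R x)"
    and b': "b' \<in> adjoin R x" "b' \<noteq> 0"
  obtains b where "b \<in> R" "b \<noteq> 0"
    "\<And>\<beta> :: 'r \<Rightarrow> 'k::alg_closed_field. hom_set R \<beta> \<Longrightarrow> \<beta> b \<noteq> 0 \<Longrightarrow>
       \<exists>\<beta>'. hom_set (adjoin R x) \<beta>' \<and> (\<forall>a\<in>R. \<beta>' a = \<beta> a) \<and> \<beta>' b' \<noteq> 0"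
proof -
  note S = adjoin_subring[OF R, of x]
  note intros = poly_over_intros[OF R] subring_setD[OF R]
  have nz: "a * b \<noteq> 0" if "a \<in> adjoin R x" "b \<in> adjoin R x" "a \<noteq> 0" "b \<noteq> 0" for a b
    using dom that unfolding domain_set_def by blast
  have nzR: "a * b \<noteq> 0" if "a \<in> R" "b \<in> R" "a \<noteq> 0" "b \<noteq> 0" for a b
    using nz that S(2) by blast
  have nzpow: "a ^ k \<noteq> 0" if "a \<in> R" "a \<noteq> 0" for a k
    using that
  proof (induction k)
    case 0
    have "(1 :: 'r) \<noteq> 0" by simp
    then show ?case by simp
  next
    case (Suc k) then show ?case using nzR[of a "a ^ k"] by (auto intro: intros)
  qed
  obtain p where p: "p \<in> poly_over R" "b' = poly p x" using b'(1) by (auto simp: adjoin_def)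
  have p0: "p \<noteq> 0" using p b'(2) by auto
  show ?thesis
  proof (cases "\<exists>P. P \<in> poly_over R \<and> P \<noteq> 0 \<and> poly P x = 0")
    case False
    show ?thesis
    proof (rule that[of "lead_coeff p"])
      show "lead_coeff p \<in> R" "lead_coeff p \<noteq> 0" using p p0 by (auto simp: poly_over_def)
      fix \<beta> :: "'r \<Rightarrow> 'k" assume \<beta>: "hom_set R \<beta>" "\<beta> (lead_coeff p) \<noteq> 0"
      have "coeff (map_poly \<beta> p) (degree p) \<noteq> 0"
        using \<beta>(2) by (simp add: coeff_map_poly hom_setD[OF \<beta>(1) R])
      then have "map_poly \<beta> p \<noteq> 0" by auto
      then have "finite {c. poly (map_poly \<beta> p) c = 0}" by (rule poly_roots_finite)
      then obtain c where c: "poly (map_poly \<beta> p) c \<noteq> 0"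
        using infinite_alg_closed_field[where 'k = 'k] by (metis (mono_tags) UNIV_I finite_subset mem_Collect_eq subsetI)
      have tr: "q = 0" if "q \<in> poly_over R" "poly q x = 0" for q using False that by blast
      from hom_extend_transcendental[OF R \<beta>(1) tr, where c = c]
      obtain \<beta>' where "hom_set (adjoin R x) \<beta>'" "\<forall>a\<in>R. \<beta>' a = \<beta> a"
        "\<forall>q\<in>poly_over R. \<beta>' (poly q x) = poly (map_poly \<beta> q) c" by blast
      then show "\<exists>\<beta>'. hom_set (adjoin R x) \<beta>' \<and> (\<forall>a\<in>R. \<beta>' a = \<beta> a) \<and> \<beta>' b' \<noteq> 0"
        using c p by (intro exI[of _ \<beta>']) auto
    qed
  next
    case True
    \<comment> \<open>A relation \<open>P\<close> of least degree replaces the minimal polynomial.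
      It need not be monic, so pseudo-division by it brings in powers of its leading
      coefficient.\<close>
    define Q where "Q P \<longleftrightarrow> P \<in> poly_over R \<and> P \<noteq> 0 \<and> poly P x = 0" for P
    obtain P where P: "Q P" "\<And>P'. Q P' \<Longrightarrow> degree P \<le> degree P'"
      using ex_has_least_nat[of Q _ degree] True unfolding Q_def by metis
    have P': "P \<in> poly_over R" "P \<noteq> 0" "poly P x = 0" using P(1) by (auto simp: Q_def)
    have lP: "lead_coeff P \<in> R" "lead_coeff P \<noteq> 0" using P' by (auto simp: poly_over_def)
    have dP: "degree P > 0"
    proof (rule ccontr)
      assume "\<not> degree P > 0"
      then obtain a where "P = [:a:]" by (metis degree_eq_zeroE gr0I)
      then show False using P' by simp
    qed
    text \<open>Among the polynomials whose value at \<open>x\<close> is a multiple of \<open>b'\<close>, one of least degree is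
      constant: otherwise it would divide \<open>P\<close> up to a scalar.\<close>
    define I where "I r \<longleftrightarrow> r \<in> poly_over R \<and> r \<noteq> 0 \<and> (\<exists>s\<in>adjoin R x. poly r x = b' * s)" for r
    have "I p" unfolding I_def using p p0 subring_one[OF S(1)] by (auto intro: bexI[of _ 1])
    then obtain r where r: "I r" "\<And>r'. I r' \<Longrightarrow> degree r \<le> degree r'"
      using ex_has_least_nat[of I p degree] by metis
    obtain s where r': "r \<in> poly_over R" "r \<noteq> 0" and s: "s \<in> adjoin R x" "poly r x = b' * s"
      using r(1) by (auto simp: I_def)
    have lr: "lead_coeff r \<in> R" "lead_coeff r \<noteq> 0" using r' by (auto simp: poly_over_def)
    have divides: "\<exists>k h. h \<in> poly_over R \<and> smult (lead_coeff r ^ k) q = r * h"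
      if q: "q \<in> poly_over R" "t \<in> adjoin R x" "poly q x = b' * t" for q t
    proof -
      obtain k h r1 where k: "h \<in> poly_over R" "r1 \<in> poly_over R" "smult (lead_coeff r ^ k) q = r * h + r1"
        "r1 = 0 \<or> degree r1 < degree r" using poly_over_pseudo_div[OF R r'(1) q(1)] by blast
      have "r1 = 0"
      proof (rule ccontr)
        assume "r1 \<noteq> 0"
        have "poly r1 x = poly (smult (lead_coeff r ^ k) q) x - poly (r * h) x" by (simp add: k(3))
        also have "\<dots> = b' * (lead_coeff r ^ k * t - s * poly h x)"
          by (simp add: q(3) s(2) algebra_simps)
        finally have "poly r1 x = b' * (lead_coeff r ^ k * t - s * poly h x)" .
        moreover have "lead_coeff r ^ k * t - s * poly h x \<in> adjoin R x"
          using q(2) s(1) lr(1) S(2) k(1)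
          by (intro subring_setD[OF S(1)]) (auto simp: adjoin_def)
        ultimately have "I r1" using k(2) \<open>r1 \<noteq> 0\<close> by (auto simp: I_def)
        from r(2)[OF this] k(4) \<open>r1 \<noteq> 0\<close> show False by auto
      qed
      then show ?thesis using k by auto
    qed
    have dr: "degree r = 0"
    proof (rule ccontr)
      assume "degree r \<noteq> 0"
      obtain k h where h: "h \<in> poly_over R" "smult (lead_coeff r ^ k) P = r * h"
        using divides[OF P'(1) subring_zero[OF S(1)]] P'(3) by auto
      have lrk: "lead_coeff r ^ k \<in> R" "lead_coeff r ^ k \<noteq> 0" using lr nzpow by (auto intro: intros)
      have "lead_coeff r ^ k * lead_coeff P \<noteq> 0" using nzR lrk lP by blast
      then have cP: "coeff (smult (lead_coeff r ^ k) P) (degree P) \<noteq> 0" by simp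
      have ne: "smult (lead_coeff r ^ k) P \<noteq> 0" using cP by (metis coeff_0)
      have deg: "degree (smult (lead_coeff r ^ k) P) = degree P"
        by (rule antisym[OF degree_smult_le le_degree[OF cP]])
      have h0: "h \<noteq> 0" using ne h(2) by auto
      have lh: "lead_coeff h \<in> R" "lead_coeff h \<noteq> 0" using h h0 by (auto simp: poly_over_def)
      have "coeff (r * h) (degree r + degree h) \<noteq> 0"
        using nzR[OF lr(1) lh(1) lr(2) lh(2)] by (simp add: coeff_mult_degree_sum)
      then have "degree r + degree h \<le> degree P" using deg h(2) le_degree by metis
      then have "degree h < degree P" using \<open>degree r \<noteq> 0\<close> by simp
      \<comment> \<open>The cofactor \<open>h\<close> has smaller degree than \<open>P\<close>, so
        by minimality it does not vanish at \<open>x\<close>. Hence \<open>r\<close> does, and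
        dividing \<open>p\<close> by \<open>r\<close> would show that a power of
        \<open>lead_coeff r\<close> annihilates \<open>b'\<close>.\<close>
      then have hx: "poly h x \<noteq> 0" using P(2)[of h] h h0 by (auto simp: Q_def)
      have "poly r x * poly h x = 0" using arg_cong[OF h(2), of "\<lambda>q. poly q x"] P'(3) by simp
      then have rx: "poly r x = 0" using nz[of "poly r x" "poly h x"] hx r' h(1) by (auto simp: adjoin_def)
      obtain k2 h2 where h2: "smult (lead_coeff r ^ k2) p = r * h2"
        using divides[OF p(1) subring_one[OF S(1)]] p(2) by auto
      have "lead_coeff r ^ k2 * b' = 0"
        using arg_cong[OF h2, of "\<lambda>q. poly q x"] rx p(2) by simp
      moreover have "lead_coeff r ^ k2 \<in> adjoin R x" "lead_coeff r ^ k2 \<noteq> 0"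
        using lr nzpow S(2) by (auto intro!: intros subsetD[OF S(2)])
      ultimately show False using nz b' by blast
    qed
    then obtain r0 where r0: "r = [:r0:]" by (metis degree_eq_zeroE)
    have r0': "r0 \<in> R" "r0 \<noteq> 0" "r0 = b' * s" using r' s r0 lr by auto
    \<comment> \<open>\<open>lead_coeff P\<close> keeps the degree of the transported relation
      positive, so that it has a root; \<open>r0 = b' * s\<close> prevents \<open>b'\<close> from
      being sent to 0.\<close>
    show ?thesis
    proof (rule that[of "lead_coeff P * r0"])
      show "lead_coeff P * r0 \<in> R" "lead_coeff P * r0 \<noteq> 0"
        using lP r0' nzR by (auto intro: intros)
      fix \<beta> :: "'r \<Rightarrow> 'k" assume \<beta>: "hom_set R \<beta>" "\<beta> (lead_coeff P * r0) \<noteq> 0"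
      note hb = hom_setD[OF \<beta>(1) R]
      have nzb: "\<beta> (lead_coeff P) \<noteq> 0" "\<beta> r0 \<noteq> 0" using \<beta>(2) lP r0' by (auto simp: hb)
      have "coeff (map_poly \<beta> P) (degree P) \<noteq> 0" using nzb(1) by (simp add: coeff_map_poly hb)
      then have "degree (map_poly \<beta> P) > 0" using dP le_degree by (metis less_le_trans)
      then obtain c where c: "poly (map_poly \<beta> P) c = 0" using alg_closed_imp_poly_has_root by blast
      \<comment> \<open>Every relation becomes a multiple of \<open>P\<close> after scaling by a
        power of \<open>lead_coeff P\<close>, since the remainder would be a relation of smaller
        degree. The scalar is not killed by \<beta> and cancels.\<close>
      have root: "poly (map_poly \<beta> q) c = 0" if q: "q \<in> poly_over R" "poly q x = 0" for q
      proof -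
        obtain k h r1 where k: "h \<in> poly_over R" "r1 \<in> poly_over R" "smult (lead_coeff P ^ k) q = P * h + r1"
          "r1 = 0 \<or> degree r1 < degree P" using poly_over_pseudo_div[OF R P'(1) q(1)] by blast
        have "poly r1 x = 0" using arg_cong[OF k(3), of "\<lambda>q. poly q x"] P'(3) q(2) by simp
        then have "r1 = 0" using k(2,4) P(2)[of r1] unfolding Q_def by linarith
        then have "map_poly \<beta> (smult (lead_coeff P ^ k) q) = map_poly \<beta> (P * h)" using k(3) by simp
        then have "smult (\<beta> (lead_coeff P) ^ k) (map_poly \<beta> q) = map_poly \<beta> P * map_poly \<beta> h"
          using map_poly_hom_smult[OF \<beta>(1) R q(1)] map_poly_hom(2)[OF \<beta>(1) R P'(1) k(1)] lP
          by (simp add: hb subring_power[OF R])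
        from arg_cong[OF this, of "\<lambda>q. poly q c"] show ?thesis using c nzb(1) by simp
      qed
      from hom_extend_root[OF R \<beta>(1) root]
      obtain \<beta>' where e: "hom_set (adjoin R x) \<beta>'" "\<And>a. a \<in> R \<Longrightarrow> \<beta>' a = \<beta> a" by blast
      have "\<beta>' b' * \<beta>' s \<noteq> 0"
        using hom_setD(3)[OF e(1) S(1) b'(1) s(1)] e(2)[OF r0'(1)] r0'(3) nzb(2) by simp
      then show "\<exists>\<beta>'. hom_set (adjoin R x) \<beta>' \<and> (\<forall>a\<in>R. \<beta>' a = \<beta> a) \<and> \<beta>' b' \<noteq> 0"
        using e by (intro exI[of _ \<beta>']) auto
    qed
  qed
qed

text \<open>A form of Chevalley's extension theorem. The generators are adjoined one at a time, and
  the condition found for the upper ring is moved down at each step. \<open>T\<close> is kept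
  abstract, as it matters only that it contains the generators.\<close>

lemma hom_extension:
  fixes R :: "'r::comm_ring_1 set"
  assumes "subring_set R" and "subring_set S" "domain_set S" "R \<subseteq> S" "set xs \<subseteq> S"
  shows "\<exists>b T. b \<in> R \<and> b \<noteq> 0 \<and> subring_set T \<and> R \<subseteq> T \<and> set xs \<subseteq> T \<and>
    (\<forall>\<beta> :: 'r \<Rightarrow> 'k::alg_closed_field. hom_set R \<beta> \<longrightarrow> \<beta> b \<noteq> 0 \<longrightarrow>
       (\<exists>\<beta>'. hom_set T \<beta>' \<and> (\<forall>a\<in>R. \<beta>' a = \<beta> a)))"
  using assms
proof (induction xs arbitrary: R)
  case Nil
  show ?case
    by (rule exI[of _ 1], rule exI[of _ R]) (use Nil in \<open>auto intro: subring_one\<close>)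
next
  case (Cons x xs)
  note A = adjoin_subring[OF \<open>subring_set R\<close>, of x]
  have AS: "adjoin R x \<subseteq> S" using Cons.prems by (intro adjoin_least) auto
  obtain b' T where T: "b' \<in> adjoin R x" "b' \<noteq> 0" "subring_set T" "adjoin R x \<subseteq> T" "set xs \<subseteq> T"
    "\<And>\<beta> :: 'r \<Rightarrow> 'k. hom_set (adjoin R x) \<beta> \<Longrightarrow> \<beta> b' \<noteq> 0 \<Longrightarrow>
       \<exists>\<beta>'. hom_set T \<beta>' \<and> (\<forall>a\<in>adjoin R x. \<beta>' a = \<beta> a)"
    using Cons.IH[of "adjoin R x"] Cons.prems A AS by auto
  have "domain_set (adjoin R x)" using AS \<open>domain_set S\<close> unfolding domain_set_def by blast
  from hom_extension_step[OF \<open>subring_set R\<close> this T(1,2), where 'k = 'k]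
  obtain b where b: "b \<in> R" "b \<noteq> 0"
    "\<And>\<beta> :: 'r \<Rightarrow> 'k. hom_set R \<beta> \<Longrightarrow> \<beta> b \<noteq> 0 \<Longrightarrow>
       \<exists>\<beta>'. hom_set (adjoin R x) \<beta>' \<and> (\<forall>a\<in>R. \<beta>' a = \<beta> a) \<and> \<beta>' b' \<noteq> 0" by blast
  show ?case
  proof (intro exI[of _ b] exI[of _ T] conjI allI impI)
    show "R \<subseteq> T" "set (x # xs) \<subseteq> T" using A T(4,5) by auto
    fix \<beta> :: "'r \<Rightarrow> 'k" assume "hom_set R \<beta>" "\<beta> b \<noteq> 0"
    from b(3)[OF this] obtain \<beta>1 where 1: "hom_set (adjoin R x) \<beta>1" "\<forall>a\<in>R. \<beta>1 a = \<beta> a" "\<beta>1 b' \<noteq> 0" by blast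
    from T(6)[OF 1(1,3)] obtain \<beta>' where "hom_set T \<beta>'" "\<forall>a\<in>adjoin R x. \<beta>' a = \<beta>1 a" by blast
    then show "\<exists>\<beta>'. hom_set T \<beta>' \<and> (\<forall>a\<in>R. \<beta>' a = \<beta> a)" using 1(2) A(2) by (intro exI[of _ \<beta>']) auto
  qed (use b T in auto)
qed

section \<open>Polynomial functions of bounded degree\<close>

text \<open>A bound on the total degree, read off a way of building the function; it is not an
  invariant of the function. The slack in \<open>coord\<close> and in \<open>d + e \<le> f\<close>
  makes the predicate monotone in \<open>d\<close>.\<close>

inductive poly_deg :: "nat \<Rightarrow> nat \<Rightarrow> ((nat \<Rightarrow> 'k::comm_ring_1) \<Rightarrow> 'k) \<Rightarrow> bool" for N where
  const: "poly_deg N d (\<lambda>_. c)"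
| coord: "i < N \<Longrightarrow> 1 \<le> d \<Longrightarrow> poly_deg N d (\<lambda>x. x i)"
| add: "poly_deg N d P \<Longrightarrow> poly_deg N d Q \<Longrightarrow> poly_deg N d (\<lambda>x. P x + Q x)"
| mult: "poly_deg N d P \<Longrightarrow> poly_deg N e Q \<Longrightarrow> d + e \<le> f \<Longrightarrow> poly_deg N f (\<lambda>x. P x * Q x)"

lemma poly_deg_mono: "poly_deg N d P \<Longrightarrow> d \<le> e \<Longrightarrow> poly_deg N e P"
proof (induction arbitrary: e rule: poly_deg.induct)
  case (mult d P d' Q f)
  show ?case by (rule poly_deg.mult[OF mult.hyps(1,2)]) (use mult in simp)
qed (auto intro: poly_deg.intros)

lemma polynomial_functions_iff: "P \<in> polynomial_functions N \<longleftrightarrow> (\<exists>d. poly_deg N d P)"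
proof
  assume "P \<in> polynomial_functions N"
  then show "\<exists>d. poly_deg N d P"
  proof induction
    case (add P Q)
    then obtain d e where "poly_deg N d P" "poly_deg N e Q" by auto
    then have "poly_deg N (max d e) P" "poly_deg N (max d e) Q" by (auto intro: poly_deg_mono)
    then show ?case by (auto intro: poly_deg.add)
  qed (auto intro: poly_deg.intros)
next
  assume "\<exists>d. poly_deg N d P"
  then obtain d where "poly_deg N d P" ..
  then show "P \<in> polynomial_functions N"
    by induction (auto intro: polynomial_functions.intros)
qed

lemma poly_deg_sum:
  assumes "\<And>i. i \<in> A \<Longrightarrow> poly_deg N d (f i)"
  shows "poly_deg N d (\<lambda>x. \<Sum>i\<in>A. f i x)"
  using assms by (induction A rule: infinite_finite_induct) (auto intro: poly_deg.intros)

lemma poly_deg_prod: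
  assumes "\<And>i. i \<in> A \<Longrightarrow> poly_deg N d (f i)"
  shows "poly_deg N (card A * d) (\<lambda>x. \<Prod>i\<in>A. f i x)"
  using assms
  by (induction A rule: infinite_finite_induct)
    (auto intro: poly_deg.const poly_deg.mult[OF _ _ order_refl])

lemma poly_deg_power: "poly_deg N d P \<Longrightarrow> poly_deg N (k * d) (\<lambda>x. P x ^ k)"
  by (induction k) (auto intro: poly_deg.const poly_deg.mult[OF _ _ order_refl])

lemma poly_deg_cmult: "poly_deg N d P \<Longrightarrow> poly_deg N d (\<lambda>x. c * P x)"
  using poly_deg.mult[OF poly_deg.const[of N 0 c], of d P d] by simp

lemma poly_deg_diff:
  assumes "poly_deg N d P" "poly_deg N d Q" shows "poly_deg N d (\<lambda>x. P x - Q x)"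
  using poly_deg.add[OF assms(1) poly_deg_cmult[OF assms(2), of "- 1"]] by simp

text \<open>Homogenisation: substituting the fractions \<open>p i / q\<close> into a polynomial of
  degree \<open>d\<close> and clearing denominators costs the factor \<open>q ^ d\<close>. The
  equations avoid division, so they make sense where \<open>q\<close> vanishes.\<close>

lemma poly_deg_compose:
  assumes "poly_deg N d P" and p: "\<And>i. i < N \<Longrightarrow> poly_deg M D (p i)" and q: "poly_deg M D q"
  shows "\<exists>R. poly_deg M (d * D) R \<and>
    (\<forall>x y. (\<forall>i<N. y i * q x = p i x) \<longrightarrow> R x = P y * q x ^ d)"
  using assms(1)
proof induction
  case (const d c)
  show ?case
    by (intro exI[of _ "\<lambda>x. c * q x ^ d"]) (auto intro!: poly_deg_cmult poly_deg_power q)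
next
  case (coord i d)
  have "poly_deg M (d * D) (\<lambda>x. p i x * q x ^ (d - 1))"
    by (rule poly_deg.mult[OF p[OF coord(1)] poly_deg_power[OF q]])
      (use coord in \<open>cases d, auto\<close>)
  moreover have "p i x * q x ^ (d - 1) = y i * q x ^ d" if "\<forall>i<N. y i * q x = p i x" for x y
  proof -
    have "q x ^ d = q x * q x ^ (d - 1)" using coord(2) by (cases d) auto
    then show ?thesis using that coord(1) by (simp flip: mult.assoc)
  qed
  ultimately show ?case by blast
next
  case (add d P Q)
  then obtain R R' where R: "poly_deg M (d * D) R" "poly_deg M (d * D) R'"
    "\<forall>x y. (\<forall>i<N. y i * q x = p i x) \<longrightarrow> R x = P y * q x ^ d"
    "\<forall>x y. (\<forall>i<N. y i * q x = p i x) \<longrightarrow> R' x = Q y * q x ^ d" by auto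
  show ?case
    by (rule exI[of _ "\<lambda>x. R x + R' x"]) (use R in \<open>auto intro: poly_deg.add simp: distrib_right\<close>)
next
  case (mult d P e Q f)
  then obtain R R' where R: "poly_deg M (d * D) R" "poly_deg M (e * D) R'"
    "\<forall>x y. (\<forall>i<N. y i * q x = p i x) \<longrightarrow> R x = P y * q x ^ d"
    "\<forall>x y. (\<forall>i<N. y i * q x = p i x) \<longrightarrow> R' x = Q y * q x ^ e" by auto
  have "poly_deg M ((d + e) * D) (\<lambda>x. R x * R' x)"
    by (rule poly_deg.mult[OF R(1,2)]) (simp add: algebra_simps)
  then have "poly_deg M (f * D) (\<lambda>x. R x * R' x * q x ^ (f - (d + e)))"
    by (rule poly_deg.mult[OF _ poly_deg_power[OF q]])
      (use mult(3) in \<open>simp add: add_mult_distrib[symmetric]\<close>)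
  moreover have "q x ^ f = q x ^ d * q x ^ e * q x ^ (f - (d + e))" for x
    using mult(3) by (simp add: power_add[symmetric])
  moreover have "R x * R' x * q x ^ (f - (d + e)) = P y * Q y * (q x ^ d * q x ^ e * q x ^ (f - (d + e)))"
    if "\<forall>i<N. y i * q x = p i x" for x y
  proof -
    have "R x = P y * q x ^ d" "R' x = Q y * q x ^ e" using R(3,4) that by blast+
    then show ?thesis by (simp only: mult_ac)
  qed
  ultimately show ?case
    by (intro exI[of _ "\<lambda>x. R x * R' x * q x ^ (f - (d + e))"]) metis
qed

section \<open>Dimensions of spaces of functions\<close>

definition fscale :: "'k::field \<Rightarrow> ('p \<Rightarrow> 'k) \<Rightarrow> 'p \<Rightarrow> 'k" where
  "fscale c f = (\<lambda>x. c * f x)"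

interpretation fv: vector_space "fscale :: 'k::field \<Rightarrow> ('p \<Rightarrow> 'k) \<Rightarrow> 'p \<Rightarrow> 'k"
  by unfold_locales (auto simp: fscale_def algebra_simps fun_eq_iff)

lemma sum_fun_apply: "(\<Sum>i\<in>A. f i) x = (\<Sum>i\<in>A. f i x :: 'k::comm_monoid_add)"
  by (induction A rule: infinite_finite_induct) auto

lemma family_card_le_spanning:
  fixes g :: "'i \<Rightarrow> 'p \<Rightarrow> 'k::field"
  assumes "finite I" "finite T" and span: "\<And>i. i \<in> I \<Longrightarrow> g i \<in> fv.span T"
    and indep: "\<And>u. (\<forall>x. (\<Sum>i\<in>I. u i * g i x) = 0) \<Longrightarrow> \<forall>i\<in>I. u i = 0"
  shows "card I \<le> card T"
proof -
  have inj: "inj_on g I"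
  proof
    fix i j assume ij: "i \<in> I" "j \<in> I" "g i = g j"
    show "i = j"
    proof (rule ccontr)
      assume "i \<noteq> j"
      \<comment> \<open>Two equal members would give a relation with coefficients 1 and -1.\<close>
      have "(\<Sum>k\<in>I. (if k = i then 1 else if k = j then -1 else 0) * g k x) = 0" for x
      proof -
        have "(\<Sum>k\<in>I. (if k = i then 1 else if k = j then -1 else 0) * g k x)
            = (\<Sum>k\<in>{i, j}. (if k = i then 1 else if k = j then -1 else 0) * g k x)"
          using ij assms(1) by (intro sum.mono_neutral_right) auto
        also have "\<dots> = 0" using \<open>i \<noteq> j\<close> ij by simp
        finally show ?thesis .
      qed
      from indep[OF allI[OF this]] ij(1) show False by (metis one_neq_zero)
    qed
  qed
  have "\<not> fv.dependent (g ` I)"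
  proof
    assume "fv.dependent (g ` I)"
    then obtain u v where u: "v \<in> g ` I" "u v \<noteq> 0" "(\<Sum>v\<in>g ` I. fscale (u v) v) = 0"
      using fv.dependent_finite[of "g ` I"] assms(1) by auto
    have 0: "(\<Sum>i\<in>I. fscale (u (g i)) (g i)) = 0" using u(3) by (simp add: sum.reindex[OF inj] o_def)
    have "(\<Sum>i\<in>I. u (g i) * g i x) = 0" for x
      using fun_cong[OF 0, of x] by (simp add: sum_fun_apply fscale_def)
    from indep[of "\<lambda>i. u (g i)", OF allI[OF this]] u(1,2) show False by auto
  qed
  then have "card (g ` I) \<le> card T"
    using fv.independent_span_bound[OF assms(2), of "g ` I"] span by auto
  then show ?thesis using card_image[OF inj] by simp
qed

lemma basis_of_function_space:
  fixes V :: "('p \<Rightarrow> 'k::field) set"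
  assumes "finite T" "V \<subseteq> fv.span T"
  obtains B where "B \<subseteq> V" "finite B" "card B = fv.dim V" "V \<subseteq> fv.span B" "fv.dim V \<le> card T"
    "\<forall>u. (\<forall>x. (\<Sum>b\<in>B. u b * b x) = 0) \<longrightarrow> (\<forall>b\<in>B. u b = 0)"
proof -
  obtain B where B: "B \<subseteq> V" "fv.independent B" "V \<subseteq> fv.span B" "card B = fv.dim V"
    using fv.basis_exists by blast
  have fin: "finite B" "card B \<le> card T"
    using fv.independent_span_bound[OF assms(1) B(2)] B(1) assms(2) by auto
  have "\<forall>b\<in>B. u b = 0" if "\<forall>x. (\<Sum>b\<in>B. u b * b x) = 0" for u
  proof -
    have "(\<Sum>b\<in>B. fscale (u b) b) = 0" using that by (auto simp: fun_eq_iff sum_fun_apply fscale_def)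
    then show ?thesis using B(2) fv.dependent_finite[OF fin(1)] by blast
  qed
  with B fin show ?thesis by (intro that[of B]) auto
qed

lemma span_times:
  fixes A B C :: "('p \<Rightarrow> 'k::field) set"
  assumes "f \<in> fv.span A" "g \<in> fv.span B" "\<And>a b. a \<in> A \<Longrightarrow> b \<in> B \<Longrightarrow> a * b \<in> fv.span C"
  shows "f * g \<in> fv.span C"
proof -
  have sc: "fscale c a * b = fscale c (a * b)" "a * fscale c b = fscale c (a * b)"
    for c and a b :: "'p \<Rightarrow> 'k"
    by (auto simp: fscale_def mult_ac)
  have 1: "a * g \<in> fv.span C" if "a \<in> A" for a
    using assms(2)
  proof (induction rule: fv.span_induct_alt)
    case base
    show ?case unfolding mult_zero_right by (rule fv.span_zero)
  next
    case (step c x y)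
    then show ?case
      unfolding distrib_left sc by (blast intro: fv.span_add fv.span_scale assms(3) that)
  qed
  show ?thesis
    using assms(1)
  proof (induction rule: fv.span_induct_alt)
    case base
    show ?case unfolding mult_zero_left by (rule fv.span_zero)
  next
    case (step c x y)
    then show ?case
      unfolding distrib_right sc by (blast intro: fv.span_add fv.span_scale 1)
  qed
qed

lemma span_linear_image:
  fixes L :: "('p \<Rightarrow> 'k::field) \<Rightarrow> 'q \<Rightarrow> 'k"
  assumes "f \<in> fv.span A" "\<And>f g. L (f + g) = L f + L g" "\<And>c f. L (fscale c f) = fscale c (L f)"
    and "\<And>a. a \<in> A \<Longrightarrow> L a \<in> fv.span C"
  shows "L f \<in> fv.span C"
proof -
  have "L 0 = 0" using assms(2)[of 0 0] by simp
  show ?thesis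
    using assms(1)
  proof (induction rule: fv.span_induct_alt)
    case base
    show ?case unfolding \<open>L 0 = 0\<close> by (rule fv.span_zero)
  next
    case (step c x y)
    then show ?case
      unfolding assms(2,3) by (blast intro: fv.span_add fv.span_scale assms(4))
  qed
qed

definition monomial_fun :: "nat \<Rightarrow> (nat \<Rightarrow> nat) \<Rightarrow> (nat \<Rightarrow> 'k::field) \<Rightarrow> 'k" where
  "monomial_fun N \<alpha> = (\<lambda>x. \<Prod>i<N. x i ^ \<alpha> i)"

text \<open>Bounding each exponent by \<open>d\<close> admits more monomials than total degree
  \<open>d\<close> requires, but their number is at most \<open>(d + 1) ^ N\<close>, which is all
  that the growth argument uses.\<close>

definition monomials :: "nat \<Rightarrow> nat \<Rightarrow> ((nat \<Rightarrow> 'k::field) \<Rightarrow> 'k) set" where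
  "monomials N d = monomial_fun N ` ({..<N} \<rightarrow>\<^sub>E {..d})"

lemma monomials_finite: "finite (monomials N d)" "card (monomials N d) \<le> (d + 1) ^ N"
proof -
  show "finite (monomials N d)" unfolding monomials_def by (intro finite_imageI finite_PiE) auto
  have "card (monomials N d) \<le> card ({..<N} \<rightarrow>\<^sub>E {..d})"
    unfolding monomials_def by (intro card_image_le finite_PiE) auto
  then show "card (monomials N d) \<le> (d + 1) ^ N" by (simp add: card_PiE)
qed

lemma monomial_funI: "(\<And>i. i < N \<Longrightarrow> \<alpha> i \<le> d) \<Longrightarrow> monomial_fun N \<alpha> \<in> monomials N d"
proof -
  assume le: "\<And>i. i < N \<Longrightarrow> \<alpha> i \<le> d"
  have "monomial_fun N \<alpha> = monomial_fun N (restrict \<alpha> {..<N})"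
    by (auto simp: monomial_fun_def fun_eq_iff)
  moreover have "restrict \<alpha> {..<N} \<in> {..<N} \<rightarrow>\<^sub>E {..d}" using le by auto
  ultimately show ?thesis unfolding monomials_def by (metis imageI)
qed

lemma poly_deg_span_monomials:
  assumes "poly_deg N d (P :: (nat \<Rightarrow> 'k::field) \<Rightarrow> 'k)"
  shows "P \<in> fv.span (monomials N d)"
  using assms
proof induction
  case (const d c)
  have "(fscale c (monomial_fun N (\<lambda>_. 0)) :: (nat \<Rightarrow> 'k) \<Rightarrow> 'k) \<in> fv.span (monomials N d)"
    by (intro fv.span_scale fv.span_base monomial_funI) auto
  moreover have "fscale c (monomial_fun N (\<lambda>_. 0)) = (\<lambda>_ :: nat \<Rightarrow> 'k. c)"
    by (simp add: fscale_def monomial_fun_def)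
  ultimately show ?case by (simp only:)
next
  case (coord i d)
  have "(monomial_fun N (\<lambda>j. if j = i then 1 else 0) :: (nat \<Rightarrow> 'k) \<Rightarrow> 'k) \<in> fv.span (monomials N d)"
    using coord by (intro fv.span_base monomial_funI) auto
  moreover have "monomial_fun N (\<lambda>j. if j = i then 1 else 0) = (\<lambda>x :: nat \<Rightarrow> 'k. x i)"
    using coord by (auto simp: monomial_fun_def fun_eq_iff if_distrib prod.delta cong: if_cong)
  ultimately show ?case by (simp only:)
next
  case (add d P Q)
  then have "P + Q \<in> fv.span (monomials N d)" by (intro fv.span_add)
  then show ?case unfolding plus_fun_def .
next
  case (mult d P e Q f)
  have "P * Q \<in> fv.span (monomials N f)"
  proof (rule span_times[OF mult.IH])
    fix a b :: "(nat \<Rightarrow> 'k) \<Rightarrow> 'k" assume "a \<in> monomials N d" "b \<in> monomials N e"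
    then obtain \<alpha> \<beta> where ab: "a = monomial_fun N \<alpha>" "b = monomial_fun N \<beta>"
      "\<alpha> \<in> {..<N} \<rightarrow>\<^sub>E {..d}" "\<beta> \<in> {..<N} \<rightarrow>\<^sub>E {..e}" by (auto simp: monomials_def)
    have "a * b = monomial_fun N (\<lambda>i. \<alpha> i + \<beta> i)"
      by (auto simp: ab monomial_fun_def fun_eq_iff power_add prod.distrib)
    moreover have "\<alpha> i + \<beta> i \<le> f" if "i < N" for i
    proof -
      have "\<alpha> i \<le> d" "\<beta> i \<le> e" using ab(3,4) that by (auto simp: PiE_iff)
      then show ?thesis using mult.hyps(3) by linarith
    qed
    ultimately show "a * b \<in> fv.span (monomials N f)" by (auto intro: fv.span_base monomial_funI)
  qed
  then show ?case unfolding times_fun_def .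
qed

text \<open>Iterating the inequality along \<open>M ^ j * s1\<close> multiplies the lower bound by
  \<open>h ^ j\<close>, while polynomial growth permits only a constant times
  \<open>(M ^ N) ^ j\<close>. Constants lose their influence as \<open>j\<close> grows, so
  \<open>h > M ^ N\<close> is impossible.\<close>

lemma growth_factor_le:
  fixes v :: "nat \<Rightarrow> nat"
  assumes bound: "\<And>s. v s \<le> c * (s + 1) ^ N" and pos: "\<And>s. v s \<ge> 1"
    and grow: "\<And>s. s \<ge> s0 \<Longrightarrow> h * v s \<le> v (M * s)" and "M \<ge> 1"
  shows "h \<le> M ^ N"
proof (rule ccontr)
  assume "\<not> h \<le> M ^ N"
  define s1 where "s1 = max s0 1"
  have iter: "h ^ j \<le> v (M ^ j * s1)" for j
  proof (induction j)
    case (Suc j)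
    have "1 * s1 \<le> M ^ j * s1" using \<open>M \<ge> 1\<close> by (intro mult_right_mono) auto
    then have "s0 \<le> M ^ j * s1" by (simp add: s1_def)
    have "h ^ Suc j \<le> h * v (M ^ j * s1)" using Suc by simp
    also have "\<dots> \<le> v (M * (M ^ j * s1))" by (rule grow) fact
    finally show ?case by (simp add: mult_ac)
  qed (use pos in auto)
  let ?x = "real h / real (M ^ N)"
  have M: "real (M ^ N) > 0" using \<open>M \<ge> 1\<close> by simp
  have "?x > 1" using \<open>\<not> h \<le> M ^ N\<close> M by (simp add: less_divide_eq flip: of_nat_power)
  then obtain j where j: "real (c * (2 * s1) ^ N) < ?x ^ j" using real_arch_pow by blast
  \<comment> \<open>As \<open>s1 \<ge> 1\<close>, doubling absorbs the summand 1 and leaves a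
    constant multiple of a power of \<open>M\<close>.\<close>
  have "M ^ j * s1 + 1 \<le> M ^ j * (2 * s1)"
    using \<open>M \<ge> 1\<close> by (simp add: s1_def mult.assoc[symmetric] Suc_leI)
  then have "c * (M ^ j * s1 + 1) ^ N \<le> c * (M ^ j * (2 * s1)) ^ N" by (intro mult_left_mono power_mono) auto
  then have "h ^ j \<le> c * (M ^ j * (2 * s1)) ^ N" using iter[of j] bound[of "M ^ j * s1"] by linarith
  also have "\<dots> = c * (2 * s1) ^ N * (M ^ N) ^ j"
    by (simp add: power_mult_distrib power_mult[symmetric] mult_ac)
  finally have "real h ^ j \<le> real (c * (2 * s1) ^ N) * real (M ^ N) ^ j"
    by (metis of_nat_le_iff of_nat_mult of_nat_power)
  then have "?x ^ j \<le> real (c * (2 * s1) ^ N)"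
    using M by (simp add: power_divide divide_le_eq)
  with j show False by simp
qed

section \<open>Rational self-maps of irreducible algebraic sets\<close>

text \<open>For the identity on \<open>Z\<close> this is the affine Hilbert function of
  \<open>Z\<close>; for \<open>z\<close> on \<open>W\<close> it is that of the image of
  \<open>z\<close>. Functions are set to 0 outside \<open>A\<close> so that they live in one vector
  space.\<close>

definition pullback_dim :: "nat \<Rightarrow> 'p set \<Rightarrow> ('p \<Rightarrow> nat \<Rightarrow> 'k::field) \<Rightarrow> nat \<Rightarrow> nat" where
  "pullback_dim N A \<phi> s = fv.dim {\<lambda>x. if x \<in> A then P (\<phi> x) else 0 | P. poly_deg N s P}"

text \<open>The basis consists of polynomials rather than of their pullbacks, so that its members
  can also be evaluated away from the image of \<phi> and multiplied with control of the
  degree.\<close>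

lemma pullback_basis:
  fixes \<phi> :: "'p \<Rightarrow> nat \<Rightarrow> 'k::field"
  obtains \<B> where "finite \<B>" "card \<B> = pullback_dim N A \<phi> s" "pullback_dim N A \<phi> s \<le> (s + 1) ^ N"
    "\<forall>P\<in>\<B>. poly_deg N s P"
    "\<forall>u. (\<forall>x\<in>A. (\<Sum>P\<in>\<B>. u P * P (\<phi> x)) = 0) \<longrightarrow> (\<forall>P\<in>\<B>. u P = 0)"
    "\<forall>P. poly_deg N s P \<longrightarrow> (\<exists>c. \<forall>x\<in>A. P (\<phi> x) = (\<Sum>Q\<in>\<B>. c Q * Q (\<phi> x)))"
proof -
  define L where "L P = (\<lambda>x. if x \<in> A then P (\<phi> x) else 0)" for P :: "(nat \<Rightarrow> 'k) \<Rightarrow> 'k"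
  define V where "V = {L P | P. poly_deg N s P}"
  have dim: "pullback_dim N A \<phi> s = fv.dim V" by (simp add: pullback_dim_def V_def L_def)
  have "V \<subseteq> fv.span (L ` monomials N s)"
  proof
    fix f assume "f \<in> V"
    then obtain P where P: "poly_deg N s P" "f = L P" by (auto simp: V_def)
    show "f \<in> fv.span (L ` monomials N s)"
      unfolding P(2)
      by (rule span_linear_image[OF poly_deg_span_monomials[OF P(1)]])
        (auto simp: L_def fscale_def fun_eq_iff intro: fv.span_base)
  qed
  from basis_of_function_space[OF finite_imageI[OF monomials_finite(1)] this]
  obtain B where B: "B \<subseteq> V" "finite B" "card B = fv.dim V" "V \<subseteq> fv.span B"
    "fv.dim V \<le> card (L ` monomials N s)"
    "\<forall>u. (\<forall>x. (\<Sum>b\<in>B. u b * b x) = 0) \<longrightarrow> (\<forall>b\<in>B. u b = 0)" by blast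
  have "\<forall>b\<in>B. \<exists>P. poly_deg N s P \<and> L P = b" using B(1) by (auto simp: V_def)
  then obtain g where g: "\<And>b. b \<in> B \<Longrightarrow> poly_deg N s (g b) \<and> L (g b) = b" by metis
  have inj: "inj_on g B" using g by (metis inj_onI)
  have gx: "g b (\<phi> x) = b x" if "b \<in> B" "x \<in> A" for b x
    using g[OF that(1)] that(2) by (metis L_def)
  have B0: "b x = 0" if "b \<in> B" "x \<notin> A" for b x
    using g[OF that(1)] that(2) by (metis L_def)
  show ?thesis
  proof (rule that[of "g ` B"])
    show "finite (g ` B)" using B by simp
    show "card (g ` B) = pullback_dim N A \<phi> s" using B dim by (simp add: card_image[OF inj])
    have "card (L ` monomials N s) \<le> (s + 1) ^ N"
      using card_image_le[OF monomials_finite(1)] monomials_finite(2) by (rule order_trans)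
    then show "pullback_dim N A \<phi> s \<le> (s + 1) ^ N" using B(5) dim by linarith
    show "\<forall>P\<in>g ` B. poly_deg N s P" using g by auto
    show "\<forall>u. (\<forall>x\<in>A. (\<Sum>P\<in>g ` B. u P * P (\<phi> x)) = 0) \<longrightarrow> (\<forall>P\<in>g ` B. u P = 0)"
    proof (intro allI impI)
      fix u assume 0: "\<forall>x\<in>A. (\<Sum>P\<in>g ` B. u P * P (\<phi> x)) = 0"
      have sum0: "(\<Sum>b\<in>B. u (g b) * b x) = 0" for x
      proof (cases "x \<in> A")
        case True
        have "(\<Sum>b\<in>B. u (g b) * b x) = (\<Sum>b\<in>B. u (g b) * g b (\<phi> x))"
          by (intro sum.cong) (auto simp: gx True)
        also have "\<dots> = 0" using bspec[OF 0 True] by (simp add: sum.reindex[OF inj])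
        finally show ?thesis .
      qed (simp add: B0)
      show "\<forall>P\<in>g ` B. u P = 0"
        using spec[OF B(6), of "\<lambda>b. u (g b)"] sum0 by simp
    qed
    show "\<forall>P. poly_deg N s P \<longrightarrow> (\<exists>c. \<forall>x\<in>A. P (\<phi> x) = (\<Sum>Q\<in>g ` B. c Q * Q (\<phi> x)))"
    proof (intro allI impI)
      fix P :: "(nat \<Rightarrow> 'k) \<Rightarrow> 'k" assume "poly_deg N s P"
      then have "L P \<in> V" unfolding V_def by blast
      then have "L P \<in> fv.span B" by (rule subsetD[OF B(4)])
      then obtain c where c: "L P = (\<Sum>b\<in>B. fscale (c b) b)"
        unfolding fv.span_finite[OF B(2)] by blast
      show "\<exists>c. \<forall>x\<in>A. P (\<phi> x) = (\<Sum>Q\<in>g ` B. c Q * Q (\<phi> x))"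
      proof (intro exI[of _ "\<lambda>Q. c (L Q)"] ballI)
        fix x assume x: "x \<in> A"
        have "P (\<phi> x) = L P x" using x by (simp add: L_def)
        also have "\<dots> = (\<Sum>b\<in>B. c b * b x)" unfolding c by (simp add: sum_fun_apply fscale_def)
        also have "\<dots> = (\<Sum>b\<in>B. c (L (g b)) * g b (\<phi> x))"
          by (intro sum.cong) (auto simp: g gx x)
        also have "\<dots> = (\<Sum>Q\<in>g ` B. c (L Q) * Q (\<phi> x))" by (simp add: sum.reindex[OF inj])
        finally show "P (\<phi> x) = (\<Sum>Q\<in>g ` B. c (L Q) * Q (\<phi> x))" .
      qed
    qed
  qed
qed

lemma card_le_pullback_dim:
  fixes \<phi> :: "'p \<Rightarrow> nat \<Rightarrow> 'k::field"
  assumes "finite I" and deg: "\<And>i. i \<in> I \<Longrightarrow> poly_deg N s (G i)"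
    and indep: "\<And>u. (\<forall>x\<in>A. (\<Sum>i\<in>I. u i * G i (\<phi> x)) = 0) \<Longrightarrow> \<forall>i\<in>I. u i = 0"
  shows "card I \<le> pullback_dim N A \<phi> s"
proof -
  obtain \<B> where B: "finite \<B>" "card \<B> = pullback_dim N A \<phi> s"
    "\<forall>P. poly_deg N s P \<longrightarrow> (\<exists>c. \<forall>x\<in>A. P (\<phi> x) = (\<Sum>Q\<in>\<B>. c Q * Q (\<phi> x)))"
    by (rule pullback_basis[of N A \<phi> s])
  define L where "L P = (\<lambda>x. if x \<in> A then P (\<phi> x) else 0)" for P :: "(nat \<Rightarrow> 'k) \<Rightarrow> 'k"
  have span: "L (G i) \<in> fv.span (L ` \<B>)" if i: "i \<in> I" for i
  proof -
    obtain c where c: "\<forall>x\<in>A. G i (\<phi> x) = (\<Sum>Q\<in>\<B>. c Q * Q (\<phi> x))" using B(3) deg[OF i] by blast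
    have "L (G i) = (\<Sum>Q\<in>\<B>. fscale (c Q) (L Q))"
      using c by (auto simp: L_def fun_eq_iff sum_fun_apply fscale_def)
    moreover have "(\<Sum>Q\<in>\<B>. fscale (c Q) (L Q)) \<in> fv.span (L ` \<B>)"
      by (intro fv.span_sum fv.span_scale fv.span_base) auto
    ultimately show ?thesis by (simp only:)
  qed
  have indep': "\<forall>i\<in>I. u i = 0" if "\<forall>x. (\<Sum>i\<in>I. u i * L (G i) x) = 0" for u
  proof (rule indep, rule ballI)
    fix x assume "x \<in> A"
    with spec[OF that, of x] show "(\<Sum>i\<in>I. u i * G i (\<phi> x)) = 0" by (simp add: L_def)
  qed
  have "finite (L ` \<B>)" using B(1) by simp
  from family_card_le_spanning[OF \<open>finite I\<close> this span indep']
  have "card I \<le> card (L ` \<B>)" .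
  also have "\<dots> \<le> card \<B>" by (rule card_image_le[OF B(1)])
  finally show ?thesis using B(2) by simp
qed

lemma pullback_dim_pos: "a \<in> A \<Longrightarrow> 1 \<le> pullback_dim N A \<phi> s"
  using card_le_pullback_dim[of "{()}" N s "\<lambda>_ _. 1" A \<phi>] by (auto intro: poly_deg.const)

text \<open>A rational map in coordinates. The common denominator makes its domain principal open,
  and a polynomial of degree \<open>s\<close> pulls back to a fraction over
  \<open>q ^ s\<close>.\<close>

locale rational_self_map =
  fixes N D :: nat and Z :: "(nat \<Rightarrow> 'k::alg_closed_field) set"
    and p :: "nat \<Rightarrow> (nat \<Rightarrow> 'k) \<Rightarrow> 'k" and q :: "(nat \<Rightarrow> 'k) \<Rightarrow> 'k" and z :: "(nat \<Rightarrow> 'k) \<Rightarrow> nat \<Rightarrow> 'k"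
  assumes Z_algebraic: "algebraic_set N Z"
    and Z_irreducible: "\<And>d e P Q. poly_deg N d P \<Longrightarrow> poly_deg N e Q \<Longrightarrow> (\<And>x. x \<in> Z \<Longrightarrow> P x * Q x = 0) \<Longrightarrow>
      (\<forall>x\<in>Z. P x = 0) \<or> (\<forall>x\<in>Z. Q x = 0)"
    and q_deg: "poly_deg N D q" and p_deg: "\<And>i. i < N \<Longrightarrow> poly_deg N D (p i)"
    and q_nonzero: "\<exists>x\<in>Z. q x \<noteq> 0"
    and z_in: "\<And>x. x \<in> Z \<Longrightarrow> q x \<noteq> 0 \<Longrightarrow> z x \<in> Z"
    and z_eq: "\<And>x i. x \<in> Z \<Longrightarrow> q x \<noteq> 0 \<Longrightarrow> i < N \<Longrightarrow> z x i * q x = p i x"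
    and finite_fibre: "\<And>y. finite {x \<in> Z. q x \<noteq> 0 \<and> z x = y}"
begin

section \<open>Regular functions on the domain of the map\<close>

definition W :: "(nat \<Rightarrow> 'k) set" where "W = {x \<in> Z. q x \<noteq> 0}"

text \<open>Composing with a retraction onto \<open>W\<close> turns functions on \<open>W\<close> into elements of a type
  that is a ring.\<close>

definition retr :: "(nat \<Rightarrow> 'k) \<Rightarrow> nat \<Rightarrow> 'k" where
  "retr x = (if x \<in> W then x else (SOME w. w \<in> W))"

lemma retr_in: "retr x \<in> W"
  using q_nonzero someI_ex[of "\<lambda>w. w \<in> W"] by (auto simp: retr_def W_def)

lemma retr_id: "x \<in> W \<Longrightarrow> retr x = x" by (simp add: retr_def)

lemma retr_Z: "retr x \<in> Z" "q (retr x) \<noteq> 0" using retr_in[of x] by (auto simp: W_def)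

text \<open>\<open>W\<close> is dense: after multiplication by \<open>q\<close> the function
  vanishes on all of \<open>Z\<close>, and irreducibility removes \<open>q\<close>.\<close>

lemma zero_on_Z:
  assumes "poly_deg N d P" "\<And>x. x \<in> W \<Longrightarrow> P x = 0" "x \<in> Z"
  shows "P x = 0"
proof -
  have "P x * q x = 0" if "x \<in> Z" for x using assms(2)[of x] that by (auto simp: W_def)
  from Z_irreducible[OF assms(1) q_deg this] q_nonzero assms(3) show ?thesis by blast
qed

text \<open>The coordinate ring of \<open>Z\<close> localised at \<open>q\<close>. The defining
  equation forces \<open>f\<close> to factor through \<open>retr\<close>, so functions on
  \<open>W\<close> are represented uniquely.\<close>

definition regular_ring :: "((nat \<Rightarrow> 'k) \<Rightarrow> 'k) set" where
  "regular_ring = {f. \<exists>d P k. poly_deg N d P \<and> (\<forall>x. f x * q (retr x) ^ k = P (retr x))}"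

lemma regular_ringI: "poly_deg N d P \<Longrightarrow> (\<And>x. f x * q (retr x) ^ k = P (retr x)) \<Longrightarrow> f \<in> regular_ring"
  unfolding regular_ring_def by blast

lemma poly_retr_regular: "poly_deg N d P \<Longrightarrow> (\<lambda>x. P (retr x)) \<in> regular_ring"
  by (rule regular_ringI[where k = 0 and P = P]) auto

lemma subring_regular_ring: "subring_set regular_ring"
  unfolding subring_set_def
proof (intro conjI ballI)
  show "1 \<in> regular_ring" by (rule regular_ringI[OF poly_deg.const[of N 0 1], of _ 0]) simp
  fix f g assume "f \<in> regular_ring" "g \<in> regular_ring"
  then obtain d P k e Q l where P: "poly_deg N d P" "\<And>x. f x * q (retr x) ^ k = P (retr x)"
    and Q: "poly_deg N e Q" "\<And>x. g x * q (retr x) ^ l = Q (retr x)"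
    unfolding regular_ring_def by blast
  have mx: "poly_deg N (max (d + l * D) (e + k * D)) (\<lambda>x. P x * q x ^ l)"
    "poly_deg N (max (d + l * D) (e + k * D)) (\<lambda>x. Q x * q x ^ k)"
    by (rule poly_deg.mult[OF P(1) poly_deg_power[OF q_deg]], simp)
      (rule poly_deg.mult[OF Q(1) poly_deg_power[OF q_deg]], simp)
  show "f - g \<in> regular_ring"
    by (rule regular_ringI[OF poly_deg_diff[OF mx], of _ "k + l"])
      (simp add: P(2)[symmetric] Q(2)[symmetric] power_add algebra_simps)
  show "f * g \<in> regular_ring"
    by (rule regular_ringI[OF poly_deg.mult[OF P(1) Q(1) order_refl], of _ "k + l"])
      (simp add: P(2)[symmetric] Q(2)[symmetric] power_add algebra_simps)
qed

lemma domain_regular_ring: "domain_set regular_ring"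
  unfolding domain_set_def
proof (intro ballI impI)
  fix f g assume "f \<in> regular_ring" "g \<in> regular_ring" and fg: "f * g = 0"
  then obtain d P k e Q l where P: "poly_deg N d P" "\<And>x. f x * q (retr x) ^ k = P (retr x)"
    and Q: "poly_deg N e Q" "\<And>x. g x * q (retr x) ^ l = Q (retr x)"
    unfolding regular_ring_def by blast
  have "P x * Q x = 0" if "x \<in> Z" for x
  proof (rule zero_on_Z[OF poly_deg.mult[OF P(1) Q(1) order_refl] _ that])
    fix x assume "x \<in> W"
    then show "P x * Q x = 0"
      using P(2)[of x] Q(2)[of x] fun_cong[OF fg, of x] by (auto simp: retr_id)
  qed
  from Z_irreducible[OF P(1) Q(1) this]
  have "(\<forall>x\<in>Z. P x = 0) \<or> (\<forall>x\<in>Z. Q x = 0)" .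
  then show "f = 0 \<or> g = 0"
  proof
    assume "\<forall>x\<in>Z. P x = 0"
    then have "f x = 0" for x using P(2)[of x] retr_Z[of x] by auto
    then show ?thesis by (auto simp: fun_eq_iff)
  next
    assume "\<forall>x\<in>Z. Q x = 0"
    then have "g x = 0" for x using Q(2)[of x] retr_Z[of x] by auto
    then show ?thesis by (auto simp: fun_eq_iff)
  qed
qed

section \<open>Pullbacks of polynomials along the map, filtered by degree\<close>

definition image_fun :: "((nat \<Rightarrow> 'k) \<Rightarrow> 'k) \<Rightarrow> (nat \<Rightarrow> 'k) \<Rightarrow> 'k" where
  "image_fun P = (\<lambda>x. P (z (retr x)))"

definition image_deg :: "nat \<Rightarrow> ((nat \<Rightarrow> 'k) \<Rightarrow> 'k) set" where
  "image_deg k = {image_fun P | P. poly_deg N k P}"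

definition image_ring :: "((nat \<Rightarrow> 'k) \<Rightarrow> 'k) set" where
  "image_ring = (\<Union>k. image_deg k)"

lemma image_deg_mono: "k \<le> l \<Longrightarrow> image_deg k \<subseteq> image_deg l"
  unfolding image_deg_def using poly_deg_mono by blast

lemma image_deg_const: "(\<lambda>_. c) \<in> image_deg k"
  unfolding image_deg_def image_fun_def using poly_deg.const by fastforce

lemma image_deg_mult: "f \<in> image_deg k \<Longrightarrow> g \<in> image_deg l \<Longrightarrow> k + l \<le> m \<Longrightarrow> f * g \<in> image_deg m"
  unfolding image_deg_def image_fun_def times_fun_def using poly_deg.mult by fastforce

lemma image_deg_diff: "f \<in> image_deg k \<Longrightarrow> g \<in> image_deg k \<Longrightarrow> f - g \<in> image_deg k"
proof -
  assume "f \<in> image_deg k" "g \<in> image_deg k"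
  then obtain P Q where "poly_deg N k P" "poly_deg N k Q" "f = image_fun P" "g = image_fun Q"
    by (auto simp: image_deg_def)
  moreover from this have "f - g = image_fun (\<lambda>x. P x - Q x)" by (simp add: image_fun_def fun_eq_iff)
  ultimately show ?thesis unfolding image_deg_def using poly_deg_diff by blast
qed

lemma image_deg_power: "f \<in> image_deg k \<Longrightarrow> f ^ l \<in> image_deg (l * k)"
proof (induction l)
  case 0
  show ?case using image_deg_const[of 1] by (simp add: one_fun_def)
next
  case (Suc l)
  then show ?case by (simp del: times_fun_apply) (rule image_deg_mult, auto)
qed

lemma subring_image_ring: "subring_set image_ring"
  unfolding subring_set_def
proof (intro conjI ballI)
  show "1 \<in> image_ring" using image_deg_const[of 1] by (auto simp: one_fun_def image_ring_def)
  fix f g assume "f \<in> image_ring" "g \<in> image_ring"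
  then obtain k l where fg: "f \<in> image_deg k" "g \<in> image_deg l" by (auto simp: image_ring_def)
  then have "f \<in> image_deg (max k l)" "g \<in> image_deg (max k l)"
    using image_deg_mono by (meson max.cobounded1 max.cobounded2 subsetD)+
  then show "f - g \<in> image_ring" using image_deg_diff by (auto simp: image_ring_def)
  show "f * g \<in> image_ring" using image_deg_mult[OF fg order_refl] unfolding image_ring_def by blast
qed

lemma image_ring_regular: "image_ring \<subseteq> regular_ring"
proof
  fix f assume "f \<in> image_ring"
  then obtain d P where P: "poly_deg N d P" "f = (\<lambda>x. P (z (retr x)))"
    by (auto simp: image_ring_def image_deg_def image_fun_def)
  obtain R where R: "poly_deg N (d * D) R"
    "\<And>x y. (\<forall>i<N. y i * q x = p i x) \<Longrightarrow> R x = P y * q x ^ d"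
    using poly_deg_compose[OF P(1), where p = p and q = q and D = D and M = N] p_deg q_deg by blast
  show "f \<in> regular_ring"
    by (rule regular_ringI[OF R(1), of _ d], subst R(2)[of "z (retr _)"])
      (use z_eq retr_Z in \<open>auto simp: P(2)\<close>)
qed

section \<open>Algebraicity of the coordinates over the pullbacks\<close>

abbreviation coordinate :: "nat \<Rightarrow> (nat \<Rightarrow> 'k) \<Rightarrow> 'k" where
  "coordinate i \<equiv> (\<lambda>x. retr x i)"

lemma coordinate_regular: "i < N \<Longrightarrow> coordinate i \<in> regular_ring"
  using poly_retr_regular[OF poly_deg.coord[OF _ order_refl]] by simp

text \<open>Otherwise the extension theorem for homomorphisms yields points of a fibre of \<open>z\<close> with
  infinitely many values of the coordinate.\<close>

lemma coordinate_algebraic: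
  assumes "i < N"
  shows "\<exists>P. P \<in> poly_over image_ring \<and> P \<noteq> 0 \<and> poly P (coordinate i) = 0"
proof (rule ccontr)
  assume "\<nexists>P. P \<in> poly_over image_ring \<and> P \<noteq> 0 \<and> poly P (coordinate i) = 0"
  then have trans: "P = 0" if "P \<in> poly_over image_ring" "poly P (coordinate i) = 0" for P
    using that by blast
  note I = subring_image_ring
  define R where "R = adjoin image_ring (coordinate i)"
  note adj = adjoin_subring[OF I, of "coordinate i", folded R_def]
  have RS: "R \<subseteq> regular_ring"
    unfolding R_def using subring_regular_ring image_ring_regular coordinate_regular[OF assms]
    by (rule adjoin_least)
  \<comment> \<open>Including the inverse of \<open>q\<close> among the generators forces the point
    defined by a homomorphism into \<open>W\<close>.\<close>
  define Y where "Y = (\<lambda>x. 1 / q (retr x))"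
  have Y: "Y \<in> regular_ring"
    by (rule regular_ringI[OF poly_deg.const[of N 0 1], of _ 1]) (simp add: Y_def retr_Z)
  define xs where "xs = Y # map coordinate [0..<N]"
  have "set xs \<subseteq> regular_ring" using Y coordinate_regular by (auto simp: xs_def)
  from hom_extension[OF adj(1) subring_regular_ring domain_regular_ring RS this, where 'k = 'k]
  obtain b T where bT: "b \<in> R" "b \<noteq> 0" "subring_set T" "R \<subseteq> T" "set xs \<subseteq> T"
    and ext: "\<And>\<beta> :: _ \<Rightarrow> 'k. hom_set R \<beta> \<Longrightarrow> \<beta> b \<noteq> 0 \<Longrightarrow> \<exists>\<beta>'. hom_set T \<beta>' \<and> (\<forall>a\<in>R. \<beta>' a = \<beta> a)"
    by blast
  obtain P where P: "P \<in> poly_over image_ring" "b = poly P (coordinate i)"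
    using bT(1) by (auto simp: R_def adjoin_def)
  have "P \<noteq> 0" using bT(2) P(2) by auto
  then have "lead_coeff P \<noteq> 0" by simp
  \<comment> \<open>Evaluation at \<open>x0\<close> is a homomorphism on the pullbacks that singles
    out the fibre over \<open>z (retr x0)\<close>. With this choice of \<open>x0\<close>, the
    polynomial \<open>P\<close> that represents \<open>b\<close> keeps a nonzero
    coefficient.\<close>
  then obtain x0 where x0: "lead_coeff P x0 \<noteq> 0" by (auto simp: fun_eq_iff)
  define \<beta>0 where "\<beta>0 f = f x0" for f :: "(nat \<Rightarrow> 'k) \<Rightarrow> 'k"
  have \<beta>0: "hom_set image_ring \<beta>0" by (auto simp: hom_set_def \<beta>0_def)
  define Q where "Q = map_poly \<beta>0 P"
  have "coeff Q (degree P) \<noteq> 0" using x0 by (simp add: Q_def coeff_map_poly \<beta>0_def)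
  then have "Q \<noteq> 0" by auto
  then have roots: "finite {c. poly Q c = 0}" by (rule poly_roots_finite)
  let ?F = "{x \<in> Z. q x \<noteq> 0 \<and> z x = z (retr x0)}"
  \<comment> \<open>Being transcendental, the coordinate may be sent to any \<open>c\<close>. Unless
    \<open>c\<close> is a root of \<open>Q\<close>, the homomorphism does not kill \<open>b\<close>,
    extends to all generators and yields a point of the fibre with this coordinate.\<close>
  have "c \<in> (\<lambda>x. x i) ` ?F" if c: "poly Q c \<noteq> 0" for c
  proof -
    from hom_extend_transcendental[OF I \<beta>0 trans, where c = c]
    obtain \<beta>1 where 1: "hom_set R \<beta>1" "\<forall>f\<in>image_ring. \<beta>1 f = \<beta>0 f" "\<beta>1 (coordinate i) = c"
      "\<forall>P\<in>poly_over image_ring. \<beta>1 (poly P (coordinate i)) = poly (map_poly \<beta>0 P) c"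
      unfolding R_def by blast
    have "\<beta>1 b \<noteq> 0" using 1(4) P c by (simp add: Q_def)
    from ext[OF 1(1) this] obtain \<beta> where \<beta>: "hom_set T \<beta>" "\<forall>a\<in>R. \<beta> a = \<beta>1 a" by blast
    note h = hom_setD[OF \<beta>(1) bT(3)]
    \<comment> \<open>The images of the coordinate functions are the coordinates of the point;
      \<open>undefined\<close> from index \<open>N\<close> on is what \<open>affine_points\<close>
      prescribes.\<close>
    define y where "y = (\<lambda>j. if j < N then \<beta> (coordinate j) else undefined)"
    have T: "coordinate j \<in> T" if "j < N" for j using bT(5) that by (auto simp: xs_def)
    have const: "(\<lambda>_. c) \<in> T" "\<beta> (\<lambda>_. c) = c" for c
    proof -
      have "(\<lambda>_. c) \<in> image_ring" using image_deg_const unfolding image_ring_def by blast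
      then show "(\<lambda>_. c) \<in> T" "\<beta> (\<lambda>_. c) = c" using \<beta>(2) 1(2) adj(2) bT(4) by (auto simp: \<beta>0_def)
    qed
    have ev: "(\<lambda>x. P (retr x)) \<in> T \<and> \<beta> (\<lambda>x. P (retr x)) = P y" if "poly_deg N d P" for d P
      using that
    proof induction
      case (add d P Q)
      then show ?case
        using subring_add[OF bT(3), of "\<lambda>x. P (retr x)" "\<lambda>x. Q (retr x)"]
          h(2)[of "\<lambda>x. P (retr x)" "\<lambda>x. Q (retr x)"] by (simp add: plus_fun_def)
    next
      case (mult d P e Q f)
      then show ?case
        using subring_mult[OF bT(3), of "\<lambda>x. P (retr x)" "\<lambda>x. Q (retr x)"]
          h(3)[of "\<lambda>x. P (retr x)" "\<lambda>x. Q (retr x)"] by (simp add: times_fun_def)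
    qed (auto simp: const T y_def)
    obtain S where S: "S \<subseteq> polynomial_functions N" "Z = {x \<in> affine_points N. \<forall>P\<in>S. P x = 0}"
      using Z_algebraic unfolding algebraic_set_def by blast
    have "P y = 0" if "P \<in> S" for P
    proof -
      have "P \<in> polynomial_functions N" using S(1) that by blast
      then obtain d where d: "poly_deg N d P" unfolding polynomial_functions_iff ..
      have "P (retr x) = 0" for x using S(2) that retr_Z(1)[of x] by blast
      then show ?thesis using ev[OF d] const(2)[of 0] by simp
    qed
    moreover have "y \<in> affine_points N" by (auto simp: affine_points_def y_def PiE_iff extensional_def)
    ultimately have yZ: "y \<in> Z" using S(2) by blast
    have "(\<lambda>x. q (retr x)) * Y = (\<lambda>_. 1)" using retr_Z by (auto simp: Y_def fun_eq_iff)
    moreover have "Y \<in> T" using bT(5) by (auto simp: xs_def)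
    ultimately have "q y * \<beta> Y = 1" using h(3)[of "\<lambda>x. q (retr x)" Y] ev[OF q_deg] const(2)[of 1] by simp
    then have yq: "q y \<noteq> 0" by auto
    have "z y j = z (retr x0) j" if j: "j < N" for j
    proof -
      let ?Z = "\<lambda>x. z (retr x) j"
      have "?Z = image_fun (\<lambda>x. x j)" by (simp add: image_fun_def)
      then have Zj: "?Z \<in> image_ring"
        using poly_deg.coord[OF j order_refl] unfolding image_ring_def image_deg_def by blast
      then have "\<beta> ?Z = z (retr x0) j" using \<beta>(2) 1(2) adj(2) by (auto simp: \<beta>0_def)
      moreover have "?Z * (\<lambda>x. q (retr x)) = (\<lambda>x. p j (retr x))"
        using z_eq[OF retr_Z j] by (auto simp: fun_eq_iff)
      moreover have "?Z \<in> T" using Zj adj(2) bT(4) by blast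
      ultimately have "z (retr x0) j * q y = p j y"
        using h(3)[of ?Z "\<lambda>x. q (retr x)"] ev[OF q_deg] ev[OF p_deg[OF j]] by simp
      then have "z (retr x0) j * q y = z y j * q y" using z_eq[OF yZ yq j] by simp
      then show ?thesis using yq by simp
    qed
    moreover have "z y \<in> affine_points N" "z (retr x0) \<in> affine_points N"
      using z_in[OF yZ yq] z_in[OF retr_Z] S(2) by auto
    ultimately have "z y = z (retr x0)"
      unfolding affine_points_def by (intro PiE_ext[of _ "{..<N}" "\<lambda>_. UNIV"]) auto
    moreover have "y i = c" using assms \<beta>(2) 1(3) adj(3) by (simp add: y_def)
    ultimately show ?thesis using yZ yq by auto
  qed
  \<comment> \<open>All but finitely many elements of an infinite field would be coordinates of
    points in one finite fibre.\<close>
  then have "UNIV \<subseteq> {c. poly Q c = 0} \<union> (\<lambda>x. x i) ` ?F" by auto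
  then have "finite (UNIV :: 'k set)" using roots finite_fibre by (meson finite_UnI finite_imageI finite_subset)
  then show False using infinite_alg_closed_field by blast
qed

lemma regular_mult_nonzero:
  "f \<in> regular_ring \<Longrightarrow> g \<in> regular_ring \<Longrightarrow> f \<noteq> 0 \<Longrightarrow> g \<noteq> 0 \<Longrightarrow> f * g \<noteq> 0"
  using domain_regular_ring unfolding domain_set_def by blast

lemma regular_power_nonzero: "f \<in> regular_ring \<Longrightarrow> f \<noteq> 0 \<Longrightarrow> f ^ k \<noteq> 0"
proof (induction k)
  case 0
  show ?case unfolding power_0 by (rule one_neq_zero)
next
  case (Suc k)
  have "f * f ^ k \<noteq> 0"
    using Suc subring_power[OF subring_regular_ring] by (intro regular_mult_nonzero) auto
  then show ?case by (simp only: power_Suc not_False_eq_True)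
qed

lemma regular_prod_nonzero:
  fixes f :: "nat \<Rightarrow> _"
  assumes "\<And>i. i < n \<Longrightarrow> f i \<in> regular_ring \<and> f i \<noteq> 0"
  shows "prod f {..<n} \<in> regular_ring \<and> prod f {..<n} \<noteq> 0"
  using assms
proof (induction n)
  case 0
  show ?case
    unfolding lessThan_0 prod.empty using subring_one[OF subring_regular_ring] one_neq_zero by blast
next
  case (Suc n)
  have IH: "prod f {..<n} \<in> regular_ring \<and> prod f {..<n} \<noteq> 0"
    by (rule Suc.IH, rule Suc.prems, rule less_SucI)
  note fn = conjunct1[OF Suc.prems[OF lessI]] conjunct2[OF Suc.prems[OF lessI]]
  have "prod f {..<n} * f n \<noteq> 0"
    by (rule regular_mult_nonzero[OF conjunct1[OF IH] fn(1) conjunct2[OF IH] fn(2)])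
  moreover have "prod f {..<n} * f n \<in> regular_ring"
    by (rule subring_mult[OF subring_regular_ring conjunct1[OF IH] fn(1)])
  ultimately show ?case unfolding prod.lessThan_Suc by (intro conjI)
qed

section \<open>Hilbert functions of the source and of the image\<close>

lemma uniform_relations:
  obtains P e C where "\<And>i. i < N \<Longrightarrow> P i \<in> poly_over image_ring \<and> P i \<noteq> 0 \<and>
    poly (P i) (coordinate i) = 0 \<and> degree (P i) \<le> e \<and> (\<forall>j. coeff (P i) j \<in> image_deg C)"
proof -
  obtain P where P: "\<And>i. i < N \<Longrightarrow> P i \<in> poly_over image_ring \<and> P i \<noteq> 0 \<and> poly (P i) (coordinate i) = 0"
    using coordinate_algebraic by metis
  have "\<forall>i j. \<exists>d. i < N \<longrightarrow> coeff (P i) j \<in> image_deg d"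
    using P unfolding poly_over_def image_ring_def by blast
  then obtain dd where dd: "\<And>i j. i < N \<Longrightarrow> coeff (P i) j \<in> image_deg (dd i j)" by metis
  show ?thesis
  \<comment> \<open>Sums over all coordinates and coefficients serve as crude common bounds.
    Coefficients above the degree are 0 and lie in every \<open>image_deg\<close>.\<close>
  proof (rule that[of P "\<Sum>i<N. degree (P i)" "\<Sum>i<N. \<Sum>j\<le>degree (P i). dd i j"], intro conjI allI)
    fix i assume i: "i < N"
    show "P i \<in> poly_over image_ring" "P i \<noteq> 0" "poly (P i) (coordinate i) = 0" using P[OF i] by auto
    show "degree (P i) \<le> (\<Sum>i<N. degree (P i))" using i by (intro member_le_sum) auto
    fix j
    show "coeff (P i) j \<in> image_deg (\<Sum>i<N. \<Sum>j\<le>degree (P i). dd i j)"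
    proof (cases "j \<le> degree (P i)")
      case True
      have "dd i j \<le> (\<Sum>j\<le>degree (P i). dd i j)" using True by (intro member_le_sum) auto
      also have "\<dots> \<le> (\<Sum>i<N. \<Sum>j\<le>degree (P i). dd i j)"
        using i by (intro member_le_sum[of i _ "\<lambda>i. \<Sum>j\<le>degree (P i). dd i j"]) auto
      finally show ?thesis using dd[OF i] image_deg_mono by blast
    next
      case False
      then have "coeff (P i) j = (\<lambda>_. 0)" by (simp add: coeff_eq_0 zero_fun_def)
      then show ?thesis using image_deg_const by simp
    qed
  qed
qed

text \<open>The relation rewrites \<open>lead_coeff P * x ^ degree P\<close> in lower powers, so
  each factor \<open>x\<close> costs one factor \<open>lead_coeff P\<close> and \<open>C\<close> in
  degree. The exponent \<open>s\<close> instead of \<open>l\<close> gives all powers up to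
  \<open>s\<close> the same denominator.\<close>

lemma power_reduction:
  assumes P: "\<And>j. coeff P j \<in> image_deg C" "P \<noteq> 0" "poly P x = 0" and "l \<le> s"
  shows "lead_coeff P ^ s * x ^ l \<in> fv.span {b * x ^ j | b j. b \<in> image_deg (s * C) \<and> j < degree P}"
proof -
  let ?a = "lead_coeff P" and ?e = "degree P"
  let ?M = "\<lambda>k. {b * x ^ j | b j. b \<in> image_deg (k * C) \<and> j < ?e}"
  have a: "?a \<in> image_deg C" using P(1) .
  have e: "0 < ?e"
  proof (rule ccontr)
    assume "\<not> 0 < ?e"
    then obtain c where "P = [:c:]" by (metis degree_eq_zeroE gr0I)
    then show False using P(2,3) by simp
  qed
  have base: "b * x ^ j \<in> fv.span (?M k)" if "b \<in> image_deg (k * C)" "j < ?e" for b j k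
    using that by (intro fv.span_base) blast
  have top: "?a * x ^ ?e = (\<Sum>j<?e. fscale (- 1) (coeff P j * x ^ j))"
  proof -
    have "0 = (\<Sum>j\<le>?e. coeff P j * x ^ j)" using P(3) by (simp add: poly_altdef)
    also have "\<dots> = (\<Sum>j<?e. coeff P j * x ^ j) + ?a * x ^ ?e"
      by (simp add: lessThan_Suc_atMost[symmetric] del: plus_fun_apply)
    finally have 0: "(\<Sum>j<?e. coeff P j * x ^ j) + ?a * x ^ ?e = 0" by (rule sym)
    have "?a * x ^ ?e = - (\<Sum>j<?e. coeff P j * x ^ j)" by (rule minus_unique[OF 0, symmetric])
    also have "\<dots> = (\<Sum>j<?e. - (coeff P j * x ^ j))" by (rule sum_negf[symmetric])
    also have "\<dots> = (\<Sum>j<?e. fscale (- 1) (coeff P j * x ^ j))"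
      by (intro sum.cong refl) (auto simp: fscale_def)
    finally show ?thesis .
  qed
  have step: "?a ^ l * x ^ l \<in> fv.span (?M l)" for l
  proof (induction l)
    case 0
    have "(\<lambda>_. 1) * x ^ 0 \<in> fv.span (?M 0)" using image_deg_const e by (intro base) auto
    moreover have "?a ^ 0 * x ^ 0 = (\<lambda>_. 1) * x ^ 0"
      unfolding power_0 mult_1_right by (rule one_fun_def)
    ultimately show ?case by (simp only:)
  next
    case (Suc l)
    have "(?a * x) * (?a ^ l * x ^ l) \<in> fv.span (?M (Suc l))"
    proof (rule span_times[OF fv.span_base Suc.IH])
      show "?a * x \<in> {?a * x}" by simp
      fix f g assume "f \<in> {?a * x}" "g \<in> ?M l"
      then obtain b j where f: "f = ?a * x" and g: "g = b * x ^ j" "b \<in> image_deg (l * C)" "j < ?e" by blast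
      show "f * g \<in> fv.span (?M (Suc l))"
      proof (cases "Suc j < ?e")
        case True
        have "?a * b \<in> image_deg (Suc l * C)" by (rule image_deg_mult[OF a g(2)]) simp
        from base[OF this True] show ?thesis unfolding f g by (simp only: power_Suc mult_ac)
      next
        case False
        then have j: "?e = Suc j" using g(3) by simp
        have "f * g = b * (?a * x ^ ?e)" unfolding f g j power_Suc by (simp only: mult_ac)
        also have "\<dots> = (\<Sum>m<?e. fscale (- 1) ((b * coeff P m) * x ^ m))"
          unfolding top sum_distrib_left
          by (intro sum.cong refl) (auto simp: fscale_def fun_eq_iff)
        also have "\<dots> \<in> fv.span (?M (Suc l))"
        proof (intro fv.span_sum fv.span_scale base)
          fix m show "b * coeff P m \<in> image_deg (Suc l * C)"
            by (rule image_deg_mult[OF g(2) P(1)]) simp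
        qed auto
        finally show ?thesis .
      qed
    qed
    then show ?case by (simp only: power_Suc mult_ac)
  qed
  have "?a ^ (s - l) * (?a ^ l * x ^ l) \<in> fv.span (?M s)"
  proof (rule span_times[OF fv.span_base step])
    show "?a ^ (s - l) \<in> {?a ^ (s - l)}" by simp
    fix f g assume "f \<in> {?a ^ (s - l)}" "g \<in> ?M l"
    then obtain b j where f: "f = ?a ^ (s - l)" and g: "g = b * x ^ j" "b \<in> image_deg (l * C)" "j < ?e" by blast
    have "?a ^ (s - l) * b \<in> image_deg (s * C)"
      by (rule image_deg_mult[OF image_deg_power[OF a] g(2)])
        (use \<open>l \<le> s\<close> in \<open>simp add: add_mult_distrib[symmetric]\<close>)
    from base[OF this g(3)] show "f * g \<in> fv.span (?M s)" unfolding f g by (simp only: mult_ac)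
  qed
  moreover have "?a ^ (s - l) * (?a ^ l * x ^ l) = ?a ^ s * x ^ l"
    using \<open>l \<le> s\<close> by (simp only: mult.assoc[symmetric] power_add[symmetric]) simp
  ultimately show ?thesis by (simp only:)
qed

text \<open>The variables are treated one by one. Their costs in degree add up, while every exponent
  stays below \<open>e\<close>, a bound independent of \<open>s\<close>.\<close>

lemma monomial_reduction:
  assumes P: "\<And>i. i < N \<Longrightarrow> P i \<noteq> 0 \<and> poly (P i) (coordinate i) = 0 \<and> degree (P i) \<le> e \<and>
      (\<forall>j. coeff (P i) j \<in> image_deg C)"
    and "n \<le> N" "\<And>i. i < n \<Longrightarrow> \<alpha> i \<le> s"
  shows "(\<Prod>i<n. lead_coeff (P i) ^ s * coordinate i ^ \<alpha> i) \<in>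
    fv.span {b * (\<Prod>i<n. coordinate i ^ \<beta> i) | b \<beta>. b \<in> image_deg (n * (s * C)) \<and> (\<forall>i<n. \<beta> i < e)}"
  using assms(2,3)
proof (induction n)
  case 0
  have "(\<lambda>_. 1) * (\<Prod>i<0::nat. coordinate i ^ (\<lambda>_. 0) i) \<in>
    {b * (\<Prod>i<0. coordinate i ^ \<beta> i) | b \<beta>. b \<in> image_deg (0 * (s * C)) \<and> (\<forall>i<0. \<beta> i < e)}"
    by (rule CollectI, rule exI[of _ "\<lambda>_. 1"], rule exI[of _ "\<lambda>_. 0"],
      intro conjI refl image_deg_const) simp
  moreover have "(\<Prod>i<0::nat. lead_coeff (P i) ^ s * coordinate i ^ \<alpha> i) =
      (\<lambda>_. 1) * (\<Prod>i<0::nat. coordinate i ^ (\<lambda>_. 0) i)"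
    unfolding lessThan_0 prod.empty mult_1_right by (rule one_fun_def)
  ultimately show ?case by (simp only: fv.span_base)
next
  case (Suc n)
  note Pn = P[of n]
  have pow: "lead_coeff (P n) ^ s * coordinate n ^ \<alpha> n \<in>
      fv.span {b * coordinate n ^ j | b j. b \<in> image_deg (s * C) \<and> j < degree (P n)}"
    by (rule power_reduction) (use Pn Suc.prems in auto)
  have IH: "(\<Prod>i<n. lead_coeff (P i) ^ s * coordinate i ^ \<alpha> i) \<in>
    fv.span {b * (\<Prod>i<n. coordinate i ^ \<beta> i) | b \<beta>. b \<in> image_deg (n * (s * C)) \<and> (\<forall>i<n. \<beta> i < e)}"
    by (rule Suc.IH) (use Suc.prems in auto)
  have "(\<Prod>i<n. lead_coeff (P i) ^ s * coordinate i ^ \<alpha> i) * (lead_coeff (P n) ^ s * coordinate n ^ \<alpha> n) \<in>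
    fv.span {b * (\<Prod>i<Suc n. coordinate i ^ \<beta> i) | b \<beta>.
      b \<in> image_deg (Suc n * (s * C)) \<and> (\<forall>i<Suc n. \<beta> i < e)}" (is "_ \<in> fv.span ?M")
  proof (rule span_times[OF IH pow])
    fix f g
    assume "f \<in> {b * (\<Prod>i<n. coordinate i ^ \<beta> i) | b \<beta>. b \<in> image_deg (n * (s * C)) \<and> (\<forall>i<n. \<beta> i < e)}"
      and "g \<in> {b * coordinate n ^ j | b j. b \<in> image_deg (s * C) \<and> j < degree (P n)}"
    then obtain b \<beta> b' j where f: "f = b * (\<Prod>i<n. coordinate i ^ \<beta> i)" "b \<in> image_deg (n * (s * C))"
      "\<forall>i<n. \<beta> i < e" and g: "g = b' * coordinate n ^ j" "b' \<in> image_deg (s * C)" "j < degree (P n)" by blast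
    have "b * b' \<in> image_deg (Suc n * (s * C))" by (rule image_deg_mult[OF f(2) g(2)]) simp
    moreover have "\<forall>i<Suc n. (\<beta>(n := j)) i < e" using f(3) g(3) Pn Suc.prems(1) by (auto simp: less_Suc_eq)
    moreover have "f * g = (b * b') * (\<Prod>i<Suc n. coordinate i ^ (\<beta>(n := j)) i)"
    proof -
      have "(\<Prod>i<Suc n. coordinate i ^ (\<beta>(n := j)) i) = (\<Prod>i<n. coordinate i ^ \<beta> i) * coordinate n ^ j"
        unfolding prod.lessThan_Suc by (intro arg_cong2[of _ _ _ _ "(*)"] prod.cong) auto
      then show ?thesis unfolding f g by (simp only: mult_ac)
    qed
    ultimately have "f * g \<in> ?M" by blast
    then show "f * g \<in> fv.span ?M" by (rule fv.span_base)
  qed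
  then show ?case by (simp only: prod.lessThan_Suc)
qed

text \<open>Multiplied by the common denominator \<open>A\<close>, every polynomial of degree
  \<open>s\<close> becomes a combination of monomials with exponents below \<open>e\<close>, with
  coefficients pulled back from degree linear in \<open>s\<close>. Multiplication by
  \<open>A\<close> is injective in a domain, so dimensions can be compared.\<close>

lemma source_dim_le_image_dim:
  obtains E C where "E \<ge> 1" "\<And>s. pullback_dim N Z (\<lambda>x. x) s \<le> E * pullback_dim N W z (C * s)"
proof -
  obtain P e C where P: "\<And>i. i < N \<Longrightarrow> P i \<in> poly_over image_ring \<and> P i \<noteq> 0 \<and>
    poly (P i) (coordinate i) = 0 \<and> degree (P i) \<le> e \<and> (\<forall>j. coeff (P i) j \<in> image_deg C)"
    using uniform_relations by blast
  \<comment> \<open>The summand 1 keeps the factor positive even when \<open>e ^ N\<close> is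
    0.\<close>
  have "pullback_dim N Z (\<lambda>x. x) s \<le> (e ^ N + 1) * pullback_dim N W z (N * C * s)" for s
  proof -
    let ?k = "N * (s * C)"
    obtain \<B> where B: "finite \<B>" "card \<B> = pullback_dim N Z (\<lambda>x. x) s" "\<forall>P\<in>\<B>. poly_deg N s P"
      "\<forall>u. (\<forall>x\<in>Z. (\<Sum>P\<in>\<B>. u P * P x) = 0) \<longrightarrow> (\<forall>P\<in>\<B>. u P = 0)"
      by (rule pullback_basis[of N Z "\<lambda>x. x" s])
    obtain \<B>' where B': "finite \<B>'" "card \<B>' = pullback_dim N W z ?k"
      "\<forall>P. poly_deg N ?k P \<longrightarrow> (\<exists>c. \<forall>x\<in>W. P (z x) = (\<Sum>Q\<in>\<B>'. c Q * Q (z x)))"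
      by (rule pullback_basis[of N W z ?k])
    define T where "T = (\<lambda>(Q, \<beta>). image_fun Q * (\<Prod>i<N. coordinate i ^ \<beta> i)) ` (\<B>' \<times> ({..<N} \<rightarrow>\<^sub>E {..<e}))"
    have finT: "finite T" unfolding T_def using B'(1) by (intro finite_imageI finite_cartesian_product finite_PiE) auto
    have "card T \<le> card (\<B>' \<times> ({..<N} \<rightarrow>\<^sub>E {..<e}))"
      unfolding T_def using B'(1) by (intro card_image_le finite_cartesian_product finite_PiE) auto
    also have "\<dots> = e ^ N * pullback_dim N W z ?k" by (simp add: card_cartesian_product card_PiE B'(2))
    finally have cardT: "card T \<le> (e ^ N + 1) * pullback_dim N W z ?k" by simp
    define A where "A = (\<Prod>i<N. lead_coeff (P i) ^ s)"
    have A: "A \<in> regular_ring \<and> A \<noteq> 0" unfolding A_def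
    proof (rule regular_prod_nonzero)
      fix i assume i: "i < N"
      have l: "lead_coeff (P i) \<in> regular_ring"
        using P[OF i] image_ring_regular by (auto simp: poly_over_def)
      show "lead_coeff (P i) ^ s \<in> regular_ring \<and> lead_coeff (P i) ^ s \<noteq> 0"
        using P[OF i] subring_power[OF subring_regular_ring l] regular_power_nonzero[OF l] by simp
    qed
    have M_T: "b * (\<Prod>i<N. coordinate i ^ \<beta> i) \<in> fv.span T"
      if b: "b \<in> image_deg ?k" and \<beta>: "\<forall>i<N. \<beta> i < e" for b \<beta>
    proof -
      obtain Q where Q: "poly_deg N ?k Q" "b = image_fun Q" using b by (auto simp: image_deg_def)
      obtain c where c: "\<forall>x\<in>W. Q (z x) = (\<Sum>Q\<in>\<B>'. c Q * Q (z x))" using B'(3) Q(1) by blast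
      have "b = (\<Sum>Q\<in>\<B>'. fscale (c Q) (image_fun Q))"
        using c retr_in by (auto simp: Q(2) image_fun_def fun_eq_iff sum_fun_apply fscale_def)
      then have bs: "b \<in> fv.span (image_fun ` \<B>')"
        by (simp only:) (intro fv.span_sum fv.span_scale fv.span_base imageI)
      show ?thesis
      proof (rule span_times[OF bs fv.span_base])
        show "(\<Prod>i<N. coordinate i ^ \<beta> i) \<in> {\<Prod>i<N. coordinate i ^ \<beta> i}" by simp
        fix f g assume "f \<in> image_fun ` \<B>'" "g \<in> {\<Prod>i<N. coordinate i ^ \<beta> i}"
        then obtain Q where Q: "Q \<in> \<B>'" "f = image_fun Q" "g = (\<Prod>i<N. coordinate i ^ \<beta> i)" by blast
        have "g = (\<Prod>i<N. coordinate i ^ restrict \<beta> {..<N} i)" unfolding Q(3) by (intro prod.cong) auto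
        moreover have "restrict \<beta> {..<N} \<in> {..<N} \<rightarrow>\<^sub>E {..<e}" using \<beta> by auto
        ultimately have "f * g \<in> T" unfolding T_def using Q(1,2) by (intro image_eqI[of _ _ "(Q, restrict \<beta> {..<N})"]) auto
        then show "f * g \<in> fv.span T" by (rule fv.span_base)
      qed
    qed
    have span: "A * (\<lambda>x. Q (retr x)) \<in> fv.span T" if Q: "poly_deg N s Q" for Q
    proof (rule span_linear_image[OF poly_deg_span_monomials[OF Q], where L = "\<lambda>f. A * (\<lambda>x. f (retr x))"])
      fix f :: "(nat \<Rightarrow> 'k) \<Rightarrow> 'k" assume "f \<in> monomials N s"
      then obtain \<alpha> where \<alpha>: "f = monomial_fun N \<alpha>" "\<alpha> \<in> {..<N} \<rightarrow>\<^sub>E {..s}" by (auto simp: monomials_def)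
      have "(\<lambda>x. f (retr x)) = (\<Prod>i<N. coordinate i ^ \<alpha> i)"
      proof
        fix x
        have "(\<Prod>i<n. coordinate i ^ \<alpha> i) x = (\<Prod>i<n. retr x i ^ \<alpha> i)" for n
        proof (induction n)
          case (Suc n)
          have "(g ^ k) x = g x ^ k" for g :: "(nat \<Rightarrow> 'k) \<Rightarrow> 'k" and k by (induction k) auto
          with Suc show ?case by simp
        qed simp
        then show "f (retr x) = (\<Prod>i<N. coordinate i ^ \<alpha> i) x" by (simp add: \<alpha>(1) monomial_fun_def)
      qed
      then have eq: "A * (\<lambda>x. f (retr x)) = (\<Prod>i<N. lead_coeff (P i) ^ s * coordinate i ^ \<alpha> i)"
        by (simp only: A_def prod.distrib)
      have "(\<Prod>i<N. lead_coeff (P i) ^ s * coordinate i ^ \<alpha> i) \<in>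
        fv.span {b * (\<Prod>i<N. coordinate i ^ \<beta> i) | b \<beta>. b \<in> image_deg ?k \<and> (\<forall>i<N. \<beta> i < e)}"
        using P \<alpha>(2) by (intro monomial_reduction) (auto simp: PiE_iff)
      also have "\<dots> \<subseteq> fv.span T"
        by (rule fv.span_minimal) (use M_T fv.subspace_span in auto)
      finally show "A * (\<lambda>x. f (retr x)) \<in> fv.span T" unfolding eq .
    qed (auto simp: fscale_def fun_eq_iff algebra_simps)
    have "card \<B> \<le> card T"
    proof (rule family_card_le_spanning[OF B(1) finT])
      show "A * (\<lambda>x. Q (retr x)) \<in> fv.span T" if "Q \<in> \<B>" for Q using span B(3) that by blast
      fix u assume u: "\<forall>x. (\<Sum>Q\<in>\<B>. u Q * (A * (\<lambda>x. Q (retr x))) x) = 0"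
      let ?S = "\<lambda>x. \<Sum>Q\<in>\<B>. u Q * Q x"
      have degS: "poly_deg N s ?S" using B(3) by (intro poly_deg_sum poly_deg_cmult) auto
      have "A * (\<lambda>x. ?S (retr x)) = 0"
        using u by (auto simp: fun_eq_iff sum_distrib_left mult_ac)
      then have "(\<lambda>x. ?S (retr x)) = 0"
        using regular_mult_nonzero[OF _ poly_retr_regular[OF degS]] A by blast
      then have "?S x = 0" if "x \<in> W" for x using retr_id[OF that] fun_cong[of "\<lambda>x. ?S (retr x)" 0 x] by simp
      then have "\<forall>x\<in>Z. ?S x = 0" using zero_on_Z[OF degS] by blast
      then show "\<forall>Q\<in>\<B>. u Q = 0" using B(4) by blast
    qed
    then show ?thesis using cardT B(2) by (simp add: mult_ac)
  qed
  then show ?thesis by (intro that[of "e ^ N + 1" "N * C"]) auto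
qed

text \<open>A function \<open>F\<close> that vanishes on the image but not on \<open>Z\<close> acts
  like a coordinate transversal to the image: its powers are independent over polynomials that are
  independent on the image. The \<open>k\<close> powers below \<open>F ^ k\<close> give the factor
  \<open>k\<close>.\<close>

lemma image_dim_growth:
  assumes F: "poly_deg N s1 F" "\<And>x. x \<in> W \<Longrightarrow> F (z x) = 0" "\<exists>x\<in>Z. F x \<noteq> 0"
  shows "k * pullback_dim N W z (k * s1) \<le> pullback_dim N Z (\<lambda>x. x) (2 * k * s1)"
proof -
  obtain \<B> where B: "finite \<B>" "card \<B> = pullback_dim N W z (k * s1)" "\<forall>P\<in>\<B>. poly_deg N (k * s1) P"
    "\<forall>u. (\<forall>x\<in>W. (\<Sum>P\<in>\<B>. u P * P (z x)) = 0) \<longrightarrow> (\<forall>P\<in>\<B>. u P = 0)"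
    by (rule pullback_basis[of N W z "k * s1"])
  have "card ({..<k} \<times> \<B>) \<le> pullback_dim N Z (\<lambda>x. x) (2 * k * s1)"
  proof (rule card_le_pullback_dim[where G = "\<lambda>(j, P) x. F x ^ j * P x"])
    fix i assume "i \<in> {..<k} \<times> \<B>"
    then obtain j P where i: "i = (j, P)" "j < k" "P \<in> \<B>" by auto
    have "j * s1 + k * s1 \<le> 2 * k * s1" using i(2) by (simp add: add_mult_distrib[symmetric])
    moreover have "poly_deg N (k * s1) P" using B(3) i(3) by blast
    ultimately have "poly_deg N (2 * k * s1) (\<lambda>x. F x ^ j * P x)"
      by (intro poly_deg.mult[OF poly_deg_power[OF F(1)]])
    then show "poly_deg N (2 * k * s1) (case i of (j, P) \<Rightarrow> \<lambda>x. F x ^ j * P x)" by (simp add: i)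
  next
    fix u :: "nat \<times> ((nat \<Rightarrow> 'k) \<Rightarrow> 'k) \<Rightarrow> 'k"
    assume u: "\<forall>x\<in>Z. (\<Sum>i\<in>{..<k} \<times> \<B>. u i * (case i of (j, P) \<Rightarrow> \<lambda>x. F x ^ j * P x) x) = 0"
    define Q where "Q j x = (\<Sum>P\<in>\<B>. u (j, P) * P x)" for j x
    have degQ: "poly_deg N (k * s1) (Q j)" for j
      unfolding Q_def[abs_def] using B(3) by (intro poly_deg_sum poly_deg_cmult) auto
    have rel: "(\<Sum>j<k. F x ^ j * Q j x) = 0" if "x \<in> Z" for x
    proof -
      have "(\<Sum>j<k. F x ^ j * Q j x) = (\<Sum>j<k. \<Sum>P\<in>\<B>. u (j, P) * (F x ^ j * P x))"
        by (simp add: Q_def sum_distrib_left mult_ac)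
      also have "\<dots> = 0" using u that by (simp add: sum.cartesian_product split_def)
      finally show ?thesis .
    qed
    have zero: "\<forall>P\<in>\<B>. u (j, P) = 0" if "j < k" for j
      using that
    proof (induction j rule: less_induct)
      case (less j)
      have Q0: "Q i x = 0" if "i < j" for i x
        unfolding Q_def using less.IH[OF that] that less.prems by simp
      \<comment> \<open>The relation divided by \<open>F ^ j\<close>, where \<open>j\<close> is the
        lowest index left; irreducibility permits the division.\<close>
      define H where "H x = (\<Sum>i\<in>{j..<k}. F x ^ (i - j) * Q i x)" for x
      have degH: "poly_deg N ((k + k) * s1) H"
        unfolding H_def[abs_def]
      proof (rule poly_deg_sum)
        fix i assume "i \<in> {j..<k}"
        then have "(i - j) * s1 \<le> k * s1" by (intro mult_right_mono) auto
        then have "(i - j) * s1 + k * s1 \<le> (k + k) * s1" by (simp add: add_mult_distrib)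
        then show "poly_deg N ((k + k) * s1) (\<lambda>x. F x ^ (i - j) * Q i x)"
          by (rule poly_deg.mult[OF poly_deg_power[OF F(1)] degQ])
      qed
      have "F x ^ j * H x = 0" if "x \<in> Z" for x
      proof -
        have "F x ^ j * H x = (\<Sum>i\<in>{j..<k}. F x ^ i * Q i x)"
          unfolding H_def sum_distrib_left
          by (intro sum.cong refl) (simp add: mult.assoc[symmetric] power_add[symmetric])
        also have "\<dots> = (\<Sum>i<k. F x ^ i * Q i x)"
          by (rule sum.mono_neutral_left) (auto simp: Q0)
        finally show ?thesis using rel[OF that] by simp
      qed
      from Z_irreducible[OF poly_deg_power[OF F(1)] degH this] F(3)
      have H0: "H x = 0" if "x \<in> Z" for x using that by auto
      \<comment> \<open>On the image every term with a positive power of \<open>F\<close> dies, so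
        only the coefficient of index \<open>j\<close> survives, and the basis is independent
        there.\<close>
      have "Q j (z x) = 0" if x: "x \<in> W" for x
      proof -
        have zx: "z x \<in> Z" using x z_in by (auto simp: W_def)
        have "H (z x) = F (z x) ^ 0 * Q j (z x) + (\<Sum>i\<in>{Suc j..<k}. F (z x) ^ (i - j) * Q i (z x))"
          unfolding H_def using less.prems by (subst sum.atLeast_Suc_lessThan) auto
        also have "(\<Sum>i\<in>{Suc j..<k}. F (z x) ^ (i - j) * Q i (z x)) = 0"
          by (rule sum.neutral) (auto simp: F(2)[OF x])
        finally show ?thesis using H0[OF zx] by simp
      qed
      then show ?case using B(4)[rule_format, of "\<lambda>P. u (j, P)"] by (auto simp: Q_def)
    qed
    then show "\<forall>i\<in>{..<k} \<times> \<B>. u i = 0" by auto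
  qed (use B in auto)
  then show ?thesis using B(2) by (simp add: card_cartesian_product)
qed

text \<open>If \<open>F\<close> were nonzero, then its powers would make the dimension of the source grow faster
  than any power of the degree.\<close>

lemma dominant:
  assumes F: "poly_deg N s F" "\<And>x. x \<in> W \<Longrightarrow> F (z x) = 0" and "x \<in> Z"
  shows "F x = 0"
proof (rule ccontr)
  assume "F x \<noteq> 0"
  then have F0: "\<exists>x\<in>Z. F x \<noteq> 0" using \<open>x \<in> Z\<close> by auto
  define s1 where "s1 = max s 1"
  have F1: "poly_deg N s1 F" using F(1) by (rule poly_deg_mono) (simp add: s1_def)
  let ?v = "pullback_dim N Z (\<lambda>x. x)" and ?w = "pullback_dim N W z"
  obtain E C0 where E: "E \<ge> 1" "\<And>s. ?v s \<le> E * ?w (C0 * s)" using source_dim_le_image_dim by blast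
  have wmono: "?w a \<le> ?w b" if "a \<le> b" for a b
  proof -
    obtain \<B> where B: "finite \<B>" "card \<B> = ?w a" "\<forall>P\<in>\<B>. poly_deg N a P"
      "\<forall>u. (\<forall>x\<in>W. (\<Sum>P\<in>\<B>. u P * P (z x)) = 0) \<longrightarrow> (\<forall>P\<in>\<B>. u P = 0)"
      by (rule pullback_basis[of N W z a])
    have "card \<B> \<le> ?w b"
    proof (rule card_le_pullback_dim[where G = "\<lambda>P. P"])
      show "poly_deg N b P" if "P \<in> \<B>" for P using B(3) poly_deg_mono[OF _ \<open>a \<le> b\<close>] that by blast
    qed (use B in auto)
    then show ?thesis using B(2) by simp
  qed
  define C where "C = max C0 1"
  have C: "?v s \<le> E * ?w (C * s)" for s
  proof -
    have "?w (C0 * s) \<le> ?w (C * s)" by (rule wmono) (simp add: C_def)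
    then show ?thesis using E(2)[of s] by (meson mult_le_mono2 order_trans)
  qed
  \<comment> \<open>Degrees are measured in units of \<open>s1\<close>, the degree bound of
    \<open>F\<close>, to match the powers of \<open>F\<close>.\<close>
  define v where "v t = ?v (t * s1)" for t
  \<comment> \<open>One more than \<open>growth_factor_le\<close> permits for the scaling factor
    \<open>2 * C\<close>, so the growth inequality for this \<open>?h\<close> is absurd.\<close>
  let ?h = "(2 * C) ^ N + 1"
  have "?h \<le> (2 * C) ^ N"
  proof (rule growth_factor_le[where v = v and c = "s1 ^ N" and ?s0.0 = "?h * E"])
    fix t
    have "?v (t * s1) \<le> (t * s1 + 1) ^ N" by (rule pullback_basis[of N Z "\<lambda>x. x" "t * s1"])
    also have "\<dots> \<le> (s1 * (t + 1)) ^ N" by (rule power_mono) (auto simp: s1_def algebra_simps)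
    finally show "v t \<le> s1 ^ N * (t + 1) ^ N" by (simp only: v_def power_mult_distrib)
    show "1 \<le> v t" unfolding v_def using \<open>x \<in> Z\<close> by (rule pullback_dim_pos)
    assume t: "?h * E \<le> t"
    \<comment> \<open>Once \<open>t\<close> reaches \<open>?h * E\<close>, the gain
      \<open>C * t\<close> from the powers of \<open>F\<close> pays both for the factor
      \<open>?h\<close> and for the loss \<open>E\<close> in passing to the image.\<close>
    have "E * (?h * v t) \<le> t * v t" using t by (simp only: mult.assoc[symmetric] mult.commute[of E] mult_le_mono1)
    also have "\<dots> \<le> t * (E * ?w (C * (t * s1)))" unfolding v_def by (intro mult_le_mono2 C)
    also have "\<dots> \<le> E * ((C * t) * ?w ((C * t) * s1))"
    proof -
      have "t \<le> C * t" by (simp add: C_def)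
      then have "t * ?w ((C * t) * s1) \<le> (C * t) * ?w ((C * t) * s1)" by (rule mult_le_mono1)
      then have "E * (t * ?w ((C * t) * s1)) \<le> E * ((C * t) * ?w ((C * t) * s1))" by (rule mult_le_mono2)
      then show ?thesis by (simp only: mult_ac)
    qed
    also have "\<dots> \<le> E * ?v (2 * (C * t) * s1)"
      by (intro mult_le_mono2 image_dim_growth[OF F1 F(2) F0])
    also have "2 * (C * t) * s1 = (2 * C) * t * s1" by simp
    finally show "?h * v t \<le> v ((2 * C) * t)" using E(1) unfolding v_def by simp
  qed (simp add: C_def)
  then show False by simp
qed

text \<open>Multiplying pullbacks along \<open>z\<close> by the powers of a function that separates a generic
  fibre gives independent functions.\<close>

theorem fibre_card_le:
  assumes e: "poly_deg N d e" and T: "poly_deg N d' T" "\<exists>x\<in>Z. T x \<noteq> 0"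
    and S: "\<And>x. x \<in> Z \<Longrightarrow> T x \<noteq> 0 \<Longrightarrow> \<exists>S \<subseteq> W. card S = h \<and> inj_on e S \<and> x \<in> S \<and> (\<forall>y\<in>S. z y = z x)"
  shows "h \<le> (D + 1) ^ N"
proof -
  let ?v = "pullback_dim N Z (\<lambda>x. x)"
  obtain x0 where x0: "x0 \<in> Z" using q_nonzero by auto
  show ?thesis
  proof (rule growth_factor_le[where v = ?v and c = 1 and ?s0.0 = "D + h * d"])
    fix s
    have "?v s \<le> (s + 1) ^ N" by (rule pullback_basis[of N Z "\<lambda>x. x" s])
    then show "?v s \<le> 1 * (s + 1) ^ N" by simp
    show "1 \<le> ?v s" using x0 by (rule pullback_dim_pos)
    assume s: "D + h * d \<le> s"
    obtain \<B> where B: "finite \<B>" "card \<B> = ?v s" "\<forall>P\<in>\<B>. poly_deg N s P"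
      "\<forall>u. (\<forall>x\<in>Z. (\<Sum>P\<in>\<B>. u P * P x) = 0) \<longrightarrow> (\<forall>P\<in>\<B>. u P = 0)"
      by (rule pullback_basis[of N Z "\<lambda>x. x" s])
    \<comment> \<open>Pullbacks along \<open>z\<close> are fractions; the single factor
      \<open>q ^ s\<close> makes the pullbacks of the whole basis polynomials of degree
      \<open>s * D\<close>.\<close>
    have "\<forall>P\<in>\<B>. \<exists>R. poly_deg N (s * D) R \<and> (\<forall>x\<in>W. R x = P (z x) * q x ^ s)"
    proof
      fix P assume "P \<in> \<B>"
      then have P: "poly_deg N s P" using B(3) by blast
      from poly_deg_compose[OF this, where p = p and q = q and D = D and M = N] p_deg q_deg
      obtain R where "poly_deg N (s * D) R" "\<And>x y. (\<forall>i<N. y i * q x = p i x) \<Longrightarrow> R x = P y * q x ^ s" by blast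
      then show "\<exists>R. poly_deg N (s * D) R \<and> (\<forall>x\<in>W. R x = P (z x) * q x ^ s)"
        using z_eq by (intro exI[of _ R]) (auto simp: W_def)
    qed
    then obtain R where R: "\<And>P. P \<in> \<B> \<Longrightarrow> poly_deg N (s * D) (R P)"
      "\<And>P x. P \<in> \<B> \<Longrightarrow> x \<in> W \<Longrightarrow> R P x = P (z x) * q x ^ s" by metis
    have "card ({..<h} \<times> \<B>) \<le> ?v ((D + 1) * s)"
    proof (rule card_le_pullback_dim[where G = "\<lambda>(j, P) x. e x ^ j * R P x"])
      fix i assume "i \<in> {..<h} \<times> \<B>"
      then obtain j P where i: "i = (j, P)" "j < h" "P \<in> \<B>" by auto
      \<comment> \<open>The powers of \<open>e\<close> add at most \<open>h * d \<le> s\<close> to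
        the degree \<open>s * D\<close>; this is the origin of \<open>(D + 1) * s\<close> and of the
        lower bound on \<open>s\<close>.\<close>
      have "j * d \<le> h * d" using i(2) by simp
      moreover have "(D + 1) * s = s * D + s" by simp
      ultimately have "j * d + s * D \<le> (D + 1) * s" using s by linarith
      then have "poly_deg N ((D + 1) * s) (\<lambda>x. e x ^ j * R P x)"
        by (rule poly_deg.mult[OF poly_deg_power[OF e] R(1)[OF i(3)]])
      then show "poly_deg N ((D + 1) * s) (case i of (j, P) \<Rightarrow> \<lambda>x. e x ^ j * R P x)" by (simp add: i)
    next
      fix u :: "nat \<times> ((nat \<Rightarrow> 'k) \<Rightarrow> 'k) \<Rightarrow> 'k"
      assume u: "\<forall>x\<in>Z. (\<Sum>i\<in>{..<h} \<times> \<B>. u i * (case i of (j, P) \<Rightarrow> \<lambda>x. e x ^ j * R P x) x) = 0"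
      define Q where "Q j x = (\<Sum>P\<in>\<B>. u (j, P) * P x)" for j x
      have degQ: "poly_deg N s (Q j)" for j
        unfolding Q_def[abs_def] using B(3) by (intro poly_deg_sum poly_deg_cmult) auto
      have rel: "(\<Sum>j<h. Q j (z y) * e y ^ j) = 0" if y: "y \<in> W" for y
      proof -
        have "0 = (\<Sum>j<h. \<Sum>P\<in>\<B>. u (j, P) * (e y ^ j * R P y))"
          using u y by (simp add: sum.cartesian_product split_def W_def)
        also have "\<dots> = (\<Sum>j<h. Q j (z y) * e y ^ j) * q y ^ s"
          using R(2)[OF _ y] by (simp add: Q_def sum_distrib_left sum_distrib_right mult_ac cong: sum.cong)
        finally show ?thesis using y by (simp add: W_def)
      qed
      \<comment> \<open>On a fibre of \<open>z\<close> the relation is a polynomial in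
        \<open>e\<close> of degree below \<open>h\<close> whose coefficients are constant on the
        fibre. It has the \<open>h\<close> distinct roots \<open>e y\<close>, so it is zero.\<close>
      have generic: "Q j (z x) = 0" if x: "x \<in> Z" "T x \<noteq> 0" and "j < h" for x j
      proof -
        obtain S where S: "S \<subseteq> W" "card S = h" "inj_on e S" "\<forall>y\<in>S. z y = z x" using S[OF x] by blast
        define f where "f = (\<Sum>j<h. monom (Q j (z x)) j)"
        have root: "poly f c = 0" if c: "c \<in> e ` S" for c
        proof -
          obtain y where y: "y \<in> S" "c = e y" using c by auto
          have "y \<in> W" "z y = z x" using y S by auto
          then show ?thesis using rel[of y] by (simp add: f_def poly_sum poly_monom y(2))
        qed
        have cf: "coeff f i = (if i < h then Q i (z x) else 0)" for i
          by (simp add: f_def coeff_sum coeff_monom sum.delta)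
        have "f = 0"
        proof (rule ccontr)
          assume "f \<noteq> 0"
          have "degree f < h"
          proof (rule ccontr)
            assume "\<not> degree f < h"
            then have "coeff f (degree f) = 0" by (simp add: cf)
            then show False using \<open>f \<noteq> 0\<close> by simp
          qed
          moreover have "card (e ` S) \<le> card {c. poly f c = 0}"
            using root by (intro card_mono poly_roots_finite \<open>f \<noteq> 0\<close>) auto
          moreover have "card {c. poly f c = 0} \<le> degree f" by (rule card_poly_roots_bound[OF \<open>f \<noteq> 0\<close>])
          ultimately show False using S by (simp add: card_image)
        qed
        then show ?thesis using cf[of j] \<open>j < h\<close> by simp
      qed
      have "\<forall>P\<in>\<B>. u (j, P) = 0" if j: "j < h" for j
      proof -
        from poly_deg_compose[OF degQ[of j], where p = p and q = q and D = D and M = N] p_deg q_deg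
        obtain R' where R': "poly_deg N (s * D) R'" "\<And>x y. (\<forall>i<N. y i * q x = p i x) \<Longrightarrow> R' x = Q j y * q x ^ s" by blast
        have R'W: "R' x = Q j (z x) * q x ^ s" if "x \<in> W" for x using R'(2) z_eq that by (auto simp: W_def)
        have degqR: "poly_deg N (D + s * D) (\<lambda>x. q x * R' x)" by (rule poly_deg.mult[OF q_deg R'(1) order_refl])
        \<comment> \<open>The vanishing is known only where \<open>T\<close> and \<open>q\<close>
          are nonzero. Irreducibility extends it to \<open>W\<close>, and dominance carries it from
          the image to \<open>Z\<close>.\<close>
        have "T x * (q x * R' x) = 0" if "x \<in> Z" for x
        proof (cases "T x = 0 \<or> q x = 0")
          case False
          then have "x \<in> W" using that by (simp add: W_def)
          with False show ?thesis using generic[OF that _ j] R'W by simp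
        qed auto
        from Z_irreducible[OF T(1) degqR this] T(2) have "q x * R' x = 0" if "x \<in> Z" for x using that by blast
        then have "Q j (z x) = 0" if "x \<in> W" for x using R'W[OF that] that by (force simp: W_def)
        then have "\<forall>x\<in>Z. Q j x = 0" using dominant[OF degQ] by blast
        then show ?thesis using B(4)[rule_format, of "\<lambda>P. u (j, P)"] by (auto simp: Q_def)
      qed
      then show "\<forall>i\<in>{..<h} \<times> \<B>. u i = 0" by auto
    qed (use B in auto)
    then show "h * ?v s \<le> ?v ((D + 1) * s)" using B(2) by (simp add: card_cartesian_product)
  qed simp
qed

end

section \<open>Irreducible open subsets of affine algebraic sets\<close>

lemma subring_polynomial_functions: "subring_set (polynomial_functions N :: ((nat \<Rightarrow> 'k::comm_ring_1) \<Rightarrow> 'k) set)"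
  unfolding subring_set_def
proof (intro conjI ballI)
  show "1 \<in> (polynomial_functions N :: ((nat \<Rightarrow> 'k) \<Rightarrow> 'k) set)"
    unfolding one_fun_def by (rule polynomial_functions.const)
  fix P Q :: "(nat \<Rightarrow> 'k) \<Rightarrow> 'k" assume PQ: "P \<in> polynomial_functions N" "Q \<in> polynomial_functions N"
  show "P * Q \<in> polynomial_functions N" unfolding times_fun_def by (rule polynomial_functions.mult[OF PQ])
  have "(\<lambda>x. P x + (\<lambda>x. (\<lambda>_. - 1) x * Q x) x) \<in> polynomial_functions N"
    by (intro polynomial_functions.add polynomial_functions.mult polynomial_functions.const PQ)
  moreover have "(\<lambda>x. P x + (\<lambda>x. (\<lambda>_. - 1) x * Q x) x) = P - Q" by (auto simp: fun_eq_iff)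
  ultimately show "P - Q \<in> polynomial_functions N" by (simp only:)
qed

text \<open>Induction on the number of coordinates: the last one is adjoined by
  \<open>hilbert_basis\<close>, and without coordinates only the constants, a field, are
  left.\<close>

lemma noetherian_polynomial_functions:
  "noetherian_set (polynomial_functions N :: ((nat \<Rightarrow> 'k::field) \<Rightarrow> 'k) set)"
proof (induction N)
  case 0
  have c: "\<exists>c. P = (\<lambda>_. c)" if "P \<in> polynomial_functions 0" for P :: "(nat \<Rightarrow> 'k) \<Rightarrow> 'k"
    using that by induction auto
  show ?case
  proof (rule noetherian_field[OF subring_polynomial_functions])
    fix P :: "(nat \<Rightarrow> 'k) \<Rightarrow> 'k" assume P: "P \<in> polynomial_functions 0" "P \<noteq> 0"
    obtain c where Pc: "P = (\<lambda>_. c)" using c[OF P(1)] ..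
    have "c \<noteq> 0" using P(2) unfolding Pc zero_fun_def by blast
    then have "(\<lambda>_. 1 / c) * P = 1" unfolding Pc by (auto simp: fun_eq_iff)
    then show "\<exists>Q\<in>polynomial_functions 0. Q * P = 1" using polynomial_functions.const by blast
  qed
next
  case (Suc N)
  have mono: "P \<in> polynomial_functions (Suc N)" if "P \<in> polynomial_functions N" for P :: "(nat \<Rightarrow> 'k) \<Rightarrow> 'k"
    using that by induction (auto intro: polynomial_functions.intros)
  let ?x = "\<lambda>x :: nat \<Rightarrow> 'k. x N"
  note A = adjoin_subring[OF subring_polynomial_functions[of N], of ?x]
  have "polynomial_functions (Suc N) = adjoin (polynomial_functions N) ?x"
  proof
    show "adjoin (polynomial_functions N) ?x \<subseteq> polynomial_functions (Suc N)"
      using mono by (intro adjoin_least subring_polynomial_functions) (auto intro: polynomial_functions.coord)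
    show "polynomial_functions (Suc N) \<subseteq> adjoin (polynomial_functions N) ?x"
    proof
      fix P :: "(nat \<Rightarrow> 'k) \<Rightarrow> 'k" assume "P \<in> polynomial_functions (Suc N)"
      then show "P \<in> adjoin (polynomial_functions N) ?x"
      proof induction
        case (const c) then show ?case using A(2) polynomial_functions.const by blast
      next
        case (coord i)
        show ?case
        proof (cases "i = N")
          case True then show ?thesis using A(3) by simp
        next
          case False
          then have "(\<lambda>x :: nat \<Rightarrow> 'k. x i) \<in> polynomial_functions N"
            using coord by (intro polynomial_functions.coord) auto
          then show ?thesis using A(2) by blast
        qed
      next
        case (add P Q)
        then have "P + Q \<in> adjoin (polynomial_functions N) ?x" by (intro subring_add[OF A(1)])
        then show ?case unfolding plus_fun_def .
      next
        case (mult P Q)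
        then have "P * Q \<in> adjoin (polynomial_functions N) ?x" by (intro subring_mult[OF A(1)])
        then show ?case unfolding times_fun_def .
      qed
    qed
  qed
  then show ?case using hilbert_basis[OF subring_polynomial_functions Suc.IH, of ?x] by (simp only:)
qed

text \<open>A nonzero function with a maximal annihilator has an irreducible nonvanishing locus.\<close>

lemma exists_prime_annihilator:
  fixes Z :: "(nat \<Rightarrow> 'k::field) set"
  assumes "Z \<noteq> {}"
  obtains f where "f \<in> polynomial_functions N" "\<exists>x\<in>Z. f x \<noteq> 0"
    "\<forall>P\<in>polynomial_functions N. \<forall>Q\<in>polynomial_functions N.
       (\<exists>x\<in>Z. P x * f x \<noteq> 0) \<longrightarrow> (\<exists>x\<in>Z. Q x * f x \<noteq> 0) \<longrightarrow> (\<exists>x\<in>Z. P x * Q x * f x \<noteq> 0)"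
proof -
  let ?Pol = "polynomial_functions N :: ((nat \<Rightarrow> 'k) \<Rightarrow> 'k) set"
  note R = subring_polynomial_functions[of N, where 'k = 'k]
  define F where "F = {f \<in> ?Pol. \<exists>x\<in>Z. f x \<noteq> 0}"
  define Ann where "Ann f = {P \<in> ?Pol. \<forall>x\<in>Z. P x * f x = 0}" for f
  have ideal: "ideal_in ?Pol (Ann f)" for f
    unfolding ideal_in_def
  proof (intro conjI ballI)
    show "Ann f \<subseteq> ?Pol" "0 \<in> Ann f" using subring_zero[OF R] by (auto simp: Ann_def)
    fix a assume a: "a \<in> Ann f"
    show "a + b \<in> Ann f" if "b \<in> Ann f" for b
    proof -
      have "(a + b) x * f x = 0" if "x \<in> Z" for x
      proof -
        have "a x * f x = 0" "b x * f x = 0" using a \<open>b \<in> Ann f\<close> that unfolding Ann_def by blast+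
        then show ?thesis by (simp only: plus_fun_apply distrib_right add_0)
      qed
      then show ?thesis using a that subring_add[OF R] unfolding Ann_def by blast
    qed
    show "b * a \<in> Ann f" if "b \<in> ?Pol" for b
      using a that subring_mult[OF R] by (auto simp: Ann_def)
  qed
  \<comment> \<open>Without a maximal annihilator, dependent choice would build a strictly
    increasing chain of ideals.\<close>
  have "\<exists>f\<in>F. \<forall>g\<in>F. Ann f \<subseteq> Ann g \<longrightarrow> Ann g = Ann f"
  proof (rule ccontr)
    assume "\<not> ?thesis"
    then have step: "\<exists>g. g \<in> F \<and> Ann f \<subset> Ann g" if "f \<in> F" for f using that by blast
    have "(\<lambda>_. 1) \<in> F" using assms by (auto simp: F_def intro: polynomial_functions.const)
    then obtain s :: "nat \<Rightarrow> _" where s: "\<And>n. s n \<in> F" "\<And>n. Ann (s n) \<subset> Ann (s (Suc n))"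
      using dependent_nat_choice[of "\<lambda>_ f. f \<in> F" "\<lambda>_ f g. Ann f \<subset> Ann g"] step by metis
    have "mono (\<lambda>n. Ann (s n))" using s(2) by (intro incseq_SucI) blast
    then obtain m where "\<forall>n\<ge>m. Ann (s n) = Ann (s m)"
      using noetherian_polynomial_functions[of N, where 'k = 'k] ideal unfolding noetherian_set_def by metis
    then show False using s(2)[of m] by (metis le_SucI le_refl psubsetE subset_refl)
  qed
  then obtain f where f: "f \<in> F" "\<And>g. g \<in> F \<Longrightarrow> Ann f \<subseteq> Ann g \<Longrightarrow> Ann g = Ann f" by blast
  show ?thesis
  proof (rule that[of f], goal_cases)
    case 3
    show ?case
    proof (intro ballI impI)
      fix P Q assume P: "P \<in> ?Pol" "\<exists>x\<in>Z. P x * f x \<noteq> 0" and Q: "Q \<in> ?Pol" "\<exists>x\<in>Z. Q x * f x \<noteq> 0"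
      \<comment> \<open>As \<open>Q\<close> does not annihilate \<open>f\<close>, the annihilator of
        the product of \<open>Q\<close> and \<open>f\<close> contains that of \<open>f\<close> and
        equals it by maximality, so \<open>P\<close> is not in it.\<close>
      have "(\<lambda>x. Q x * f x) \<in> ?Pol" using Q(1) f(1) by (auto simp: F_def intro: polynomial_functions.mult)
      then have "(\<lambda>x. Q x * f x) \<in> F" using Q(2) unfolding F_def by blast
      moreover have "Ann f \<subseteq> Ann (\<lambda>x. Q x * f x)" by (auto simp: Ann_def)
      ultimately have "Ann (\<lambda>x. Q x * f x) = Ann f" by (rule f(2))
      moreover have "P \<notin> Ann f" using P by (auto simp: Ann_def)
      ultimately have "P \<notin> Ann (\<lambda>x. Q x * f x)" by blast
      then show "\<exists>x\<in>Z. P x * Q x * f x \<noteq> 0" using P(1) by (auto simp: Ann_def mult.assoc)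
    qed
  qed (use f(1) in \<open>auto simp: F_def\<close>)
qed

section \<open>Local fractions\<close>

text \<open>A common setting for germs at \<open>p0\<close>, used for a chart and for the product of
  a chart with itself. Neighbourhoods are tested by nonvanishing of a member of the algebra, so that
  shrinking a set and clearing a denominator are the same operation.\<close>

locale local_algebra =
  fixes \<P> :: "('p \<Rightarrow> 'k::field) set" and A :: "'p set" and p0 :: 'p
  assumes const: "(\<lambda>_. c) \<in> \<P>"
    and add: "S \<in> \<P> \<Longrightarrow> T \<in> \<P> \<Longrightarrow> (\<lambda>p. S p + T p) \<in> \<P>"
    and mult: "S \<in> \<P> \<Longrightarrow> T \<in> \<P> \<Longrightarrow> (\<lambda>p. S p * T p) \<in> \<P>"
    and p0: "p0 \<in> A"
begin

definition nb :: "'p set \<Rightarrow> bool" where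
  "nb M \<longleftrightarrow> (\<exists>T\<in>\<P>. T p0 \<noteq> 0 \<and> (\<forall>p\<in>A. T p \<noteq> 0 \<longrightarrow> p \<in> M))"

definition rat :: "('p \<Rightarrow> 'k) \<Rightarrow> bool" where
  "rat f \<longleftrightarrow> (\<exists>S\<in>\<P>. \<exists>T\<in>\<P>. T p0 \<noteq> 0 \<and> (\<forall>p\<in>A. T p \<noteq> 0 \<longrightarrow> f p = S p / T p))"

lemma nbI: "T \<in> \<P> \<Longrightarrow> T p0 \<noteq> 0 \<Longrightarrow> (\<And>p. p \<in> A \<Longrightarrow> T p \<noteq> 0 \<Longrightarrow> p \<in> M) \<Longrightarrow> nb M"
  unfolding nb_def by blast

lemma ratI: "S \<in> \<P> \<Longrightarrow> T \<in> \<P> \<Longrightarrow> T p0 \<noteq> 0 \<Longrightarrow> (\<And>p. p \<in> A \<Longrightarrow> T p \<noteq> 0 \<Longrightarrow> f p = S p / T p) \<Longrightarrow> rat f"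
  unfolding rat_def by blast

lemma nb_mono: "nb M \<Longrightarrow> M \<inter> A \<subseteq> M' \<Longrightarrow> nb M'"
  unfolding nb_def by blast

lemma nb_Int:
  assumes "nb M" "nb M'" shows "nb (M \<inter> M')"
proof -
  obtain T T' where "T \<in> \<P>" "T p0 \<noteq> 0" "\<forall>p\<in>A. T p \<noteq> 0 \<longrightarrow> p \<in> M"
    "T' \<in> \<P>" "T' p0 \<noteq> 0" "\<forall>p\<in>A. T' p \<noteq> 0 \<longrightarrow> p \<in> M'" using assms unfolding nb_def by blast
  then show ?thesis by (intro nbI[of "\<lambda>p. T p * T' p"] mult) auto
qed

lemma rat_const: "rat (\<lambda>_. c)"
  by (rule ratI[OF const[of c] const[of 1]]) auto

lemma rat_cong:
  assumes "rat f" "nb M" "\<And>p. p \<in> M \<Longrightarrow> p \<in> A \<Longrightarrow> g p = f p"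
  shows "rat g"
proof -
  obtain S T T' where "S \<in> \<P>" "T \<in> \<P>" "T p0 \<noteq> 0" "\<forall>p\<in>A. T p \<noteq> 0 \<longrightarrow> f p = S p / T p"
    "T' \<in> \<P>" "T' p0 \<noteq> 0" "\<forall>p\<in>A. T' p \<noteq> 0 \<longrightarrow> p \<in> M" using assms(1,2) unfolding nb_def rat_def by blast
  then show ?thesis
    by (intro ratI[of "\<lambda>p. S p * T' p" "\<lambda>p. T p * T' p"] mult) (auto simp: assms(3))
qed

lemma
  assumes "rat f" "rat g"
  shows rat_add: "rat (\<lambda>p. f p + g p)" and rat_mult: "rat (\<lambda>p. f p * g p)"
proof -
  obtain S T S' T' where *: "S \<in> \<P>" "T \<in> \<P>" "T p0 \<noteq> 0" "\<forall>p\<in>A. T p \<noteq> 0 \<longrightarrow> f p = S p / T p"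
    "S' \<in> \<P>" "T' \<in> \<P>" "T' p0 \<noteq> 0" "\<forall>p\<in>A. T' p \<noteq> 0 \<longrightarrow> g p = S' p / T' p"
    using assms unfolding rat_def by blast
  show "rat (\<lambda>p. f p + g p)"
    by (rule ratI[of "\<lambda>p. S p * T' p + S' p * T p" "\<lambda>p. T p * T' p"])
      (use * in \<open>auto intro: mult add simp: add_frac_eq\<close>)
  show "rat (\<lambda>p. f p * g p)"
    by (rule ratI[of "\<lambda>p. S p * S' p" "\<lambda>p. T p * T' p"]) (use * in \<open>auto intro: mult\<close>)
qed

lemma rat_sum: "(\<And>i. i \<in> I \<Longrightarrow> rat (f i)) \<Longrightarrow> rat (\<lambda>p. \<Sum>i\<in>I. f i p)"
  by (induction I rule: infinite_finite_induct) (auto intro: rat_const rat_add)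

lemma rat_nonzero:
  assumes "rat f" "f p0 \<noteq> 0" shows "nb {p. f p \<noteq> 0}"
proof -
  obtain S T where *: "S \<in> \<P>" "T \<in> \<P>" "T p0 \<noteq> 0" "\<forall>p\<in>A. T p \<noteq> 0 \<longrightarrow> f p = S p / T p"
    using assms unfolding rat_def by blast
  have "S p0 \<noteq> 0" using * assms(2) p0 by auto
  then show ?thesis using * by (intro nbI[of "\<lambda>p. S p * T p"] mult) auto
qed

lemma rat_divide:
  assumes "rat f" "rat g" "g p0 \<noteq> 0" shows "rat (\<lambda>p. f p / g p)"
proof -
  obtain S T S' T' where *: "S \<in> \<P>" "T \<in> \<P>" "T p0 \<noteq> 0" "\<forall>p\<in>A. T p \<noteq> 0 \<longrightarrow> f p = S p / T p"
    "S' \<in> \<P>" "T' \<in> \<P>" "T' p0 \<noteq> 0" "\<forall>p\<in>A. T' p \<noteq> 0 \<longrightarrow> g p = S' p / T' p"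
    using assms unfolding rat_def by blast
  have "S' p0 \<noteq> 0" using * assms(3) p0 by auto
  then show ?thesis
    using * by (intro ratI[of "\<lambda>p. S p * T' p * T' p" "\<lambda>p. T p * S' p * T' p"] mult) auto
qed

text \<open>Multiplying denominators only shrinks the locus where the product is nonzero, so a
  single \<open>T\<close> can also certify membership in \<open>M\<close>.\<close>

lemma common_denominator:
  assumes "finite I" "\<And>i. i \<in> I \<Longrightarrow> rat (f i)" "nb M"
  shows "\<exists>T\<in>\<P>. \<exists>S. T p0 \<noteq> 0 \<and> (\<forall>i\<in>I. S i \<in> \<P>) \<and>
    (\<forall>p\<in>A. T p \<noteq> 0 \<longrightarrow> p \<in> M \<and> (\<forall>i\<in>I. f i p * T p = S i p))"
  using assms(1,2)
proof induction
  case empty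
  show ?case using assms(3) unfolding nb_def by auto
next
  case (insert i I)
  then obtain T S where T: "T \<in> \<P>" "T p0 \<noteq> 0" "\<forall>i\<in>I. S i \<in> \<P>"
    "\<forall>p\<in>A. T p \<noteq> 0 \<longrightarrow> p \<in> M \<and> (\<forall>i\<in>I. f i p * T p = S i p)" by auto
  obtain S' T' where S': "S' \<in> \<P>" "T' \<in> \<P>" "T' p0 \<noteq> 0" "\<forall>p\<in>A. T' p \<noteq> 0 \<longrightarrow> f i p = S' p / T' p"
    using insert.prems[of i] unfolding rat_def by blast
  define S2 where "S2 j = (if j = i then (\<lambda>p. S' p * T p) else (\<lambda>p. S j p * T' p))" for j
  show ?case
  proof (intro bexI[of _ "\<lambda>p. T p * T' p"] exI[of _ S2] conjI ballI impI)
    show "(\<lambda>p. T p * T' p) \<in> \<P>" using T S' by (intro mult)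
    show "T p0 * T' p0 \<noteq> 0" using T S' by simp
    show "S2 j \<in> \<P>" if "j \<in> insert i I" for j using that T S' by (auto simp: S2_def intro: mult)
    fix p assume p: "p \<in> A" "T p * T' p \<noteq> 0"
    then show "p \<in> M" using T by auto
    fix j assume "j \<in> insert i I"
    then show "f j p * (T p * T' p) = S2 j p"
      using p T(4) S'(4) insert.hyps by (auto simp: S2_def mult_ac)
  qed
qed

end

section \<open>Affine charts\<close>

lemma zariski_openE:
  assumes "zariski_open n Z W"
  obtains S where "S \<subseteq> polynomial_functions n" "W = Z - {x \<in> Z. \<forall>P\<in>S. P x = 0}"
  using assms unfolding zariski_open_def by blast

lemma points_open_subspace: "open_in_space X U \<Longrightarrow> points (open_subspace X U) = U"
  by (simp add: open_subspace_def openin_subset inf.absorb2)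

lemma open_in_open_subspace:
  "open_in_space X U \<Longrightarrow> open_in_space (open_subspace X U) W \<longleftrightarrow> open_in_space X W \<and> W \<subseteq> U"
  by (simp add: open_subspace_def openin_open_subtopology)

lemma sections_open_subspace: "sections (open_subspace X U) = sections X"
  by (simp add: open_subspace_def)

locale affine_chart =
  fixes X :: "('a, 'k::field) fun_space" and U :: "'a set" and N :: nat
    and Z :: "(nat \<Rightarrow> 'k) set" and \<theta> :: "'a \<Rightarrow> nat \<Rightarrow> 'k"
  assumes space_fun: "space_with_functions X" and U_open: "open_in_space X U"
    and Z_algebraic: "algebraic_set N Z"
    and iso: "isomorphism (open_subspace X U) (algebraic_set_space N Z) \<theta>"
begin

lemma bij: "bij_betw \<theta> U Z"
  using iso by (simp add: isomorphism_def points_open_subspace[OF U_open] points_algebraic_set_space)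

lemma in_Z: "x \<in> U \<Longrightarrow> \<theta> x \<in> Z" using bij by (auto simp: bij_betw_def)

lemma inj: "x \<in> U \<Longrightarrow> y \<in> U \<Longrightarrow> \<theta> x = \<theta> y \<Longrightarrow> x = y" using bij by (auto simp: bij_betw_def inj_on_def)

lemma Z_affine: "Z \<subseteq> affine_points N" using Z_algebraic by (auto simp: algebraic_set_def)

lemma U_points: "U \<subseteq> points X" using U_open openin_subset by blast

lemma nonvanishing_open:
  assumes "P \<in> polynomial_functions N"
  shows "open_in_space X {x \<in> U. P (\<theta> x) \<noteq> 0}"
proof -
  have "zariski_open N Z {y \<in> Z. P y \<noteq> 0}"
    unfolding zariski_open_def using assms by (intro exI[of _ "{P}"]) auto
  moreover have "continuous_map (space_top (open_subspace X U)) (space_top (algebraic_set_space N Z)) \<theta>"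
    using iso by (simp add: isomorphism_def morphism_def)
  ultimately have "open_in_space (open_subspace X U) {x \<in> points (open_subspace X U). \<theta> x \<in> {y \<in> Z. P y \<noteq> 0}}"
    unfolding continuous_map open_in_algebraic_set_space[symmetric] by blast
  moreover have "{x \<in> U. \<theta> x \<in> {y \<in> Z. P y \<noteq> 0}} = {x \<in> U. P (\<theta> x) \<noteq> 0}" using in_Z by auto
  ultimately show ?thesis
    by (simp add: points_open_subspace[OF U_open] open_in_open_subspace[OF U_open])
qed

abbreviation "\<theta>' \<equiv> inv_into U \<theta>"

lemma inverse: "y \<in> Z \<Longrightarrow> \<theta>' y \<in> U" "x \<in> U \<Longrightarrow> \<theta>' (\<theta> x) = x" "y \<in> Z \<Longrightarrow> \<theta> (\<theta>' y) = y"
  using bij by (auto simp: bij_betw_def inv_into_into inv_into_f_f f_inv_into_f)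

lemma inverse_morphism: "morphism (algebraic_set_space N Z) (open_subspace X U) \<theta>'"
  using iso by (simp add: isomorphism_def points_open_subspace[OF U_open])

lemma principal_base:
  assumes "open_in_space X W" "x \<in> W" "x \<in> U"
  shows "\<exists>P\<in>polynomial_functions N. P (\<theta> x) \<noteq> 0 \<and> (\<forall>y\<in>U. P (\<theta> y) \<noteq> 0 \<longrightarrow> y \<in> W)"
proof -
  have "open_in_space (open_subspace X U) (W \<inter> U)"
    using assms(1) U_open by (auto simp: open_in_open_subspace[OF U_open])
  moreover have "zariski_open N Z {y \<in> Z. \<theta>' y \<in> V}" if "open_in_space (open_subspace X U) V" for V
    using inverse_morphism that
    by (simp add: morphism_def continuous_map open_in_algebraic_set_space points_algebraic_set_space)
  ultimately have "zariski_open N Z {y \<in> Z. \<theta>' y \<in> W \<inter> U}" by blast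
  from zariski_openE[OF this] obtain S where S: "S \<subseteq> polynomial_functions N"
    "{y \<in> Z. \<theta>' y \<in> W \<inter> U} = Z - {y \<in> Z. \<forall>P\<in>S. P y = 0}" .
  have "\<theta> x \<in> {y \<in> Z. \<theta>' y \<in> W \<inter> U}" using assms in_Z inverse(2) by auto
  then have "\<theta> x \<in> Z - {y \<in> Z. \<forall>P\<in>S. P y = 0}" by (simp only: S(2))
  then obtain P where P: "P \<in> S" "P (\<theta> x) \<noteq> 0" by blast
  have "y \<in> W" if "y \<in> U" "P (\<theta> y) \<noteq> 0" for y
  proof -
    have "\<theta> y \<in> Z - {y \<in> Z. \<forall>P\<in>S. P y = 0}" using that P in_Z by auto
    then have "\<theta> y \<in> {y \<in> Z. \<theta>' y \<in> W \<inter> U}" by (simp only: S(2))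
    then show ?thesis using inverse(2)[OF that(1)] by auto
  qed
  then show ?thesis using P S(1) by blast
qed

lemma section_fraction:
  assumes "open_in_space X W" "\<phi> \<in> sections X W" "x \<in> W" "x \<in> U"
  shows "\<exists>P\<in>polynomial_functions N. \<exists>Q\<in>polynomial_functions N. Q (\<theta> x) \<noteq> 0 \<and>
    (\<forall>y\<in>U. Q (\<theta> y) \<noteq> 0 \<longrightarrow> y \<in> W \<and> \<phi> y = P (\<theta> y) / Q (\<theta> y))"
proof -
  have WU: "open_in_space X (W \<inter> U)" using assms(1) U_open by blast
  have "\<phi> \<in> sections X (W \<inter> U)"
  proof -
    have "\<forall>U W f. open_in_space X U \<longrightarrow> open_in_space X W \<longrightarrow> W \<subseteq> U \<longrightarrow> f \<in> sections X U \<longrightarrow> f \<in> sections X W"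
      using space_fun unfolding space_with_functions_def by blast
    then show ?thesis using assms(1,2) WU by blast
  qed
  moreover have "open_in_space (open_subspace X U) (W \<inter> U)"
    using WU by (auto simp: open_in_open_subspace[OF U_open])
  moreover have "\<psi> \<circ> \<theta>' \<in> sections (algebraic_set_space N Z) {y \<in> Z. \<theta>' y \<in> V}"
    if "open_in_space (open_subspace X U) V" "\<psi> \<in> sections X V" for \<psi> V
    using inverse_morphism that
    by (simp add: morphism_def sections_open_subspace points_algebraic_set_space)
  ultimately have "\<phi> \<circ> \<theta>' \<in> sections (algebraic_set_space N Z) {y \<in> Z. \<theta>' y \<in> W \<inter> U}" by blast
  moreover have "\<theta> x \<in> {y \<in> Z. \<theta>' y \<in> W \<inter> U}" using assms in_Z inverse(2) by auto
  ultimately obtain W' P Q where W': "zariski_open N Z W'" "\<theta> x \<in> W'" "W' \<subseteq> {y \<in> Z. \<theta>' y \<in> W \<inter> U}"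
    and PQ: "P \<in> polynomial_functions N" "Q \<in> polynomial_functions N"
    "\<forall>y\<in>W'. Q y \<noteq> 0 \<and> (\<phi> \<circ> \<theta>') y = P y / Q y"
    unfolding algebraic_set_space_def by (simp (no_asm_use)) blast
  from zariski_openE[OF W'(1)] obtain S where S: "S \<subseteq> polynomial_functions N" "W' = Z - {y \<in> Z. \<forall>P\<in>S. P y = 0}" .
  then obtain R where R: "R \<in> S" "R (\<theta> x) \<noteq> 0" using W'(2) by blast
  have RP: "R \<in> polynomial_functions N" using R S by blast
  show ?thesis
  \<comment> \<open>The fraction is valid on \<open>W'\<close> only. Expanding it by
    \<open>R\<close>, which vanishes on the rest of \<open>Z\<close>, turns nonvanishing of the
    denominator into membership in \<open>W'\<close>.\<close>
  proof (rule bexI[of _ "\<lambda>y. P y * R y"], rule bexI[of _ "\<lambda>y. Q y * R y"], intro conjI ballI impI)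
    show "Q (\<theta> x) * R (\<theta> x) \<noteq> 0" using PQ(3) W'(2) R by simp
    fix y assume y: "y \<in> U" "Q (\<theta> y) * R (\<theta> y) \<noteq> 0"
    then have "\<theta> y \<in> W'" using R in_Z by (auto simp: S(2))
    then show "y \<in> W" "\<phi> y = P (\<theta> y) * R (\<theta> y) / (Q (\<theta> y) * R (\<theta> y))"
      using W'(3) PQ(3) inverse(2)[OF y(1)] y(2) by auto
  qed (use PQ RP in \<open>auto intro: polynomial_functions.mult\<close>)
qed

lemma coordinate_section:
  assumes "i < N"
  shows "(\<lambda>x. \<theta> x i) \<in> sections X U"
proof -
  have "zariski_open N Z Z"
    unfolding zariski_open_def
    by (rule exI[of _ "{\<lambda>_. 1}"]) (auto intro: polynomial_functions.const)
  moreover have "(\<lambda>y. y i) \<in> sections (algebraic_set_space N Z) Z"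
    unfolding algebraic_set_space_def select_convs
  proof (intro CollectI ballI)
    fix x assume "x \<in> Z"
    then show "\<exists>W P Q. zariski_open N Z W \<and> x \<in> W \<and> W \<subseteq> Z \<and> P \<in> polynomial_functions N \<and>
      Q \<in> polynomial_functions N \<and> (\<forall>y\<in>W. Q y \<noteq> 0 \<and> y i = P y / Q y)"
      using \<open>zariski_open N Z Z\<close> polynomial_functions.coord[OF assms] polynomial_functions.const[of 1 N]
      by (intro exI[of _ Z] exI[of _ "\<lambda>y. y i"] exI[of _ "\<lambda>_. 1"]) auto
  qed
  ultimately have "(\<lambda>y. y i) \<circ> \<theta> \<in> sections (open_subspace X U) {x \<in> points (open_subspace X U). \<theta> x \<in> Z}"
    using iso unfolding isomorphism_def morphism_def open_in_algebraic_set_space by blast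
  moreover have "{x \<in> U. \<theta> x \<in> Z} = U" using in_Z by auto
  ultimately show ?thesis
    by (simp add: points_open_subspace[OF U_open] sections_open_subspace o_def)
qed

lemma irreducible_open_subset:
  assumes "U \<noteq> {}"
  shows "\<exists>W. open_in_space X W \<and> W \<noteq> {} \<and>
    (\<forall>A B. open_in_space X A \<longrightarrow> open_in_space X B \<longrightarrow> A \<subseteq> W \<longrightarrow> B \<subseteq> W \<longrightarrow> A \<noteq> {} \<longrightarrow> B \<noteq> {} \<longrightarrow> A \<inter> B \<noteq> {})"
proof -
  have "Z \<noteq> {}" using assms in_Z by blast
  from exists_prime_annihilator[OF this, of N]
  obtain f where f: "f \<in> polynomial_functions N" "\<exists>x\<in>Z. f x \<noteq> 0"
    "\<forall>P\<in>polynomial_functions N. \<forall>Q\<in>polynomial_functions N.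
       (\<exists>x\<in>Z. P x * f x \<noteq> 0) \<longrightarrow> (\<exists>x\<in>Z. Q x * f x \<noteq> 0) \<longrightarrow> (\<exists>x\<in>Z. P x * Q x * f x \<noteq> 0)" by blast
  \<comment> \<open>By the choice of \<open>f\<close>, functions that are not identically zero on
    this locus have a product that is not identically zero there. Principal open sets form a base,
    so nonempty open subsets meet.\<close>
  let ?W = "{x \<in> U. f (\<theta> x) \<noteq> 0}"
  have "?W \<noteq> {}" using f(2) inverse(1,3) by force
  moreover have "A \<inter> B \<noteq> {}" if AB: "open_in_space X A" "open_in_space X B" "A \<subseteq> ?W" "B \<subseteq> ?W" "A \<noteq> {}" "B \<noteq> {}" for A B
  proof -
    obtain a b where ab: "a \<in> A" "b \<in> B" using AB by blast
    have aU: "a \<in> U" "b \<in> U" "f (\<theta> a) \<noteq> 0" "f (\<theta> b) \<noteq> 0" using ab AB by auto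
    obtain P where P: "P \<in> polynomial_functions N" "P (\<theta> a) \<noteq> 0" "\<forall>y\<in>U. P (\<theta> y) \<noteq> 0 \<longrightarrow> y \<in> A"
      using principal_base[OF AB(1) ab(1) aU(1)] by blast
    obtain Q where Q: "Q \<in> polynomial_functions N" "Q (\<theta> b) \<noteq> 0" "\<forall>y\<in>U. Q (\<theta> y) \<noteq> 0 \<longrightarrow> y \<in> B"
      using principal_base[OF AB(2) ab(2) aU(2)] by blast
    have "\<exists>x\<in>Z. P x * f x \<noteq> 0" "\<exists>x\<in>Z. Q x * f x \<noteq> 0" using P(2) Q(2) aU in_Z by (metis no_zero_divisors)+
    then obtain x where x: "x \<in> Z" "P x * Q x * f x \<noteq> 0" using f(3) P(1) Q(1) by blast
    then have "\<theta>' x \<in> A \<inter> B" using P(3) Q(3) inverse(1,3)[of x] by auto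
    then show ?thesis by blast
  qed
  ultimately show ?thesis using nonvanishing_open[OF f(1)] by blast
qed

lemma local_algebra: "x \<in> U \<Longrightarrow> local_algebra {\<lambda>y. P (\<theta> y) | P. P \<in> polynomial_functions N} U x"
proof unfold_locales
  fix S T assume "S \<in> {\<lambda>y. P (\<theta> y) | P. P \<in> polynomial_functions N}" "T \<in> {\<lambda>y. P (\<theta> y) | P. P \<in> polynomial_functions N}"
  then obtain P Q where PQ: "P \<in> polynomial_functions N" "Q \<in> polynomial_functions N"
    "S = (\<lambda>y. P (\<theta> y))" "T = (\<lambda>y. Q (\<theta> y))" by blast
  show "(\<lambda>y. S y + T y) \<in> {\<lambda>y. P (\<theta> y) | P. P \<in> polynomial_functions N}"
    by (rule CollectI, rule exI[of _ "\<lambda>x. P x + Q x"])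
      (simp add: PQ(3,4) polynomial_functions.add[OF PQ(1,2)])
  show "(\<lambda>y. S y * T y) \<in> {\<lambda>y. P (\<theta> y) | P. P \<in> polynomial_functions N}"
    by (rule CollectI, rule exI[of _ "\<lambda>x. P x * Q x"])
      (simp add: PQ(3,4) polynomial_functions.mult[OF PQ(1,2)])
next
  show "(\<lambda>_. c) \<in> {\<lambda>y. P (\<theta> y) | P. P \<in> polynomial_functions N}" for c
    by (rule CollectI, rule exI[of _ "\<lambda>_. c"]) (simp add: polynomial_functions.const)
qed auto

end

lemma prevariety_chart:
  assumes "prevariety X" "x \<in> points X"
  obtains U N Z \<theta> where "affine_chart X U N Z \<theta>" "x \<in> U"
proof -
  obtain \<U> where U: "\<Union>\<U> = points X" "\<forall>U\<in>\<U>. open_in_space X U \<and> affine_variety (open_subspace X U)"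
    using assms(1) unfolding prevariety_def by blast
  then obtain U where "U \<in> \<U>" "x \<in> U" using assms(2) by blast
  moreover from this obtain N Z \<theta> where "algebraic_set N Z" "isomorphism (open_subspace X U) (algebraic_set_space N Z) \<theta>"
    using U(2) unfolding affine_variety_def by blast
  ultimately show ?thesis
    using that[of U N Z \<theta>] U(2) assms(1) by (auto simp: affine_chart_def prevariety_def)
qed

lemma section_nonvanishing_open:
  assumes X: "prevariety X" and W: "open_in_space X W" and \<phi>: "\<phi> \<in> sections X W"
  shows "open_in_space X {x \<in> W. \<phi> x \<noteq> 0}"
proof (subst openin_subopen, intro ballI)
  fix x assume x: "x \<in> {x \<in> W. \<phi> x \<noteq> 0}"
  then have "x \<in> points X" using W openin_subset by blast
  from prevariety_chart[OF X this] obtain U N Z \<theta> where c: "affine_chart X U N Z \<theta>" "x \<in> U" .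
  interpret affine_chart X U N Z \<theta> by fact
  obtain P Q where PQ: "P \<in> polynomial_functions N" "Q \<in> polynomial_functions N" "Q (\<theta> x) \<noteq> 0"
    "\<forall>y\<in>U. Q (\<theta> y) \<noteq> 0 \<longrightarrow> y \<in> W \<and> \<phi> y = P (\<theta> y) / Q (\<theta> y)"
    using section_fraction[OF W \<phi> _ c(2)] x by blast
  let ?T = "{y \<in> U. P (\<theta> y) * Q (\<theta> y) \<noteq> 0}"
  have "open_in_space X ?T"
    by (rule nonvanishing_open[OF polynomial_functions.mult[OF PQ(1,2)]])
  moreover have "x \<in> ?T" "?T \<subseteq> {x \<in> W. \<phi> x \<noteq> 0}" using PQ x c(2) by auto
  ultimately show "\<exists>T. open_in_space X T \<and> x \<in> T \<and> T \<subseteq> {x \<in> W. \<phi> x \<noteq> 0}" by blast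
qed

section \<open>Connected algebraic groups are irreducible\<close>

lemma section_closure:
  assumes "space_with_functions X" "open_in_space X U"
  shows section_const: "(\<lambda>_. c) \<in> sections X U"
    and section_add: "f \<in> sections X U \<Longrightarrow> g \<in> sections X U \<Longrightarrow> (\<lambda>x. f x + g x) \<in> sections X U"
    and section_mult: "f \<in> sections X U \<Longrightarrow> g \<in> sections X U \<Longrightarrow> (\<lambda>x. f x * g x) \<in> sections X U"
proof -
  note sf = assms(1)[unfolded space_with_functions_def]
  show "(\<lambda>_. c) \<in> sections X U" using sf[THEN conjunct2, THEN conjunct1] assms(2) by simp
  show "(\<lambda>x. f x + g x) \<in> sections X U" if "f \<in> sections X U" "g \<in> sections X U"
    using sf[THEN conjunct2, THEN conjunct2, THEN conjunct1] assms(2) that by simp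
  show "(\<lambda>x. f x * g x) \<in> sections X U" if "f \<in> sections X U" "g \<in> sections X U"
    using sf[THEN conjunct2, THEN conjunct2, THEN conjunct1] assms(2) that by simp
qed

lemma section_sum:
  assumes "space_with_functions X" "open_in_space X U" "\<And>i. i \<in> I \<Longrightarrow> f i \<in> sections X U"
  shows "(\<lambda>x. \<Sum>i\<in>I. f i x) \<in> sections X U"
  using assms(3)
proof (induction I rule: infinite_finite_induct)
  case (insert i I)
  then have "(\<lambda>x. f i x + (\<Sum>i\<in>I. f i x)) \<in> sections X U"
    by (intro section_add[OF assms(1,2)]) auto
  with insert.hyps show ?case by simp
qed (simp_all add: section_const[OF assms(1,2)])

lemma tensor_one: "space_with_functions X \<Longrightarrow> space_with_functions Y \<Longrightarrow> open_in_space X U \<Longrightarrow>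
    open_in_space Y W \<Longrightarrow> (\<lambda>_. 1) \<in> tensor_functions X Y U W"
  unfolding tensor_functions_def
  by (rule CollectI, rule exI[of _ 1], rule exI[of _ "\<lambda>_ _. 1"], rule exI[of _ "\<lambda>_ _. 1"])
    (auto simp: section_const)

lemma product_generator_full:
  fixes X :: "('a, 'k::field) fun_space" and Y :: "('b, 'k) fun_space"
  assumes "space_with_functions X" "space_with_functions Y"
  shows "points X \<times> points Y \<in> {{p \<in> U \<times> W. t p \<noteq> 0} | U W t.
      open_in_space X U \<and> open_in_space Y W \<and> t \<in> tensor_functions X Y U W}"
  by (rule CollectI, rule exI[of _ "points X"], rule exI[of _ "points Y"], rule exI[of _ "\<lambda>_. 1"])
    (simp add: tensor_one[OF assms openin_topspace openin_topspace])

text \<open>The topology of the product is in general finer than the product topology, so continuity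
  is checked on the generators: freezing the second variable turns a tensor into a section in the
  first.\<close>

lemma slice_continuous:
  assumes X: "prevariety X" and k: "k \<in> points X"
  shows "continuous_map (space_top X) (product_top X X) (\<lambda>g. (g, k))"
  unfolding product_top_def
proof (rule continuous_on_generated_topo)
  have sX: "space_with_functions X" using X by (simp add: prevariety_def)
  fix D assume "D \<in> {{p \<in> U \<times> W. t p \<noteq> 0} | U W t.
      open_in_space X U \<and> open_in_space X W \<and> t \<in> tensor_functions X X U W}"
  then obtain U W t where D: "D = {p \<in> U \<times> W. t p \<noteq> 0}" "open_in_space X U" "open_in_space X W"
    "t \<in> tensor_functions X X U W" by blast
  obtain m a b where t: "t = (\<lambda>(x, y). \<Sum>i<(m::nat). a i x * b i y)" "\<forall>i<m. a i \<in> sections X U"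
    using D(4) unfolding tensor_functions_def by blast
  have UX: "U \<subseteq> points X" using D(2) openin_subset by blast
  have "(\<lambda>g. \<Sum>i<m. a i g * b i k) \<in> sections X U"
    using t(2) by (intro section_sum section_mult section_const sX D(2)) auto
  from section_nonvanishing_open[OF X D(2) this]
  have "open_in_space X {g \<in> U. (\<Sum>i<m. a i g * b i k) \<noteq> 0}" .
  moreover have "(\<lambda>g. (g, k)) -` D \<inter> points X =
      (if k \<in> W then {g \<in> U. (\<Sum>i<m. a i g * b i k) \<noteq> 0} else {})"
    using UX by (auto simp: D(1) t(1))
  ultimately show "open_in_space X ((\<lambda>g. (g, k)) -` D \<inter> points X)" by simp
next
  have sX: "space_with_functions X" using X by (simp add: prevariety_def)
  have "(\<lambda>g. (g, k)) ` points X \<subseteq> points X \<times> points X" using k by auto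
  also have "\<dots> \<subseteq> \<Union> {{p \<in> U \<times> W. t p \<noteq> 0} | U W t.
      open_in_space X U \<and> open_in_space X W \<and> t \<in> tensor_functions X X U W}"
    by (rule Union_upper[OF product_generator_full[OF sX sX]])
  finally show "(\<lambda>g. (g, k)) ` points X \<subseteq> \<Union> {{p \<in> U \<times> W. t p \<noteq> 0} | U W t.
      open_in_space X U \<and> open_in_space X W \<and> t \<in> tensor_functions X X U W}" .
qed

lemma points_product_space:
  assumes "space_with_functions X" "space_with_functions Y"
  shows "points (product_space X Y) = points X \<times> points Y"
proof -
  have "points X \<times> points Y \<subseteq> points (product_space X Y)"
    unfolding product_space_def product_top_def select_convs topology_generated_by_topspace
    by (rule Union_upper[OF product_generator_full[OF assms]])
  moreover have "points (product_space X Y) \<subseteq> points X \<times> points Y"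
    unfolding product_space_def product_top_def
    by (auto simp: topology_generated_by_topspace dest: openin_subset)
  ultimately show ?thesis by blast
qed

definition irreducible_open :: "('a, 'k) fun_space \<Rightarrow> 'a set \<Rightarrow> bool" where
  "irreducible_open X W \<longleftrightarrow> open_in_space X W \<and> (\<forall>A B. open_in_space X A \<longrightarrow> open_in_space X B \<longrightarrow>
     A \<subseteq> W \<longrightarrow> B \<subseteq> W \<longrightarrow> A \<noteq> {} \<longrightarrow> B \<noteq> {} \<longrightarrow> A \<inter> B \<noteq> {})"

lemma irreducible_openD:
  "irreducible_open X W \<Longrightarrow> open_in_space X A \<Longrightarrow> open_in_space X B \<Longrightarrow>
     A \<subseteq> W \<Longrightarrow> B \<subseteq> W \<Longrightarrow> A \<noteq> {} \<Longrightarrow> B \<noteq> {} \<Longrightarrow> A \<inter> B \<noteq> {}"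
  unfolding irreducible_open_def by blast

lemma irreducible_open_Un:
  assumes W: "irreducible_open X W" "irreducible_open X W'" and ne: "W \<inter> W' \<noteq> {}"
  shows "irreducible_open X (W \<union> W')"
proof -
  have o: "open_in_space X W" "open_in_space X W'" using W by (auto simp: irreducible_open_def)
  have meet: "A \<inter> (W \<inter> W') \<noteq> {}" if A: "open_in_space X A" "A \<subseteq> W \<union> W'" "A \<noteq> {}" for A
  proof (cases "A \<inter> W = {}")
    case False
    then have "(A \<inter> W) \<inter> (W \<inter> W') \<noteq> {}"
      using A(1) o ne irreducible_openD[OF W(1), of "A \<inter> W" "W \<inter> W'"] by auto
    then show ?thesis by blast
  next
    case True
    then have "A \<inter> W' \<noteq> {}" using A by blast
    then have "(A \<inter> W') \<inter> (W \<inter> W') \<noteq> {}"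
      using A(1) o ne irreducible_openD[OF W(2), of "A \<inter> W'" "W \<inter> W'"] by auto
    then show ?thesis by blast
  qed
  show ?thesis unfolding irreducible_open_def
  proof (intro conjI allI impI)
    show "open_in_space X (W \<union> W')" using o by blast
    fix A B assume AB: "open_in_space X A" "open_in_space X B" "A \<subseteq> W \<union> W'" "B \<subseteq> W \<union> W'" "A \<noteq> {}" "B \<noteq> {}"
    have "(A \<inter> (W \<inter> W')) \<inter> (B \<inter> (W \<inter> W')) \<noteq> {}"
      by (rule irreducible_openD[OF W(1)]) (use AB o meet in auto)
    then show "A \<inter> B \<noteq> {}" by blast
  qed
qed

text \<open>Lying in a common irreducible open set is an equivalence relation, because two such sets
  that meet have an irreducible union. Its classes are open, so connectedness leaves a single
  one.\<close>

lemma connected_locally_irreducible: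
  assumes conn: "connected_space (space_top X)"
    and loc: "\<And>x. x \<in> points X \<Longrightarrow> \<exists>W. irreducible_open X W \<and> x \<in> W"
    and AB: "open_in_space X A" "open_in_space X B" "A \<noteq> {}" "B \<noteq> {}"
  shows "A \<inter> B \<noteq> {}"
proof -
  define r where "r x y \<longleftrightarrow> (\<exists>W. irreducible_open X W \<and> x \<in> W \<and> y \<in> W)" for x y
  have trans: "r x z" if "r x y" "r y z" for x y z
    using that irreducible_open_Un unfolding r_def by (metis UnCI disjoint_iff)
  have sym: "r x y \<Longrightarrow> r y x" for x y unfolding r_def by blast
  obtain a b where ab: "a \<in> A" "b \<in> B" using AB by blast
  have abX: "a \<in> points X" "b \<in> points X" using ab AB openin_subset by blast+
  define E where "E = {y. r a y}"
  have "open_in_space X W" if "irreducible_open X W" for W using that by (simp add: irreducible_open_def)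
  have EX: "E \<subseteq> points X" unfolding E_def r_def irreducible_open_def using openin_subset by blast
  have "open_in_space X E"
  proof (subst openin_subopen, intro ballI)
    fix y assume "y \<in> E"
    then obtain W where W: "irreducible_open X W" "a \<in> W" "y \<in> W" by (auto simp: E_def r_def)
    then have "W \<subseteq> E" by (auto simp: E_def r_def)
    then show "\<exists>T. open_in_space X T \<and> y \<in> T \<and> T \<subseteq> E" using W by (auto simp: irreducible_open_def)
  qed
  moreover have "open_in_space X (points X - E)"
  proof (subst openin_subopen, intro ballI)
    fix y assume y: "y \<in> points X - E"
    then obtain W where W: "irreducible_open X W" "y \<in> W" using loc by blast
    have "W \<subseteq> points X" using W(1) openin_subset unfolding irreducible_open_def by blast
    moreover have "w \<notin> E" if "w \<in> W" for w
    proof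
      assume "w \<in> E"
      moreover have "r w y" using W that unfolding r_def by blast
      ultimately show False using trans y unfolding E_def by blast
    qed
    ultimately show "\<exists>T. open_in_space X T \<and> y \<in> T \<and> T \<subseteq> points X - E"
      using W by (auto simp: irreducible_open_def)
  qed
  moreover have "a \<in> E" using loc[OF abX(1)] by (auto simp: E_def r_def)
  ultimately have "points X - E = {}"
    using conn unfolding connected_space_def by (metis Diff_disjoint Diff_partition EX Un_upper1 empty_iff subset_refl)
  then have "r a b" using abX by (auto simp: E_def)
  then obtain W where W: "irreducible_open X W" "a \<in> W" "b \<in> W" by (auto simp: r_def)
  have "(A \<inter> W) \<inter> (B \<inter> W) \<noteq> {}"
    by (rule irreducible_openD[OF W(1)]) (use AB ab W in \<open>auto simp: irreducible_open_def\<close>)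
  then show ?thesis by blast
qed

locale connected_algebraic_group = comm_group G for G :: "'g monoid" (structure) +
  fixes X :: "('g, 'k::alg_closed_field) fun_space"
  assumes algebraic: "algebraic_group X G" and connected: "connected_space (space_top X)"
begin

lemma carrier_points: "points X = carrier G" and prevariety_X: "prevariety X"
  and space_X: "space_with_functions X"
  using algebraic by (auto simp: algebraic_group_def variety_def prevariety_def)

lemma mult_morphism: "morphism (product_space X X) X (\<lambda>(x, y). x \<otimes> y)"
  and inv_morphism: "morphism X X (\<lambda>x. inv x)"
  using algebraic by (auto simp: algebraic_group_def)

lemma points_product: "points (product_space X X) = carrier G \<times> carrier G"
  by (simp add: points_product_space[OF space_X space_X] carrier_points)

lemma top_product: "space_top (product_space X X) = product_top X X"
  by (simp add: product_space_def)

lemma translation_continuous: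
  assumes "k \<in> carrier G"
  shows "continuous_map (space_top X) (space_top X) (\<lambda>g. g \<otimes> k)"
proof -
  have "continuous_map (product_top X X) (space_top X) (\<lambda>(x, y). x \<otimes> y)"
    using mult_morphism by (simp add: morphism_def top_product)
  from continuous_map_compose[OF slice_continuous[OF prevariety_X] this]
  show ?thesis using assms by (simp add: carrier_points o_def)
qed

lemma translation_open:
  assumes "k \<in> carrier G" "open_in_space X W"
  shows "open_in_space X {g \<in> carrier G. g \<otimes> k \<in> W}"
  using translation_continuous[OF assms(1)] assms(2) by (auto simp: continuous_map carrier_points)

text \<open>A chart contains a nonempty irreducible open set, and its translates cover the group.
  Homogeneity is essential: two crossing lines are connected but reducible.\<close>

theorem irreducible:
  assumes "open_in_space X A" "open_in_space X B" "A \<noteq> {}" "B \<noteq> {}"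
  shows "A \<inter> B \<noteq> {}"
proof (rule connected_locally_irreducible[OF connected _ assms])
  have "\<one> \<in> points X" by (simp add: carrier_points)
  from prevariety_chart[OF prevariety_X this]
  obtain U N Z \<theta> where U: "affine_chart X U N Z \<theta>" "\<one> \<in> U" .
  obtain W where W: "irreducible_open X W" "W \<noteq> {}"
    using affine_chart.irreducible_open_subset[OF U(1)] U(2) unfolding irreducible_open_def by blast
  obtain w where w: "w \<in> W" using W by blast
  have oW: "open_in_space X W" and WX: "W \<subseteq> carrier G"
    using W(1) openin_subset by (auto simp: irreducible_open_def carrier_points[symmetric])
  fix x assume "x \<in> points X"
  then have x: "x \<in> carrier G" by (simp add: carrier_points)
  define k where "k = inv x \<otimes> w"
  have k: "k \<in> carrier G" and wG: "w \<in> carrier G" using w WX x by (auto simp: k_def)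
  have xk: "x \<otimes> k = w" using x wG by (simp add: k_def m_assoc[symmetric])
  let ?V = "{g \<in> carrier G. g \<otimes> k \<in> W}"
  have "irreducible_open X ?V"
    unfolding irreducible_open_def
  proof (intro conjI allI impI)
    show "open_in_space X ?V" by (rule translation_open[OF k oW])
    have tr: "open_in_space X ((\<lambda>g. g \<otimes> k) ` A)" if A: "open_in_space X A" for A
    proof -
      have AG: "A \<subseteq> carrier G" using A openin_subset carrier_points by metis
      have "(\<lambda>g. g \<otimes> k) ` A = {g \<in> carrier G. g \<otimes> inv k \<in> A}"
      proof (intro equalityI subsetI)
        fix g assume "g \<in> (\<lambda>g. g \<otimes> k) ` A"
        then show "g \<in> {g \<in> carrier G. g \<otimes> inv k \<in> A}" using AG k by (auto simp: m_assoc subset_iff)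
      next
        fix g assume g: "g \<in> {g \<in> carrier G. g \<otimes> inv k \<in> A}"
        then have "g = (g \<otimes> inv k) \<otimes> k" using k by (simp add: m_assoc)
        then show "g \<in> (\<lambda>g. g \<otimes> k) ` A" using g by blast
      qed
      then show ?thesis using translation_open[OF inv_closed[OF k] A] by simp
    qed
    fix A B assume A: "open_in_space X A" "open_in_space X B" "A \<subseteq> ?V" "B \<subseteq> ?V" "A \<noteq> {}" "B \<noteq> {}"
    have "(\<lambda>g. g \<otimes> k) ` A \<inter> (\<lambda>g. g \<otimes> k) ` B \<noteq> {}"
      by (rule irreducible_openD[OF W(1) tr tr]) (use A in auto)
    then obtain a b where ab: "a \<in> A" "b \<in> B" "a \<otimes> k = b \<otimes> k" by blast
    moreover from ab(1,2) A(3,4) have "a \<in> carrier G" "b \<in> carrier G" by auto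
    ultimately have "a = b" using k by simp
    then show "A \<inter> B \<noteq> {}" using ab by blast
  qed
  moreover have "x \<in> ?V" using x xk w by simp
  ultimately show "\<exists>W. irreducible_open X W \<and> x \<in> W" by blast
qed

text \<open>For general position arguments: open conditions that are only known to be satisfiable
  one by one have to hold at the same point.\<close>

lemma irreducible_Inter:
  assumes "finite I" "\<And>i. i \<in> I \<Longrightarrow> open_in_space X (A i) \<and> A i \<noteq> {}"
    and "open_in_space X B" "B \<noteq> {}"
  shows "\<exists>x\<in>B. \<forall>i\<in>I. x \<in> A i"
proof -
  have "open_in_space X (B \<inter> (\<Inter>i\<in>I. A i)) \<and> B \<inter> (\<Inter>i\<in>I. A i) \<noteq> {}"
    using assms(1,2)
  proof induction
    case (insert i I)
    then have "open_in_space X (A i)" "A i \<noteq> {}" "open_in_space X (B \<inter> (\<Inter>i\<in>I. A i))"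
      "B \<inter> (\<Inter>i\<in>I. A i) \<noteq> {}" by auto
    from openin_Int[OF this(1,3)] irreducible[OF this(1,3,2,4)]
    show ?case by (simp add: Int_left_commute Int_assoc)
  qed (use assms in auto)
  then show ?thesis by blast
qed

end

section \<open>Rational maps of bounded degree on an affine chart\<close>

text \<open>Pairs of points are coded in \<open>2 * N\<close> coordinates, so that polynomials on
  one affine space also describe functions on the product of a chart with itself.\<close>

definition join :: "nat \<Rightarrow> (nat \<Rightarrow> 'k) \<Rightarrow> (nat \<Rightarrow> 'k) \<Rightarrow> nat \<Rightarrow> 'k" where
  "join N x y = (\<lambda>i. if i < N then x i else y (i - N))"

lemma polynomial_join_left:
  assumes "P \<in> polynomial_functions N"
  shows "\<exists>Q\<in>polynomial_functions (2 * N). \<forall>x y. Q (join N x y) = P x"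
  using assms
proof induction
  case (coord i)
  show ?case
    by (rule bexI[of _ "\<lambda>w. w i"]) (use coord in \<open>auto simp: join_def intro: polynomial_functions.coord\<close>)
next
  case (add P P')
  then obtain Q Q' where "Q \<in> polynomial_functions (2 * N)" "Q' \<in> polynomial_functions (2 * N)"
    "\<forall>x y. Q (join N x y) = P x" "\<forall>x y. Q' (join N x y) = P' x" by blast
  then show ?case by (intro bexI[of _ "\<lambda>w. Q w + Q' w"]) (auto intro: polynomial_functions.add)
next
  case (mult P P')
  then obtain Q Q' where "Q \<in> polynomial_functions (2 * N)" "Q' \<in> polynomial_functions (2 * N)"
    "\<forall>x y. Q (join N x y) = P x" "\<forall>x y. Q' (join N x y) = P' x" by blast
  then show ?case by (intro bexI[of _ "\<lambda>w. Q w * Q' w"]) (auto intro: polynomial_functions.mult)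
qed (auto intro: polynomial_functions.const)

lemma polynomial_join_right:
  assumes "P \<in> polynomial_functions N"
  shows "\<exists>Q\<in>polynomial_functions (2 * N). \<forall>x y. Q (join N x y) = P y"
  using assms
proof induction
  case (coord i)
  show ?case
    by (rule bexI[of _ "\<lambda>w. w (i + N)"]) (use coord in \<open>auto simp: join_def intro: polynomial_functions.coord\<close>)
next
  case (add P P')
  then obtain Q Q' where "Q \<in> polynomial_functions (2 * N)" "Q' \<in> polynomial_functions (2 * N)"
    "\<forall>x y. Q (join N x y) = P y" "\<forall>x y. Q' (join N x y) = P' y" by blast
  then show ?case by (intro bexI[of _ "\<lambda>w. Q w + Q' w"]) (auto intro: polynomial_functions.add)
next
  case (mult P P')
  then obtain Q Q' where "Q \<in> polynomial_functions (2 * N)" "Q' \<in> polynomial_functions (2 * N)"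
    "\<forall>x y. Q (join N x y) = P y" "\<forall>x y. Q' (join N x y) = P' y" by blast
  then show ?case by (intro bexI[of _ "\<lambda>w. Q w * Q' w"]) (auto intro: polynomial_functions.mult)
qed (auto intro: polynomial_functions.const)

locale group_chart = connected_algebraic_group G X + affine_chart X U N Z \<theta>
  for G :: "'g monoid" (structure) and X :: "('g, 'k::alg_closed_field) fun_space"
    and U N Z \<theta> +
  assumes U_nonempty: "U \<noteq> {}"
begin

lemma U_carrier: "g \<in> U \<Longrightarrow> g \<in> carrier G" using U_points carrier_points by blast

definition chart_funs :: "('g \<Rightarrow> 'k) set" where
  "chart_funs = {\<lambda>y. P (\<theta> y) | P. P \<in> polynomial_functions N}"

definition pair_funs :: "('g \<times> 'g \<Rightarrow> 'k) set" where
  "pair_funs = {\<lambda>p. P (join N (\<theta> (fst p)) (\<theta> (snd p))) | P. P \<in> polynomial_functions (2 * N)}"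

lemma chart_local_algebra: "u \<in> U \<Longrightarrow> local_algebra chart_funs U u"
  unfolding chart_funs_def by (rule local_algebra)

lemma pair_local_algebra:
  assumes "x0 \<in> U" "y0 \<in> U"
  shows "local_algebra pair_funs (U \<times> U) (x0, y0)"
proof
  show "(\<lambda>_. c) \<in> pair_funs" for c
    unfolding pair_funs_def
    by (rule CollectI, rule exI[of _ "\<lambda>_. c"]) (simp add: polynomial_functions.const)
  show "(x0, y0) \<in> U \<times> U" using assms by simp
next
  fix S T assume "S \<in> pair_funs" "T \<in> pair_funs"
  then obtain P Q where PQ: "P \<in> polynomial_functions (2 * N)" "Q \<in> polynomial_functions (2 * N)"
    "S = (\<lambda>p. P (join N (\<theta> (fst p)) (\<theta> (snd p))))" "T = (\<lambda>p. Q (join N (\<theta> (fst p)) (\<theta> (snd p))))"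
    unfolding pair_funs_def by blast
  show "(\<lambda>p. S p + T p) \<in> pair_funs" unfolding pair_funs_def
    by (rule CollectI, rule exI[of _ "\<lambda>x. P x + Q x"])
      (simp add: PQ(3,4) polynomial_functions.add[OF PQ(1,2)])
  show "(\<lambda>p. S p * T p) \<in> pair_funs" unfolding pair_funs_def
    by (rule CollectI, rule exI[of _ "\<lambda>x. P x * Q x"])
      (simp add: PQ(3,4) polynomial_functions.mult[OF PQ(1,2)])
qed

lemma chart_rat_section:
  assumes u: "u \<in> U" and W: "open_in_space X W" "u \<in> W" and \<phi>: "\<phi> \<in> sections X W"
  shows "local_algebra.rat chart_funs U u \<phi>"
proof -
  interpret L: local_algebra chart_funs U u by (rule chart_local_algebra[OF u])
  obtain P Q where PQ: "P \<in> polynomial_functions N" "Q \<in> polynomial_functions N" "Q (\<theta> u) \<noteq> 0"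
    "\<forall>y\<in>U. Q (\<theta> y) \<noteq> 0 \<longrightarrow> y \<in> W \<and> \<phi> y = P (\<theta> y) / Q (\<theta> y)"
    using section_fraction[OF W(1) \<phi> W(2) u] by blast
  show ?thesis
    by (rule L.ratI[of "\<lambda>y. P (\<theta> y)" "\<lambda>y. Q (\<theta> y)"]) (use PQ in \<open>auto simp: chart_funs_def\<close>)
qed

lemma chart_nb_open:
  assumes u: "u \<in> U" and W: "open_in_space X W" "u \<in> W"
  shows "local_algebra.nb chart_funs U u W"
proof -
  interpret L: local_algebra chart_funs U u by (rule chart_local_algebra[OF u])
  obtain P where P: "P \<in> polynomial_functions N" "P (\<theta> u) \<noteq> 0" "\<forall>y\<in>U. P (\<theta> y) \<noteq> 0 \<longrightarrow> y \<in> W"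
    using principal_base[OF W u] by blast
  show ?thesis by (rule L.nbI[of "\<lambda>y. P (\<theta> y)"]) (use P in \<open>auto simp: chart_funs_def\<close>)
qed

lemma nb_imp_open:
  assumes u: "u \<in> U" and "local_algebra.nb chart_funs U u M"
  obtains T where "T \<in> polynomial_functions N" "T (\<theta> u) \<noteq> 0" "\<forall>y\<in>U. T (\<theta> y) \<noteq> 0 \<longrightarrow> y \<in> M"
proof -
  interpret L: local_algebra chart_funs U u by (rule chart_local_algebra[OF u])
  obtain S where S: "S \<in> chart_funs" "S u \<noteq> 0" "\<forall>y\<in>U. S y \<noteq> 0 \<longrightarrow> y \<in> M"
    using assms(2) unfolding L.nb_def by blast
  then obtain T where "T \<in> polynomial_functions N" "S = (\<lambda>y. T (\<theta> y))" unfolding chart_funs_def by blast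
  with S show ?thesis by (intro that[of T]) simp_all
qed

lemma pair_funs_left: "P \<in> polynomial_functions N \<Longrightarrow> (\<lambda>p. P (\<theta> (fst p))) \<in> pair_funs"
proof -
  assume "P \<in> polynomial_functions N"
  from polynomial_join_left[OF this] obtain Q where "Q \<in> polynomial_functions (2 * N)"
    "\<forall>x y. Q (join N x y) = P x" by blast
  then show ?thesis unfolding pair_funs_def by (intro CollectI exI[of _ Q]) simp
qed

lemma pair_funs_right: "P \<in> polynomial_functions N \<Longrightarrow> (\<lambda>p. P (\<theta> (snd p))) \<in> pair_funs"
proof -
  assume "P \<in> polynomial_functions N"
  from polynomial_join_right[OF this] obtain Q where "Q \<in> polynomial_functions (2 * N)"
    "\<forall>x y. Q (join N x y) = P y" by blast
  then show ?thesis unfolding pair_funs_def by (intro CollectI exI[of _ Q]) simp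
qed

context
  fixes x0 y0 assumes xy: "x0 \<in> U" "y0 \<in> U"
begin

interpretation L: local_algebra pair_funs "U \<times> U" "(x0, y0)"
  by (rule pair_local_algebra[OF xy])

lemma pair_left:
  assumes W: "open_in_space X W" "x0 \<in> W" and \<phi>: "\<phi> \<in> sections X W"
  shows "L.rat (\<lambda>p. \<phi> (fst p))"
proof -
  obtain P Q where PQ: "P \<in> polynomial_functions N" "Q \<in> polynomial_functions N" "Q (\<theta> x0) \<noteq> 0"
    "\<forall>y\<in>U. Q (\<theta> y) \<noteq> 0 \<longrightarrow> y \<in> W \<and> \<phi> y = P (\<theta> y) / Q (\<theta> y)"
    using section_fraction[OF W(1) \<phi> W(2) xy(1)] by blast
  show ?thesis
    by (rule L.ratI[OF pair_funs_left[OF PQ(1)] pair_funs_left[OF PQ(2)]]) (use PQ in auto)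
qed

lemma pair_right:
  assumes W: "open_in_space X W" "y0 \<in> W" and \<phi>: "\<phi> \<in> sections X W"
  shows "L.rat (\<lambda>p. \<phi> (snd p))"
proof -
  obtain P Q where PQ: "P \<in> polynomial_functions N" "Q \<in> polynomial_functions N" "Q (\<theta> y0) \<noteq> 0"
    "\<forall>y\<in>U. Q (\<theta> y) \<noteq> 0 \<longrightarrow> y \<in> W \<and> \<phi> y = P (\<theta> y) / Q (\<theta> y)"
    using section_fraction[OF W(1) \<phi> W(2) xy(2)] by blast
  show ?thesis
    by (rule L.ratI[OF pair_funs_right[OF PQ(1)] pair_funs_right[OF PQ(2)]]) (use PQ in auto)
qed

lemma pair_nb_Times:
  assumes "open_in_space X W" "x0 \<in> W" "open_in_space X W'" "y0 \<in> W'"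
  shows "L.nb (W \<times> W')"
proof -
  obtain P where P: "P \<in> polynomial_functions N" "P (\<theta> x0) \<noteq> 0" "\<forall>y\<in>U. P (\<theta> y) \<noteq> 0 \<longrightarrow> y \<in> W"
    using principal_base[OF assms(1,2) xy(1)] by blast
  obtain Q where Q: "Q \<in> polynomial_functions N" "Q (\<theta> y0) \<noteq> 0" "\<forall>y\<in>U. Q (\<theta> y) \<noteq> 0 \<longrightarrow> y \<in> W'"
    using principal_base[OF assms(3,4) xy(2)] by blast
  have "L.nb (W \<times> UNIV)"
    by (rule L.nbI[OF pair_funs_left[OF P(1)]]) (use P in auto)
  moreover have "L.nb (UNIV \<times> W')"
    by (rule L.nbI[OF pair_funs_right[OF Q(1)]]) (use Q in auto)
  ultimately have "L.nb ((W \<times> UNIV) \<inter> (UNIV \<times> W'))" by (rule L.nb_Int)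
  then show ?thesis by (rule L.nb_mono) auto
qed

lemma pair_tensor:
  assumes "open_in_space X W" "x0 \<in> W" "open_in_space X W'" "y0 \<in> W'" "t \<in> tensor_functions X X W W'"
  shows "L.rat t"
proof -
  obtain m a b where t: "t = (\<lambda>(x, y). \<Sum>i<(m::nat). a i x * b i y)" "\<forall>i<m. a i \<in> sections X W"
    "\<forall>i<m. b i \<in> sections X W'"
    using assms(5) unfolding tensor_functions_def by blast
  have "L.rat (\<lambda>p. \<Sum>i<m. a i (fst p) * b i (snd p))"
    using t(2,3) by (intro L.rat_sum L.rat_mult pair_left[OF assms(1,2)] pair_right[OF assms(3,4)]) auto
  then show ?thesis by (simp add: t(1) split_def)
qed

text \<open>Induction over the generation of the topology. Tensors are fractions near the point, so
  within \<open>U \<times> U\<close> each generator around it contains the nonvanishing locus of a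
  polynomial in \<open>2 * N\<close> coordinates.\<close>

lemma pair_nb_open:
  assumes "openin (product_top X X) D" "(x0, y0) \<in> D"
  shows "L.nb D"
proof -
  have "generate_topology_on {{p \<in> U \<times> W. t p \<noteq> 0} | U W t.
     open_in_space X U \<and> open_in_space X W \<and> t \<in> tensor_functions X X U W} D"
    using assms(1) unfolding product_top_def by (simp add: openin_topology_generated_by)
  then show ?thesis using assms(2)
  proof induction
    case (Int a b) then show ?case by (intro L.nb_Int) auto
  next
    case (UN K)
    then obtain k where "k \<in> K" "(x0, y0) \<in> k" by blast
    with UN have "L.nb k" by blast
    then show ?case by (rule L.nb_mono) (use \<open>k \<in> K\<close> in blast)
  next
    case (Basis s)
    then obtain W W' t where s: "s = {p \<in> W \<times> W'. t p \<noteq> 0}" "open_in_space X W" "open_in_space X W'"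
      "t \<in> tensor_functions X X W W'" by blast
    have p: "x0 \<in> W" "y0 \<in> W'" "t (x0, y0) \<noteq> 0" using Basis(2) s(1) by auto
    have "L.nb ((W \<times> W') \<inter> {p. t p \<noteq> 0})"
      by (intro L.nb_Int pair_nb_Times L.rat_nonzero pair_tensor[OF s(2) p(1) s(3) p(2) s(4)] s p)
    then show ?case by (rule L.nb_mono) (auto simp: s(1))
  qed simp
qed

lemma pair_section:
  assumes "f \<in> sections (product_space X X) D" "(x0, y0) \<in> D"
  shows "L.rat f"
proof -
  have "\<forall>p\<in>D. \<exists>W W' s t N'. open_in_space X W \<and> open_in_space X W' \<and>
      s \<in> tensor_functions X X W W' \<and> t \<in> tensor_functions X X W W' \<and>
      openin (product_top X X) N' \<and> p \<in> N' \<and> N' \<subseteq> D \<inter> (W \<times> W') \<and>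
      (\<forall>q\<in>N'. t q \<noteq> 0 \<and> f q = s q / t q)"
    using assms(1) unfolding product_space_def select_convs mem_Collect_eq .
  from bspec[OF this assms(2)] obtain W W' s t N' where *: "open_in_space X W" "open_in_space X W'"
    "s \<in> tensor_functions X X W W'" "t \<in> tensor_functions X X W W'"
    "openin (product_top X X) N'" "(x0, y0) \<in> N'" "N' \<subseteq> D \<inter> (W \<times> W')"
    "\<forall>q\<in>N'. t q \<noteq> 0 \<and> f q = s q / t q"
    by (elim exE conjE) (rule that)
  have p: "x0 \<in> W" "y0 \<in> W'" "t (x0, y0) \<noteq> 0" using * by auto
  have "L.rat (\<lambda>p. s p / t p)"
    by (intro L.rat_divide pair_tensor[OF *(1) p(1) *(2) p(2)] * p)
  moreover have "L.nb N'" by (rule pair_nb_open[OF *(5,6)])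
  ultimately show ?thesis by (rule L.rat_cong) (use * in auto)
qed

end

section \<open>The group law in coordinates\<close>

lemma mult_section:
  assumes "i < N"
  shows "(\<lambda>p. \<theta> (fst p \<otimes> snd p) i) \<in> sections (product_space X X) {p \<in> carrier G \<times> carrier G. fst p \<otimes> snd p \<in> U}"
proof -
  have "(\<lambda>x. \<theta> x i) \<circ> (\<lambda>(x, y). x \<otimes> y) \<in>
      sections (product_space X X) {p \<in> points (product_space X X). (\<lambda>(x, y). x \<otimes> y) p \<in> U}"
    using mult_morphism U_open coordinate_section[OF assms] unfolding morphism_def by blast
  then show ?thesis by (simp add: points_product o_def split_def)
qed

lemma mult_open: "openin (product_top X X) {p \<in> carrier G \<times> carrier G. fst p \<otimes> snd p \<in> U}"
proof -
  have "continuous_map (space_top (product_space X X)) (space_top X) (\<lambda>(x, y). x \<otimes> y)"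
    using mult_morphism by (simp add: morphism_def)
  then have "openin (space_top (product_space X X)) {p \<in> points (product_space X X). (\<lambda>(x, y). x \<otimes> y) p \<in> U}"
    using U_open by (simp add: continuous_map)
  then show ?thesis by (simp add: points_product[unfolded top_product] top_product split_def)
qed

text \<open>A description near a single pair suffices: it holds wherever \<open>T\<close> is
  nonzero, and its degree bound \<open>B\<close> will serve for all iterates.\<close>

lemma mult_chart:
  obtains B S T x0 y0 where "\<And>i. i < N \<Longrightarrow> poly_deg (2 * N) B (S i)" "poly_deg (2 * N) B T"
    "x0 \<in> U" "y0 \<in> U" "T (join N (\<theta> x0) (\<theta> y0)) \<noteq> 0"
    "\<And>x y. x \<in> U \<Longrightarrow> y \<in> U \<Longrightarrow> T (join N (\<theta> x) (\<theta> y)) \<noteq> 0 \<Longrightarrow>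
      x \<otimes> y \<in> U \<and> (\<forall>i<N. \<theta> (x \<otimes> y) i * T (join N (\<theta> x) (\<theta> y)) = S i (join N (\<theta> x) (\<theta> y)))"
proof -
  obtain y0 where y0: "y0 \<in> U" using U_nonempty by blast
  have y0': "y0 \<in> carrier G" by (rule U_carrier[OF y0])
  have "open_in_space X {g \<in> carrier G. g \<otimes> y0 \<in> U}" by (rule translation_open[OF y0' U_open])
  \<comment> \<open>The chart need not be closed under products. Its translate is nonempty, with
    \<open>y0 \<otimes> inv y0\<close> as a witness, so irreducibility makes it meet
    \<open>U\<close>.\<close>
  moreover have "y0 \<otimes> inv y0 \<in> {g \<in> carrier G. g \<otimes> y0 \<in> U}" using y0 y0' by simp
  ultimately have "U \<inter> {g \<in> carrier G. g \<otimes> y0 \<in> U} \<noteq> {}"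
    using irreducible[OF U_open _ U_nonempty] by blast
  then obtain x0 where x0: "x0 \<in> U" "x0 \<otimes> y0 \<in> U" "x0 \<in> carrier G" by blast
  interpret L: local_algebra pair_funs "U \<times> U" "(x0, y0)" by (rule pair_local_algebra[OF x0(1) y0])
  let ?D = "{p \<in> carrier G \<times> carrier G. fst p \<otimes> snd p \<in> U}"
  have D: "(x0, y0) \<in> ?D" using x0 y0' by simp
  have "L.rat (\<lambda>p. \<theta> (fst p \<otimes> snd p) i)" if "i < N" for i
    by (rule pair_section[OF x0(1) y0 mult_section[OF that] D])
  moreover have "L.nb ?D" by (rule pair_nb_open[OF x0(1) y0 mult_open D])
  ultimately have "\<exists>T\<in>pair_funs. \<exists>S. T (x0, y0) \<noteq> 0 \<and> (\<forall>i\<in>{..<N}. S i \<in> pair_funs) \<and>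
    (\<forall>p\<in>U \<times> U. T p \<noteq> 0 \<longrightarrow> p \<in> ?D \<and> (\<forall>i\<in>{..<N}. \<theta> (fst p \<otimes> snd p) i * T p = S i p))"
    by (intro L.common_denominator) auto
  then obtain T S where TS: "T \<in> pair_funs" "T (x0, y0) \<noteq> 0" "\<forall>i\<in>{..<N}. S i \<in> pair_funs"
    "\<forall>p\<in>U \<times> U. T p \<noteq> 0 \<longrightarrow> p \<in> ?D \<and> (\<forall>i\<in>{..<N}. \<theta> (fst p \<otimes> snd p) i * T p = S i p)"
    by blast
  obtain T' where T': "T' \<in> polynomial_functions (2 * N)" "T = (\<lambda>p. T' (join N (\<theta> (fst p)) (\<theta> (snd p))))"
    using TS(1) by (auto simp: pair_funs_def)
  have "\<forall>i. \<exists>P. i < N \<longrightarrow> P \<in> polynomial_functions (2 * N) \<and> S i = (\<lambda>p. P (join N (\<theta> (fst p)) (\<theta> (snd p))))"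
    using TS(3) unfolding pair_funs_def by blast
  then obtain S' where S': "\<And>i. i < N \<Longrightarrow> S' i \<in> polynomial_functions (2 * N) \<and>
    S i = (\<lambda>p. S' i (join N (\<theta> (fst p)) (\<theta> (snd p))))" by metis
  have "\<forall>i. \<exists>d. i < N \<longrightarrow> poly_deg (2 * N) d (S' i)" using S' polynomial_functions_iff by metis
  then obtain dd where dd: "\<And>i. i < N \<Longrightarrow> poly_deg (2 * N) (dd i) (S' i)" by metis
  obtain d where d: "poly_deg (2 * N) d T'" using T'(1) polynomial_functions_iff by metis
  let ?B = "d + (\<Sum>i<N. dd i)"
  show ?thesis
  proof (rule that[of ?B S' T' x0 y0])
    fix i assume i: "i < N"
    have "dd i \<le> (\<Sum>i<N. dd i)" using i by (intro member_le_sum) auto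
    then show "poly_deg (2 * N) ?B (S' i)" by (intro poly_deg_mono[OF dd[OF i]]) simp
  next
    show "poly_deg (2 * N) ?B T'" by (rule poly_deg_mono[OF d]) simp
    show "x0 \<in> U" "y0 \<in> U" by fact+
    show "T' (join N (\<theta> x0) (\<theta> y0)) \<noteq> 0" using TS(2) by (simp add: T'(2))
  next
    fix x y assume "x \<in> U" "y \<in> U" "T' (join N (\<theta> x) (\<theta> y)) \<noteq> 0"
    then show "x \<otimes> y \<in> U \<and> (\<forall>i<N. \<theta> (x \<otimes> y) i * T' (join N (\<theta> x) (\<theta> y)) = S' i (join N (\<theta> x) (\<theta> y)))"
      using bspec[OF TS(4), of "(x, y)"] S' by (simp add: T'(2))
  qed
qed

text \<open>The point \<open>u\<close> certifies a nonempty domain. It is recorded because maps can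
  be combined only near points where all of them, and the result, stay in the chart.\<close>

definition ratmap :: "('g \<Rightarrow> 'g) \<Rightarrow> nat \<Rightarrow> 'g \<Rightarrow> bool" where
  "ratmap \<mu> D u \<longleftrightarrow> u \<in> U \<and> (\<exists>p q. (\<forall>i<N. poly_deg N D (p i)) \<and> poly_deg N D q \<and> q (\<theta> u) \<noteq> 0 \<and>
     (\<forall>g\<in>U. q (\<theta> g) \<noteq> 0 \<longrightarrow> \<mu> g \<in> U \<and> (\<forall>i<N. \<theta> (\<mu> g) i * q (\<theta> g) = p i (\<theta> g))))"

lemma ratmapI:
  assumes "u \<in> U" "\<And>i. i < N \<Longrightarrow> poly_deg N D (p i)" "poly_deg N D q" "q (\<theta> u) \<noteq> 0"
    and "\<And>g. g \<in> U \<Longrightarrow> q (\<theta> g) \<noteq> 0 \<Longrightarrow> \<mu> g \<in> U"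
    and "\<And>g i. g \<in> U \<Longrightarrow> q (\<theta> g) \<noteq> 0 \<Longrightarrow> i < N \<Longrightarrow> \<theta> (\<mu> g) i * q (\<theta> g) = p i (\<theta> g)"
  shows "ratmap \<mu> D u"
  unfolding ratmap_def using assms by blast

lemma ratmapE:
  assumes "ratmap \<mu> D u"
  obtains p q where "u \<in> U" "\<And>i. i < N \<Longrightarrow> poly_deg N D (p i)" "poly_deg N D q" "q (\<theta> u) \<noteq> 0"
    "\<And>g. g \<in> U \<Longrightarrow> q (\<theta> g) \<noteq> 0 \<Longrightarrow> \<mu> g \<in> U"
    "\<And>g i. g \<in> U \<Longrightarrow> q (\<theta> g) \<noteq> 0 \<Longrightarrow> i < N \<Longrightarrow> \<theta> (\<mu> g) i * q (\<theta> g) = p i (\<theta> g)"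
  using assms unfolding ratmap_def by blast

lemma ratmap_mono: "ratmap \<mu> D u \<Longrightarrow> D \<le> E \<Longrightarrow> ratmap \<mu> E u"
  unfolding ratmap_def using poly_deg_mono by blast

lemma ratmap_domain_open: "open_in_space X {u. ratmap \<mu> D u}"
proof (subst openin_subopen, intro ballI)
  fix u assume "u \<in> {u. ratmap \<mu> D u}"
  then obtain p q where pq: "u \<in> U" "\<And>i. i < N \<Longrightarrow> poly_deg N D (p i)" "poly_deg N D q" "q (\<theta> u) \<noteq> 0"
    "\<And>g. g \<in> U \<Longrightarrow> q (\<theta> g) \<noteq> 0 \<Longrightarrow> \<mu> g \<in> U"
    "\<And>g i. g \<in> U \<Longrightarrow> q (\<theta> g) \<noteq> 0 \<Longrightarrow> i < N \<Longrightarrow> \<theta> (\<mu> g) i * q (\<theta> g) = p i (\<theta> g)"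
    using ratmapE by blast
  have "open_in_space X {x \<in> U. q (\<theta> x) \<noteq> 0}"
    using pq(3) by (intro nonvanishing_open) (auto simp: polynomial_functions_iff)
  moreover have "{x \<in> U. q (\<theta> x) \<noteq> 0} \<subseteq> {u. ratmap \<mu> D u}"
    using ratmapI[OF _ pq(2,3) _ pq(5,6)] by blast
  ultimately show "\<exists>T. open_in_space X T \<and> u \<in> T \<and> T \<subseteq> {u. ratmap \<mu> D u}" using pq(1,4) by blast
qed

lemma ratmap_id: "u \<in> U \<Longrightarrow> ratmap (\<lambda>g. g) 1 u"
  by (rule ratmapI[where p = "\<lambda>i x. x i" and q = "\<lambda>_. 1"]) (auto intro: poly_deg.intros)

lemma ratmap_const: "u \<in> U \<Longrightarrow> c \<in> U \<Longrightarrow> ratmap (\<lambda>_. c) 0 u"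
  by (rule ratmapI[where p = "\<lambda>i _. \<theta> c i" and q = "\<lambda>_. 1"]) (auto intro: poly_deg.intros)

text \<open>Regularity yields local fractions of some uncontrolled degree. This is enough for
  inversion and for \<sigma> itself; only the iterates call for an explicit bound.\<close>

lemma ratmap_morphism:
  assumes "morphism X X \<mu>" "u \<in> U" "\<mu> u \<in> U"
  shows "\<exists>D. ratmap \<mu> D u"
proof -
  interpret L: local_algebra chart_funs U u by (rule chart_local_algebra[OF assms(2)])
  let ?W = "{g \<in> points X. \<mu> g \<in> U}"
  have W: "open_in_space X ?W" using assms(1) U_open by (simp add: morphism_def continuous_map)
  have uW: "u \<in> ?W" using assms U_points by auto
  have "L.rat (\<lambda>g. \<theta> (\<mu> g) i)" if "i < N" for i
  proof -
    have "(\<lambda>x. \<theta> x i) \<circ> \<mu> \<in> sections X ?W"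
      using assms(1) U_open coordinate_section[OF that] unfolding morphism_def by blast
    from chart_rat_section[OF assms(2) W uW this] show ?thesis by (simp add: o_def)
  qed
  moreover have "L.nb ?W" by (rule chart_nb_open[OF assms(2) W uW])
  ultimately have "\<exists>T\<in>chart_funs. \<exists>S. T u \<noteq> 0 \<and> (\<forall>i\<in>{..<N}. S i \<in> chart_funs) \<and>
    (\<forall>p\<in>U. T p \<noteq> 0 \<longrightarrow> p \<in> ?W \<and> (\<forall>i\<in>{..<N}. \<theta> (\<mu> p) i * T p = S i p))"
    by (intro L.common_denominator) auto
  then obtain T S where TS: "T \<in> chart_funs" "T u \<noteq> 0" "\<forall>i\<in>{..<N}. S i \<in> chart_funs"
    "\<forall>p\<in>U. T p \<noteq> 0 \<longrightarrow> p \<in> ?W \<and> (\<forall>i\<in>{..<N}. \<theta> (\<mu> p) i * T p = S i p)"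
    by blast
  obtain T' where T': "T' \<in> polynomial_functions N" "T = (\<lambda>p. T' (\<theta> p))"
    using TS(1) by (auto simp: chart_funs_def)
  have "\<forall>i. \<exists>P. i < N \<longrightarrow> P \<in> polynomial_functions N \<and> S i = (\<lambda>p. P (\<theta> p))"
    using TS(3) unfolding chart_funs_def by blast
  then obtain S' where S': "\<And>i. i < N \<Longrightarrow> S' i \<in> polynomial_functions N \<and> S i = (\<lambda>p. S' i (\<theta> p))" by metis
  have "\<forall>i. \<exists>d. i < N \<longrightarrow> poly_deg N d (S' i)" using S' polynomial_functions_iff by metis
  then obtain dd where dd: "\<And>i. i < N \<Longrightarrow> poly_deg N (dd i) (S' i)" by metis
  obtain d where d: "poly_deg N d T'" using T'(1) polynomial_functions_iff by metis
  let ?B = "d + (\<Sum>i<N. dd i)"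
  have "ratmap \<mu> ?B u"
  proof (rule ratmapI[OF assms(2), where p = S' and q = T'])
    fix i assume i: "i < N"
    have "dd i \<le> (\<Sum>i<N. dd i)" using i by (intro member_le_sum) auto
    then show "poly_deg N ?B (S' i)" by (intro poly_deg_mono[OF dd[OF i]]) simp
  next
    show "poly_deg N ?B T'" by (rule poly_deg_mono[OF d]) simp
    show "T' (\<theta> u) \<noteq> 0" using TS(2) by (simp add: T'(2))
  qed (use TS(4) S' T'(2) in auto)
  then show ?thesis ..
qed

lemma ratmap_comp:
  assumes "ratmap \<mu> D u" "ratmap \<nu> E (\<mu> u)"
  shows "ratmap (\<lambda>g. \<nu> (\<mu> g)) ((E + 1) * D) u"
proof -
  obtain p q where pq: "u \<in> U" "\<And>i. i < N \<Longrightarrow> poly_deg N D (p i)" "poly_deg N D q" "q (\<theta> u) \<noteq> 0"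
    "\<And>g. g \<in> U \<Longrightarrow> q (\<theta> g) \<noteq> 0 \<Longrightarrow> \<mu> g \<in> U"
    "\<And>g i. g \<in> U \<Longrightarrow> q (\<theta> g) \<noteq> 0 \<Longrightarrow> i < N \<Longrightarrow> \<theta> (\<mu> g) i * q (\<theta> g) = p i (\<theta> g)"
    using ratmapE[OF assms(1)] by blast
  obtain p' q' where pq': "\<mu> u \<in> U" "\<And>i. i < N \<Longrightarrow> poly_deg N E (p' i)" "poly_deg N E q'" "q' (\<theta> (\<mu> u)) \<noteq> 0"
    "\<And>g. g \<in> U \<Longrightarrow> q' (\<theta> g) \<noteq> 0 \<Longrightarrow> \<nu> g \<in> U"
    "\<And>g i. g \<in> U \<Longrightarrow> q' (\<theta> g) \<noteq> 0 \<Longrightarrow> i < N \<Longrightarrow> \<theta> (\<nu> g) i * q' (\<theta> g) = p' i (\<theta> g)"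
    using ratmapE[OF assms(2)] by blast
  have comp: "\<exists>R. poly_deg N (E * D) R \<and>
      (\<forall>g\<in>U. q (\<theta> g) \<noteq> 0 \<longrightarrow> R (\<theta> g) = P (\<theta> (\<mu> g)) * q (\<theta> g) ^ E)" if degP: "poly_deg N E P" for P
  proof -
    obtain R where "poly_deg N (E * D) R" "\<And>x y. (\<forall>i<N. y i * q x = p i x) \<Longrightarrow> R x = P y * q x ^ E"
      using poly_deg_compose[OF degP, where p = p and q = q and D = D and M = N] pq(2,3) by blast
    then show ?thesis using pq(6) by blast
  qed
  obtain R where R: "poly_deg N (E * D) R"
    "\<And>g. g \<in> U \<Longrightarrow> q (\<theta> g) \<noteq> 0 \<Longrightarrow> R (\<theta> g) = q' (\<theta> (\<mu> g)) * q (\<theta> g) ^ E"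
    using comp[OF pq'(3)] by blast
  have "\<forall>i. \<exists>R. i < N \<longrightarrow> poly_deg N (E * D) R \<and>
      (\<forall>g\<in>U. q (\<theta> g) \<noteq> 0 \<longrightarrow> R (\<theta> g) = p' i (\<theta> (\<mu> g)) * q (\<theta> g) ^ E)"
    using comp[OF pq'(2)] by blast
  then obtain R' where R': "\<And>i. i < N \<Longrightarrow> poly_deg N (E * D) (R' i)"
    "\<And>i g. i < N \<Longrightarrow> g \<in> U \<Longrightarrow> q (\<theta> g) \<noteq> 0 \<Longrightarrow> R' i (\<theta> g) = p' i (\<theta> (\<mu> g)) * q (\<theta> g) ^ E" by metis
  show ?thesis
  \<comment> \<open>Substitution gives degree \<open>E * D\<close>. The extra factor
    \<open>q\<close>, of degree \<open>D\<close>, makes the new denominator vanish wherever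
    \<open>q\<close> does, since \<open>R\<close> is controlled only where \<open>q\<close> is
    nonzero.\<close>
  proof (rule ratmapI[where p = "\<lambda>i x. q x * R' i x" and q = "\<lambda>x. q x * R x"])
    show "poly_deg N ((E + 1) * D) (\<lambda>x. q x * R x)" by (rule poly_deg.mult[OF pq(3) R(1)]) simp
    show "poly_deg N ((E + 1) * D) (\<lambda>x. q x * R' i x)" if "i < N" for i
      by (rule poly_deg.mult[OF pq(3) R'(1)[OF that]]) simp
    show "u \<in> U" by fact
    show "q (\<theta> u) * R (\<theta> u) \<noteq> 0" using pq pq' R by simp
    fix g assume g: "g \<in> U" "q (\<theta> g) * R (\<theta> g) \<noteq> 0"
    then have g': "q (\<theta> g) \<noteq> 0" "q' (\<theta> (\<mu> g)) \<noteq> 0" "\<mu> g \<in> U" using R(2)[of g] pq(5) by auto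
    then show "\<nu> (\<mu> g) \<in> U" using pq'(5) by blast
    fix i assume i: "i < N"
    have "\<theta> (\<nu> (\<mu> g)) i * (q (\<theta> g) * R (\<theta> g)) =
        (\<theta> (\<nu> (\<mu> g)) i * q' (\<theta> (\<mu> g))) * (q (\<theta> g) * q (\<theta> g) ^ E)"
      using R(2)[OF g(1) g'(1)] by simp
    also have "\<dots> = q (\<theta> g) * R' i (\<theta> g)"
      using pq'(6)[OF g'(3,2) i] R'(2)[OF i g(1) g'(1)] by simp
    finally show "\<theta> (\<nu> (\<mu> g)) i * (q (\<theta> g) * R (\<theta> g)) = q (\<theta> g) * R' i (\<theta> g)" .
  qed
qed

lemma ratmap_mult:
  assumes S: "\<And>i. i < N \<Longrightarrow> poly_deg (2 * N) B (S i)" and T: "poly_deg (2 * N) B T"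
    and chart: "\<And>x y. x \<in> U \<Longrightarrow> y \<in> U \<Longrightarrow> T (join N (\<theta> x) (\<theta> y)) \<noteq> 0 \<Longrightarrow>
      x \<otimes> y \<in> U \<and> (\<forall>i<N. \<theta> (x \<otimes> y) i * T (join N (\<theta> x) (\<theta> y)) = S i (join N (\<theta> x) (\<theta> y)))"
    and "ratmap \<mu> D u" "ratmap \<nu> D u" "T (join N (\<theta> (\<mu> u)) (\<theta> (\<nu> u))) \<noteq> 0"
  shows "ratmap (\<lambda>g. \<mu> g \<otimes> \<nu> g) ((B + 1) * (2 * D)) u"
proof -
  obtain p q where pq: "u \<in> U" "\<And>i. i < N \<Longrightarrow> poly_deg N D (p i)" "poly_deg N D q" "q (\<theta> u) \<noteq> 0"
    "\<And>g. g \<in> U \<Longrightarrow> q (\<theta> g) \<noteq> 0 \<Longrightarrow> \<mu> g \<in> U"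
    "\<And>g i. g \<in> U \<Longrightarrow> q (\<theta> g) \<noteq> 0 \<Longrightarrow> i < N \<Longrightarrow> \<theta> (\<mu> g) i * q (\<theta> g) = p i (\<theta> g)"
    using ratmapE[OF assms(4)] by blast
  obtain p' q' where "u \<in> U" and pq': "\<And>i. i < N \<Longrightarrow> poly_deg N D (p' i)" "poly_deg N D q'" "q' (\<theta> u) \<noteq> 0"
    "\<And>g. g \<in> U \<Longrightarrow> q' (\<theta> g) \<noteq> 0 \<Longrightarrow> \<nu> g \<in> U"
    "\<And>g i. g \<in> U \<Longrightarrow> q' (\<theta> g) \<noteq> 0 \<Longrightarrow> i < N \<Longrightarrow> \<theta> (\<nu> g) i * q' (\<theta> g) = p' i (\<theta> g)"
    using ratmapE[OF assms(5)] by blast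
  \<comment> \<open>Both factors are brought to one denominator, which doubles the degree, so that
    the pair is a single fraction in \<open>2 * N\<close> coordinates.\<close>
  define Q where "Q x = q x * q' x" for x
  define Pj where "Pj i x = (if i < N then p i x * q' x else p' (i - N) x * q x)" for i x
  have Q: "poly_deg N (2 * D) Q" unfolding Q_def[abs_def] by (rule poly_deg.mult[OF pq(3) pq'(2)]) simp
  have Pj: "poly_deg N (2 * D) (Pj i)" if "i < 2 * N" for i
  proof (cases "i < N")
    case True
    then show ?thesis using poly_deg.mult[OF pq(2)[OF True] pq'(2), of "2 * D"] by (simp add: Pj_def[abs_def])
  next
    case False
    then have "i - N < N" using that by simp
    from poly_deg.mult[OF pq'(1)[OF this] pq(3), of "2 * D"] False show ?thesis by (simp add: Pj_def[abs_def])
  qed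
  let ?j = "\<lambda>g. join N (\<theta> (\<mu> g)) (\<theta> (\<nu> g))"
  have j: "?j g i * Q (\<theta> g) = Pj i (\<theta> g)" if "g \<in> U" "Q (\<theta> g) \<noteq> 0" "i < 2 * N" for g i
  proof (cases "i < N")
    case True
    then show ?thesis using pq(6)[OF that(1) _ True] that(2) by (auto simp: Q_def Pj_def join_def)
  next
    case False
    then have "i - N < N" using that by simp
    then show ?thesis using pq'(5)[OF that(1), of "i - N"] that(2) False by (auto simp: Q_def Pj_def join_def)
  qed
  have comp: "\<exists>R. poly_deg N (B * (2 * D)) R \<and>
      (\<forall>g\<in>U. Q (\<theta> g) \<noteq> 0 \<longrightarrow> R (\<theta> g) = P (?j g) * Q (\<theta> g) ^ B)" if degP: "poly_deg (2 * N) B P" for P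
  proof -
    obtain R where "poly_deg N (B * (2 * D)) R" "\<And>x y. (\<forall>i<2 * N. y i * Q x = Pj i x) \<Longrightarrow> R x = P y * Q x ^ B"
      using poly_deg_compose[OF degP, where p = Pj and q = Q and D = "2 * D" and M = N] Pj Q by blast
    then show ?thesis using j by blast
  qed
  obtain R where R: "poly_deg N (B * (2 * D)) R"
    "\<And>g. g \<in> U \<Longrightarrow> Q (\<theta> g) \<noteq> 0 \<Longrightarrow> R (\<theta> g) = T (?j g) * Q (\<theta> g) ^ B"
    using comp[OF T] by blast
  have "\<forall>i. \<exists>R. i < N \<longrightarrow> poly_deg N (B * (2 * D)) R \<and>
      (\<forall>g\<in>U. Q (\<theta> g) \<noteq> 0 \<longrightarrow> R (\<theta> g) = S i (?j g) * Q (\<theta> g) ^ B)"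
    using comp[OF S] by blast
  then obtain R' where R': "\<And>i. i < N \<Longrightarrow> poly_deg N (B * (2 * D)) (R' i)"
    "\<And>i g. i < N \<Longrightarrow> g \<in> U \<Longrightarrow> Q (\<theta> g) \<noteq> 0 \<Longrightarrow> R' i (\<theta> g) = S i (?j g) * Q (\<theta> g) ^ B" by metis
  show ?thesis
  proof (rule ratmapI[where p = "\<lambda>i x. Q x * R' i x" and q = "\<lambda>x. Q x * R x"])
    show "poly_deg N ((B + 1) * (2 * D)) (\<lambda>x. Q x * R x)" by (rule poly_deg.mult[OF Q R(1)]) simp
    show "poly_deg N ((B + 1) * (2 * D)) (\<lambda>x. Q x * R' i x)" if "i < N" for i
      by (rule poly_deg.mult[OF Q R'(1)[OF that]]) simp
    show "u \<in> U" by fact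
    have "Q (\<theta> u) \<noteq> 0" using pq(4) pq'(3) by (simp add: Q_def)
    then show "Q (\<theta> u) * R (\<theta> u) \<noteq> 0" using R(2)[OF pq(1)] assms(6) by simp
    fix g assume g: "g \<in> U" "Q (\<theta> g) * R (\<theta> g) \<noteq> 0"
    then have g': "Q (\<theta> g) \<noteq> 0" "T (?j g) \<noteq> 0" using R(2)[of g] by auto
    have U: "\<mu> g \<in> U" "\<nu> g \<in> U" using g'(1) g(1) pq(5) pq'(4) by (auto simp: Q_def)
    note c = chart[OF U g'(2)]
    show "\<mu> g \<otimes> \<nu> g \<in> U" using c by blast
    fix i assume i: "i < N"
    have "\<theta> (\<mu> g \<otimes> \<nu> g) i * (Q (\<theta> g) * R (\<theta> g)) =
        (\<theta> (\<mu> g \<otimes> \<nu> g) i * T (?j g)) * (Q (\<theta> g) * Q (\<theta> g) ^ B)"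
      using R(2)[OF g(1) g'(1)] by simp
    also have "\<dots> = Q (\<theta> g) * R' i (\<theta> g)"
      using c i R'(2)[OF i g(1) g'(1)] by simp
    finally show "\<theta> (\<mu> g \<otimes> \<nu> g) i * (Q (\<theta> g) * R (\<theta> g)) = Q (\<theta> g) * R' i (\<theta> g)" .
  qed
qed

end

section \<open>Fixed points of endomorphisms\<close>

lemma (in local_algebra) nb_INT:
  "finite I \<Longrightarrow> (\<And>i. i \<in> I \<Longrightarrow> nb (M i)) \<Longrightarrow> nb (\<Inter>i\<in>I. M i)"
proof (induction rule: finite_induct)
  case empty
  show ?case by (rule nbI[OF const[of 1]]) auto
qed (auto intro: nb_Int)

text \<open>Adding a multiple of a polynomial that vanishes on \<open>S\<close> but not at the new
  point leaves the old values alone and moves the new one to a free value, which exists because the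
  field is infinite.\<close>

lemma separating_polynomial:
  fixes S :: "(nat \<Rightarrow> 'k::alg_closed_field) set"
  assumes "finite S" "S \<subseteq> affine_points N"
  shows "\<exists>e\<in>polynomial_functions N. inj_on e S"
  using assms
proof induction
  case empty
  show ?case using polynomial_functions.const by (metis inj_on_empty)
next
  case (insert a S)
  then obtain e where e: "e \<in> polynomial_functions N" "inj_on e S" by auto
  have "\<exists>i<N. a i \<noteq> s i" if "s \<in> S" for s
  proof (rule ccontr)
    assume "\<not> ?thesis"
    then have "a = s" using insert.prems that
      unfolding affine_points_def by (intro PiE_ext[of a "{..<N}" "\<lambda>_. UNIV"]) auto
    then show False using insert.hyps(2) that by simp
  qed
  then obtain i where i: "\<And>s. s \<in> S \<Longrightarrow> i s < N \<and> a (i s) \<noteq> s (i s)" by metis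
  have "poly_deg N (card S * 1) (\<lambda>x. \<Prod>s\<in>S. x (i s) - s (i s))"
    using i by (intro poly_deg_prod poly_deg_diff poly_deg.coord poly_deg.const) auto
  then have \<delta>: "(\<lambda>x. \<Prod>s\<in>S. x (i s) - s (i s)) \<in> polynomial_functions N"
    unfolding polynomial_functions_iff by blast
  have \<delta>0: "(\<Prod>s\<in>S. t (i s) - s (i s)) = 0" if "t \<in> S" for t
    using that insert.hyps(1) by (intro prod_zero) auto
  have \<delta>a: "(\<Prod>s\<in>S. a (i s) - s (i s)) \<noteq> 0" using i insert.hyps(1) by (auto simp: prod_zero_iff)
  obtain v where v: "v \<notin> e ` S"
    using infinite_alg_closed_field[where 'k = 'k] finite_imageI[OF insert.hyps(1), of e]
    by (metis UNIV_eq_I)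
  define c where "c = (v - e a) / (\<Prod>s\<in>S. a (i s) - s (i s))"
  define e' where "e' = (\<lambda>x. e x + c * (\<Prod>s\<in>S. x (i s) - s (i s)))"
  have "e' \<in> polynomial_functions N"
    unfolding e'_def using e(1) \<delta> by (intro polynomial_functions.add polynomial_functions.mult polynomial_functions.const)
  moreover have on_S: "e' s = e s" if "s \<in> S" for s using \<delta>0[OF that] by (simp add: e'_def)
  have at_a: "e' a = v" using \<delta>a by (simp add: e'_def c_def)
  have "inj_on e' (insert a S)"
    unfolding inj_on_insert using e(2) v on_S at_a insert.hyps(2)
    by (auto simp: inj_on_def image_iff)
  ultimately show ?case by blast
qed

lemma polynomial_join_fix_right:
  "P \<in> polynomial_functions (2 * N) \<Longrightarrow> (\<lambda>x. P (join N x y)) \<in> polynomial_functions N"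
proof (induction rule: polynomial_functions.induct)
  case (coord i)
  then show ?case
    by (cases "i < N") (auto simp: join_def intro: polynomial_functions.coord polynomial_functions.const)
qed (auto intro: polynomial_functions.intros)

lemma polynomial_join_fix_left:
  "P \<in> polynomial_functions (2 * N) \<Longrightarrow> (\<lambda>y. P (join N x y)) \<in> polynomial_functions N"
proof (induction rule: polynomial_functions.induct)
  case (coord i)
  then show ?case
    by (cases "i < N") (auto simp: join_def intro: polynomial_functions.coord polynomial_functions.const)
qed (auto intro: polynomial_functions.intros)

context group_chart
begin

text \<open>The element \<open>k\<close> may lie outside the chart, so the description for pairs of
  chart points does not apply. Instead the quotient of tensors that represents the product near
  \<open>(u, k)\<close> is restricted to a slice.\<close>

lemma translation_rat:
  assumes u: "u \<in> U" "u \<otimes> k \<in> U" and k: "k \<in> carrier G" and i: "i < N"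
  shows "local_algebra.rat chart_funs U u (\<lambda>g. \<theta> (g \<otimes> k) i)"
proof -
  interpret L: local_algebra chart_funs U u by (rule chart_local_algebra[OF u(1)])
  let ?D = "{p \<in> carrier G \<times> carrier G. fst p \<otimes> snd p \<in> U}" and ?f = "\<lambda>p. \<theta> (fst p \<otimes> snd p) i"
  have D: "(u, k) \<in> ?D" using u k U_carrier by auto
  have "\<forall>p\<in>?D. \<exists>W W' s t N'. open_in_space X W \<and> open_in_space X W' \<and>
      s \<in> tensor_functions X X W W' \<and> t \<in> tensor_functions X X W W' \<and>
      openin (product_top X X) N' \<and> p \<in> N' \<and> N' \<subseteq> ?D \<inter> (W \<times> W') \<and>
      (\<forall>q\<in>N'. t q \<noteq> 0 \<and> ?f q = s q / t q)"
    using mult_section[OF i] unfolding product_space_def select_convs mem_Collect_eq .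
  from bspec[OF this D] obtain W W' s t N' where *: "open_in_space X W" "open_in_space X W'"
    "s \<in> tensor_functions X X W W'" "t \<in> tensor_functions X X W W'"
    "openin (product_top X X) N'" "(u, k) \<in> N'" "N' \<subseteq> ?D \<inter> (W \<times> W')"
    "\<forall>q\<in>N'. t q \<noteq> 0 \<and> ?f q = s q / t q"
    by (elim exE conjE) (rule that)
  have uW: "u \<in> W" using * by auto
  have rat: "L.rat (\<lambda>g. t (g, k))" if t: "t \<in> tensor_functions X X W W'" for t
  proof -
    obtain m a b where tt: "t = (\<lambda>(x, y). \<Sum>i<(m::nat). a i x * b i y)" "\<forall>i<m. a i \<in> sections X W"
      using t unfolding tensor_functions_def by blast
    have "(\<lambda>g. \<Sum>i<m. a i g * b i k) \<in> sections X W"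
      using tt(2) by (intro section_sum section_mult section_const space_X *(1)) auto
    from chart_rat_section[OF u(1) *(1) uW this] show ?thesis by (simp add: tt(1))
  qed
  have "L.rat (\<lambda>g. s (g, k) / t (g, k))"
    using * by (intro L.rat_divide rat) auto
  moreover have "L.nb {g \<in> points X. (g, k) \<in> N'}"
  proof (rule chart_nb_open[OF u(1)])
    show "open_in_space X {g \<in> points X. (g, k) \<in> N'}"
      using slice_continuous[OF prevariety_X, of k] *(5) k by (simp add: continuous_map carrier_points)
    show "u \<in> {g \<in> points X. (g, k) \<in> N'}" using * u U_points by auto
  qed
  ultimately show ?thesis by (rule L.rat_cong) (use *(8) in auto)
qed

lemma translation_rat_polynomial:
  assumes u: "u \<in> U" "u \<otimes> k \<in> U" and k: "k \<in> carrier G" and e: "e \<in> polynomial_functions N"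
  shows "local_algebra.rat chart_funs U u (\<lambda>g. e (\<theta> (g \<otimes> k)))"
proof -
  interpret L: local_algebra chart_funs U u by (rule chart_local_algebra[OF u(1)])
  show ?thesis
    using e by induction (auto intro: L.rat_const L.rat_add L.rat_mult translation_rat[OF u k])
qed

lemma Z_irreducible:
  assumes "P \<in> polynomial_functions N" "Q \<in> polynomial_functions N" "\<And>x. x \<in> Z \<Longrightarrow> P x * Q x = 0"
  shows "(\<forall>x\<in>Z. P x = 0) \<or> (\<forall>x\<in>Z. Q x = 0)"
proof (rule ccontr)
  assume "\<not> ?thesis"
  then obtain a b where ab: "a \<in> Z" "P a \<noteq> 0" "b \<in> Z" "Q b \<noteq> 0" by blast
  have "\<theta>' a \<in> {x \<in> U. P (\<theta> x) \<noteq> 0}" "\<theta>' b \<in> {x \<in> U. Q (\<theta> x) \<noteq> 0}" using ab inverse(1,3) by auto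
  then have "{x \<in> U. P (\<theta> x) \<noteq> 0} \<inter> {x \<in> U. Q (\<theta> x) \<noteq> 0} \<noteq> {}"
    by (intro irreducible nonvanishing_open assms) auto
  then show False using assms(3) in_Z by fastforce
qed

text \<open>The fibres of \<open>\<lambda>g. \<tau> g \<otimes> (inv g \<otimes> c)\<close> are cosets of the group of fixed points of \<open>\<tau>\<close>.\<close>

lemma card_fixed_points_le:
  assumes \<tau>: "\<tau> \<in> hom G G" and c: "c \<in> carrier G"
    and fin: "finite {g \<in> carrier G. \<tau> g = g}"
    and rm: "ratmap (\<lambda>g. \<tau> g \<otimes> (inv g \<otimes> c)) D u"
  shows "card {g \<in> carrier G. \<tau> g = g} \<le> (D + 1) ^ N"
proof -
  define H where "H = {g \<in> carrier G. \<tau> g = g}"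
  define \<kappa> where "\<kappa> g = \<tau> g \<otimes> (inv g \<otimes> c)" for g
  have \<tau>c: "\<tau> g \<in> carrier G" if "g \<in> carrier G" for g using \<tau> that by (auto simp: hom_def)
  have \<tau>m: "\<tau> (x \<otimes> y) = \<tau> x \<otimes> \<tau> y" if "x \<in> carrier G" "y \<in> carrier G" for x y
    using \<tau> that by (auto simp: hom_def)
  interpret hom: group_hom G G \<tau> by unfold_locales (rule \<tau>)
  have HG: "H \<subseteq> carrier G" and finH: "finite H" using fin by (auto simp: H_def)
  have oneH: "\<one> \<in> H" by (simp add: H_def)
  have \<kappa>_coset: "\<kappa> (g \<otimes> k) = \<kappa> g" if g: "g \<in> carrier G" and "k \<in> H" for g k
  proof -
    have k: "k \<in> carrier G" "\<tau> k = k" using that by (auto simp: H_def)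
    have "\<kappa> (g \<otimes> k) = (\<tau> g \<otimes> k) \<otimes> ((inv g \<otimes> inv k) \<otimes> c)"
      unfolding \<kappa>_def using \<tau>m[OF g k(1)] k g by (simp add: inv_mult)
    also have "\<dots> = (k \<otimes> inv k) \<otimes> (\<tau> g \<otimes> (inv g \<otimes> c))"
    proof -
      have "(a \<otimes> k) \<otimes> ((b \<otimes> j) \<otimes> c) = (k \<otimes> j) \<otimes> (a \<otimes> (b \<otimes> c))"
        if "a \<in> carrier G" "b \<in> carrier G" "j \<in> carrier G" for a b j
        using that k(1) c by (simp add: m_ac)
      then show ?thesis using \<tau>c[OF g] k g by simp
    qed
    also have "\<dots> = \<kappa> g" using k g c \<tau>c[OF g] by (simp add: \<kappa>_def)
    finally show ?thesis .
  qed
  have \<kappa>_fibre: "g \<otimes> inv g0 \<in> H" if g: "g \<in> carrier G" "g0 \<in> carrier G" "\<kappa> g = \<kappa> g0" for g g0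
  proof -
    have "(\<tau> g \<otimes> inv g) \<otimes> c = (\<tau> g0 \<otimes> inv g0) \<otimes> c"
      using g \<tau>c c unfolding \<kappa>_def by (simp add: m_assoc)
    then have 1: "\<tau> g \<otimes> inv g = \<tau> g0 \<otimes> inv g0" using g \<tau>c c by simp
    have "\<tau> (g \<otimes> inv g0) = \<tau> g \<otimes> inv (\<tau> g0)" using g \<tau>m by simp
    also have "\<dots> = (\<tau> g \<otimes> inv g) \<otimes> (g \<otimes> inv (\<tau> g0))"
      using g \<tau>c by (simp add: m_assoc) (simp add: m_assoc[symmetric])
    also have "\<dots> = (\<tau> g0 \<otimes> inv g0) \<otimes> (g \<otimes> inv (\<tau> g0))" by (simp only: 1)
    also have "\<dots> = (\<tau> g0 \<otimes> inv (\<tau> g0)) \<otimes> (g \<otimes> inv g0)"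
    proof -
      have ac: "(a \<otimes> b) \<otimes> (g \<otimes> j) = (a \<otimes> j) \<otimes> (g \<otimes> b)"
        if "a \<in> carrier G" "b \<in> carrier G" "j \<in> carrier G" for a b j
        using that g(1) by (simp add: m_ac)
      show ?thesis by (rule ac) (use g \<tau>c in simp_all)
    qed
    also have "\<dots> = g \<otimes> inv g0" using g \<tau>c by simp
    finally show ?thesis using g by (simp add: H_def)
  qed
  obtain p q where pq: "u \<in> U" "\<And>i. i < N \<Longrightarrow> poly_deg N D (p i)" "poly_deg N D q" "q (\<theta> u) \<noteq> 0"
    "\<And>g. g \<in> U \<Longrightarrow> q (\<theta> g) \<noteq> 0 \<Longrightarrow> \<kappa> g \<in> U"
    "\<And>g i. g \<in> U \<Longrightarrow> q (\<theta> g) \<noteq> 0 \<Longrightarrow> i < N \<Longrightarrow> \<theta> (\<kappa> g) i * q (\<theta> g) = p i (\<theta> g)"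
    using ratmapE[OF rm, folded \<kappa>_def] by blast
  define z where "z y = \<theta> (\<kappa> (\<theta>' y))" for y
  have z\<theta>: "z (\<theta> g) = \<theta> (\<kappa> g)" if "g \<in> U" for g using inverse(2)[OF that] by (simp add: z_def)
  interpret R: rational_self_map N D Z p q z
  proof
    show "algebraic_set N Z" by (rule Z_algebraic)
    show "(\<forall>x\<in>Z. P x = 0) \<or> (\<forall>x\<in>Z. Q x = 0)"
      if "poly_deg N d P" "poly_deg N e Q" "\<And>x. x \<in> Z \<Longrightarrow> P x * Q x = 0" for d e P Q
      using that by (intro Z_irreducible) (auto simp: polynomial_functions_iff)
    show "poly_deg N D q" "\<And>i. i < N \<Longrightarrow> poly_deg N D (p i)" by fact+
    show "\<exists>x\<in>Z. q x \<noteq> 0" using pq(1,4) in_Z by blast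
    show "z x \<in> Z" if "x \<in> Z" "q x \<noteq> 0" for x
      using pq(5)[of "\<theta>' x"] inverse(1,3)[OF that(1)] that(2) in_Z by (simp add: z_def)
    show "z x i * q x = p i x" if "x \<in> Z" "q x \<noteq> 0" "i < N" for x i
      using pq(6)[of "\<theta>' x" i] inverse(1,3)[OF that(1)] that by (simp add: z_def)
    fix w
    have sub: "{x \<in> Z. q x \<noteq> 0 \<and> z x = w} \<subseteq> \<theta> ` {g \<in> U. q (\<theta> g) \<noteq> 0 \<and> \<theta> (\<kappa> g) = w}"
    proof
      fix x assume "x \<in> {x \<in> Z. q x \<noteq> 0 \<and> z x = w}"
      then show "x \<in> \<theta> ` {g \<in> U. q (\<theta> g) \<noteq> 0 \<and> \<theta> (\<kappa> g) = w}"
        using inverse(1,3)[of x] by (intro image_eqI[of _ _ "\<theta>' x"]) (auto simp: z_def)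
    qed
    have "finite {g \<in> U. q (\<theta> g) \<noteq> 0 \<and> \<theta> (\<kappa> g) = w}" (is "finite ?F")
    proof (cases "?F = {}")
      case False
      then obtain g0 where g0: "g0 \<in> ?F" by blast
      \<comment> \<open>Points with equal image differ by a fixed point of \<tau>, so finitely many
        fixed points give finite fibres.\<close>
      have "?F \<subseteq> (\<lambda>k. k \<otimes> g0) ` H"
      proof
        fix g assume g: "g \<in> ?F"
        have "\<kappa> g = \<kappa> g0" using g g0 pq(5) by (intro inj) auto
        then have "g \<otimes> inv g0 \<in> H" using g g0 U_carrier by (intro \<kappa>_fibre) auto
        moreover have "g = (g \<otimes> inv g0) \<otimes> g0" using g g0 U_carrier by (simp add: m_assoc)
        ultimately show "g \<in> (\<lambda>k. k \<otimes> g0) ` H" by blast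
      qed
      then show ?thesis using finH by (meson finite_imageI finite_subset)
    qed (simp only: finite.emptyI)
    then show "finite {x \<in> Z. q x \<noteq> 0 \<and> z x = w}" using sub by (meson finite_imageI finite_subset)
  qed
  let ?W = "{g \<in> U. q (\<theta> g) \<noteq> 0}"
  have oW: "open_in_space X ?W" using pq(3) by (intro nonvanishing_open) (auto simp: polynomial_functions_iff)
  have uW: "u \<in> ?W" using pq(1,4) by simp
  \<comment> \<open>General position: some \<open>u0\<close> has its whole coset under
    \<open>H\<close> in the domain, because the finitely many translates of the domain are open and
    nonempty.\<close>
  have "\<exists>x\<in>U. \<forall>k\<in>H. x \<in> {g \<in> carrier G. g \<otimes> k \<in> ?W}"
  proof (rule irreducible_Inter[OF finH _ U_open U_nonempty], intro conjI)
    fix k assume k: "k \<in> H"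
    show "open_in_space X {g \<in> carrier G. g \<otimes> k \<in> ?W}" using k HG oW by (intro translation_open) auto
    have "(u \<otimes> inv k) \<otimes> k = u" using k HG U_carrier[OF pq(1)] by (auto simp: m_assoc subset_iff)
    then have "u \<otimes> inv k \<in> {g \<in> carrier G. g \<otimes> k \<in> ?W}" using uW k HG U_carrier[OF pq(1)] by auto
    then show "{g \<in> carrier G. g \<otimes> k \<in> ?W} \<noteq> {}" by blast
  qed
  then obtain u0 where u0: "u0 \<in> U" "\<And>k. k \<in> H \<Longrightarrow> u0 \<otimes> k \<in> U \<and> q (\<theta> (u0 \<otimes> k)) \<noteq> 0" by blast
  have u0G: "u0 \<in> carrier G" using u0(1) U_carrier by blast
  have "(\<lambda>k. \<theta> (u0 \<otimes> k)) ` H \<subseteq> affine_points N" using u0(2) in_Z Z_affine by auto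
  then obtain e where e: "e \<in> polynomial_functions N" "inj_on e ((\<lambda>k. \<theta> (u0 \<otimes> k)) ` H)"
    using separating_polynomial[of "(\<lambda>k. \<theta> (u0 \<otimes> k)) ` H" N] finH by blast
  have sep: "e (\<theta> (u0 \<otimes> k)) \<noteq> e (\<theta> (u0 \<otimes> k'))" if "k \<in> H" "k' \<in> H" "k \<noteq> k'" for k k'
  proof
    assume "e (\<theta> (u0 \<otimes> k)) = e (\<theta> (u0 \<otimes> k'))"
    then have "\<theta> (u0 \<otimes> k) = \<theta> (u0 \<otimes> k')" using e(2) that by (auto dest: inj_onD)
    then have "u0 \<otimes> k = u0 \<otimes> k'" using u0(2) that inj by blast
    then show False using that HG u0G by (auto simp: subset_iff)
  qed
  interpret L: local_algebra chart_funs U u0 by (rule chart_local_algebra[OF u0(1)])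
  \<comment> \<open>That the coset stays in the domain and that \<open>e\<close> separates it are
    open conditions at \<open>u0\<close>. A polynomial \<open>T\<close> cuts out a neighbourhood on
    which they persist, with one \<open>e\<close> for all cosets.\<close>
  have nb1: "L.nb (\<Inter>k\<in>H. {g \<in> carrier G. g \<otimes> k \<in> ?W})"
  proof (rule L.nb_INT[OF finH])
    fix k assume k: "k \<in> H"
    show "L.nb {g \<in> carrier G. g \<otimes> k \<in> ?W}"
      using k HG oW u0(2)[OF k] u0G
      by (intro chart_nb_open[OF u0(1)] translation_open) auto
  qed
  have nb2: "L.nb (\<Inter>(k, k')\<in>{(k, k') \<in> H \<times> H. k \<noteq> k'}. {g. e (\<theta> (g \<otimes> k)) \<noteq> e (\<theta> (g \<otimes> k'))})"
  proof (rule L.nb_INT)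
    show "finite {(k, k') \<in> H \<times> H. k \<noteq> k'}" by (rule finite_subset[OF _ finite_cartesian_product[OF finH finH]]) auto
    fix i assume "i \<in> {(k, k') \<in> H \<times> H. k \<noteq> k'}"
    then obtain k k' where i: "i = (k, k')" "k \<in> H" "k' \<in> H" "k \<noteq> k'" by blast
    have kG: "k \<in> carrier G" "k' \<in> carrier G" using i HG by auto
    have "L.rat (\<lambda>g. e (\<theta> (g \<otimes> k)) + (- 1) * e (\<theta> (g \<otimes> k')))"
      using u0 i kG e(1) by (intro L.rat_add L.rat_mult L.rat_const translation_rat_polynomial) auto
    then have "L.nb {g. e (\<theta> (g \<otimes> k)) + (- 1) * e (\<theta> (g \<otimes> k')) \<noteq> 0}"
      by (rule L.rat_nonzero) (use sep[OF i(2-4)] in simp)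
    then show "L.nb (case i of (k, k') \<Rightarrow> {g. e (\<theta> (g \<otimes> k)) \<noteq> e (\<theta> (g \<otimes> k'))})"
      by (simp add: i(1))
  qed
  obtain T where T: "T \<in> polynomial_functions N" "T (\<theta> u0) \<noteq> 0"
    "\<forall>y\<in>U. T (\<theta> y) \<noteq> 0 \<longrightarrow> y \<in> (\<Inter>k\<in>H. {g \<in> carrier G. g \<otimes> k \<in> ?W}) \<inter>
      (\<Inter>(k, k')\<in>{(k, k') \<in> H \<times> H. k \<noteq> k'}. {g. e (\<theta> (g \<otimes> k)) \<noteq> e (\<theta> (g \<otimes> k'))})"
    by (rule nb_imp_open[OF u0(1) L.nb_Int[OF nb1 nb2]])
  have generic: "\<exists>S\<subseteq>R.W. card S = card H \<and> inj_on e S \<and> x \<in> S \<and> (\<forall>y\<in>S. z y = z x)"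
    if x: "x \<in> Z" "T x \<noteq> 0" for x
  proof -
    define g where "g = \<theta>' x"
    have g: "g \<in> U" "\<theta> g = x" "g \<in> carrier G" using inverse(1,3)[of x] x U_carrier by (auto simp: g_def)
    have gk: "g \<otimes> k \<in> ?W" if "k \<in> H" for k using T(3) g x(2) that by blast
    have gsep: "e (\<theta> (g \<otimes> k)) \<noteq> e (\<theta> (g \<otimes> k'))" if "k \<in> H" "k' \<in> H" "k \<noteq> k'" for k k'
      using T(3) g x(2) that by blast
    let ?S = "(\<lambda>k. \<theta> (g \<otimes> k)) ` H"
    show ?thesis
    proof (intro exI[of _ ?S] conjI ballI)
      show "?S \<subseteq> R.W" using gk in_Z by (auto simp: R.W_def)
      show "card ?S = card H" by (intro card_image inj_onI) (metis gsep)
      show "inj_on e ?S" using gsep by (auto simp: inj_on_def)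
      show "x \<in> ?S" using oneH g by (intro image_eqI[of _ _ \<one>]) auto
      fix y assume "y \<in> ?S"
      then obtain k where k: "k \<in> H" "y = \<theta> (g \<otimes> k)" by blast
      have "z y = \<theta> (\<kappa> (g \<otimes> k))" using gk[OF k(1)] k(2) z\<theta> by simp
      also have "\<dots> = z x" using \<kappa>_coset[OF g(3) k(1)] z\<theta>[OF g(1)] g(2) by simp
      finally show "z y = z x" .
    qed
  qed
  obtain d d' where "poly_deg N d e" "poly_deg N d' T" using e(1) T(1) polynomial_functions_iff by metis
  moreover have "\<exists>x\<in>Z. T x \<noteq> 0" using T(2) u0(1) in_Z by blast
  ultimately have "card H \<le> (D + 1) ^ N" using generic by (rule R.fibre_card_le)
  then show ?thesis by (simp add: H_def)
qed

section \<open>Degrees of the iterates of an isogeny\<close>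

lemma preimage_open:
  assumes "continuous_map (space_top X) (space_top X) \<mu>" "\<mu> ` carrier G = carrier G"
    and A: "open_in_space X A" "A \<noteq> {}"
  shows "open_in_space X {g \<in> carrier G. \<mu> g \<in> A}" "{g \<in> carrier G. \<mu> g \<in> A} \<noteq> {}"
proof -
  show "open_in_space X {g \<in> carrier G. \<mu> g \<in> A}" using assms(1) A(1) by (simp add: continuous_map carrier_points)
  obtain a where a: "a \<in> A" using A(2) by blast
  then have "a \<in> carrier G" using openin_subset[OF A(1)] carrier_points by blast
  then have "a \<in> \<mu> ` carrier G" using assms(2) by simp
  then show "{g \<in> carrier G. \<mu> g \<in> A} \<noteq> {}" using a by blast
qed

text \<open>Composition with \<sigma> multiplies the degree bound by \<open>L\<close>. Inversion and
  the two multiplications contribute constant factors, since their local descriptions are fixed once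
  and for all; only the base point and \<open>c\<close> vary with \<open>n\<close>.\<close>

theorem fixed_points_bound:
  assumes "isogeny X G \<sigma>"
  shows "\<exists>K L. \<forall>n. finite {g \<in> carrier G. (\<sigma> ^^ n) g = g} \<longrightarrow>
    card {g \<in> carrier G. (\<sigma> ^^ n) g = g} \<le> (K * L ^ n + 1) ^ N"
proof -
  have \<sigma>: "\<sigma> \<in> hom G G" "morphism X X \<sigma>" "\<sigma> ` carrier G = carrier G"
    using assms by (auto simp: isogeny_def algebraic_End_def)
  have cont\<sigma>: "continuous_map (space_top X) (space_top X) \<sigma>" using \<sigma>(2) by (simp add: morphism_def)
  have pow: "continuous_map (space_top X) (space_top X) (\<sigma> ^^ n) \<and> (\<sigma> ^^ n) ` carrier G = carrier G \<and>
    \<sigma> ^^ n \<in> hom G G" for n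
  proof (induction n)
    case (Suc n)
    have "continuous_map (space_top X) (space_top X) (\<sigma> \<circ> \<sigma> ^^ n)"
      using Suc cont\<sigma> by (blast intro: continuous_map_compose)
    moreover have "(\<sigma> \<circ> \<sigma> ^^ n) ` carrier G = carrier G"
      using Suc \<sigma>(3) by (simp only: image_comp[symmetric])
    moreover have "\<sigma> \<circ> \<sigma> ^^ n \<in> hom G G" using Suc \<sigma>(1) by (auto simp: hom_def Pi_def)
    ultimately show ?case unfolding funpow.simps by blast
  qed (auto simp: hom_def)
  have contI: "continuous_map (space_top X) (space_top X) (\<lambda>g. inv g)"
    using inv_morphism by (simp add: morphism_def)
  have surjI: "(\<lambda>g. inv g) ` carrier G = carrier G"
  proof (intro equalityI subsetI)
    fix x assume "x \<in> carrier G"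
    then show "x \<in> (\<lambda>g. inv g) ` carrier G" by (intro image_eqI[of _ _ "inv x"]) auto
  qed auto
  note preI = preimage_open[OF contI surjI]
  note preS = preimage_open[OF conjunct1[OF pow] conjunct1[OF conjunct2[OF pow]]]
  obtain B S T x0 y0 where chart: "\<And>i. i < N \<Longrightarrow> poly_deg (2 * N) B (S i)" "poly_deg (2 * N) B T"
    "x0 \<in> U" "y0 \<in> U" "T (join N (\<theta> x0) (\<theta> y0)) \<noteq> 0"
    "\<And>x y. x \<in> U \<Longrightarrow> y \<in> U \<Longrightarrow> T (join N (\<theta> x) (\<theta> y)) \<noteq> 0 \<Longrightarrow>
      x \<otimes> y \<in> U \<and> (\<forall>i<N. \<theta> (x \<otimes> y) i * T (join N (\<theta> x) (\<theta> y)) = S i (join N (\<theta> x) (\<theta> y)))"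
    using mult_chart by blast
  have rmult: "ratmap (\<lambda>g. \<mu> g \<otimes> \<nu> g) ((B + 1) * (2 * D)) u"
    if "ratmap \<mu> D u" "ratmap \<nu> D u" "T (join N (\<theta> (\<mu> u)) (\<theta> (\<nu> u))) \<noteq> 0" for \<mu> \<nu> D u
    by (rule ratmap_mult[OF _ chart(2) _ that, where S = S]) (fact chart(1), fact chart(6))
  have T: "T \<in> polynomial_functions (2 * N)" using chart(2) polynomial_functions_iff by blast
  \<comment> \<open>Left factors whose product with at least one right factor, namely
    \<open>y0\<close>, is covered by the description of the group law.\<close>
  define O1 where "O1 = {a \<in> U. T (join N (\<theta> a) (\<theta> y0)) \<noteq> 0}"
  have O1: "open_in_space X O1" "O1 \<noteq> {}"
    using nonvanishing_open[OF polynomial_join_fix_right[OF T]] chart(3,5) by (auto simp: O1_def)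
  have meetU: "\<exists>g\<in>U. g \<in> A" if "open_in_space X A" "A \<noteq> {}" for A
    using irreducible[OF U_open that(1) U_nonempty that(2)] by blast
  obtain gi where gi: "gi \<in> U" "inv gi \<in> U" using meetU[OF preI[OF U_open U_nonempty]] by blast
  obtain Di where Di: "ratmap (\<lambda>g. inv g) Di gi" using ratmap_morphism[OF inv_morphism gi] by blast
  obtain gs where gs: "gs \<in> U" "\<sigma> gs \<in> U" using meetU[OF preimage_open[OF cont\<sigma> \<sigma>(3) U_open U_nonempty]] by blast
  obtain Ds where Ds: "ratmap \<sigma> Ds gs" using ratmap_morphism[OF \<sigma>(2) gs] by blast
  \<comment> \<open>\<open>ratmap_comp\<close> with the outer map \<sigma> of degree
    \<open>Ds\<close> contributes the factor \<open>Ds + 1\<close>.\<close>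
  define L where "L = Ds + 1"
  have pow_rm: "\<exists>u. ratmap (\<sigma> ^^ n) (L ^ n) u" for n
  proof (induction n)
    case 0
    have "(\<lambda>g. g) = \<sigma> ^^ 0" by auto
    then show ?case using ratmap_id gi(1) by (metis power_0)
  next
    case (Suc n)
    have Os: "open_in_space X {u. ratmap \<sigma> Ds u}" "{u. ratmap \<sigma> Ds u} \<noteq> {}"
      using ratmap_domain_open Ds by blast+
    \<comment> \<open>The preimage of the domain of \<sigma> under the iterate is nonempty because
      the iterate is surjective; by irreducibility it meets the domain of the iterate.\<close>
    have "{u. ratmap (\<sigma> ^^ n) (L ^ n) u} \<inter> {g \<in> carrier G. (\<sigma> ^^ n) g \<in> {u. ratmap \<sigma> Ds u}} \<noteq> {}"
      using Suc by (intro irreducible ratmap_domain_open preS Os) auto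
    then obtain u where u: "ratmap (\<sigma> ^^ n) (L ^ n) u" "ratmap \<sigma> Ds ((\<sigma> ^^ n) u)" by blast
    from ratmap_comp[OF this] have "ratmap (\<lambda>g. \<sigma> ((\<sigma> ^^ n) g)) (L ^ Suc n) u" by (simp add: L_def)
    then show ?case by (auto simp: o_def)
  qed
  \<comment> \<open>\<open>(B + 1) * (2 * Di)\<close> is the degree of
    \<open>inv g \<otimes> c\<close>; with the summand 1, \<open>M * L ^ n\<close> bounds the
    degrees of both factors of the outer product, for which \<open>K\<close> accounts.\<close>
  define M where "M = 1 + (B + 1) * (2 * Di)"
  define K where "K = (B + 1) * (2 * M)"
  have "card {g \<in> carrier G. (\<sigma> ^^ n) g = g} \<le> (K * L ^ n + 1) ^ N"
    if fin: "finite {g \<in> carrier G. (\<sigma> ^^ n) g = g}" for n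
  proof -
    define F where "F = (\<lambda>i::nat. if i = 0 then {u. ratmap (\<lambda>g. inv g) Di u} else
      if i = 1 then {g \<in> carrier G. inv g \<in> O1} else {g \<in> carrier G. (\<sigma> ^^ n) g \<in> O1})"
    have "\<exists>x\<in>{u. ratmap (\<sigma> ^^ n) (L ^ n) u}. \<forall>i\<in>{0, 1, 2}. x \<in> F i"
    proof (rule irreducible_Inter)
      show "open_in_space X (F i) \<and> F i \<noteq> {}" for i
        unfolding F_def using preI[OF O1] preS[OF O1] ratmap_domain_open Di by auto
      show "{u. ratmap (\<sigma> ^^ n) (L ^ n) u} \<noteq> {}" using pow_rm by blast
    qed (simp_all add: ratmap_domain_open)
    then obtain u where u: "ratmap (\<sigma> ^^ n) (L ^ n) u" "ratmap (\<lambda>g. inv g) Di u" "inv u \<in> O1" "(\<sigma> ^^ n) u \<in> O1"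
      by (auto simp: F_def)
    have uU: "u \<in> U" using u(1) by (simp add: ratmap_def)
    have uG: "u \<in> carrier G" using uU U_carrier by blast
    \<comment> \<open>\<open>c\<close> has to bring both products within reach at \<open>u\<close>:
      \<open>S1\<close> admits \<open>inv u \<otimes> c\<close>, and \<open>S2\<close> admits its
      product with the iterate. The second condition becomes one on \<open>c\<close> by a
      translation, and irreducibility lets both hold.\<close>
    define S1 where "S1 = {c \<in> U. T (join N (\<theta> (inv u)) (\<theta> c)) \<noteq> 0}"
    define S2 where "S2 = {b \<in> U. T (join N (\<theta> ((\<sigma> ^^ n) u)) (\<theta> b)) \<noteq> 0}"
    have S1: "open_in_space X S1" "S1 \<noteq> {}"
      using nonvanishing_open[OF polynomial_join_fix_left[OF T]] u(3) chart(4) by (auto simp: S1_def O1_def)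
    have S2: "open_in_space X S2" "y0 \<in> S2"
      using nonvanishing_open[OF polynomial_join_fix_left[OF T]] u(4) chart(4) by (auto simp: S2_def O1_def)
    have "y0 \<otimes> u \<in> {c \<in> carrier G. c \<otimes> inv u \<in> S2}"
      using S2(2) uG U_carrier[OF chart(4)] by (simp add: m_assoc)
    then have "S1 \<inter> {c \<in> carrier G. c \<otimes> inv u \<in> S2} \<noteq> {}"
      using S1 S2(1) uG by (intro irreducible translation_open) auto
    then obtain c where c: "c \<in> S1" "c \<otimes> inv u \<in> S2" "c \<in> carrier G" by blast
    have c2: "inv u \<otimes> c \<in> S2" using c(2,3) uG by (simp add: m_comm)
    have cU: "c \<in> U" using c(1) by (simp add: S1_def)
    have "ratmap (\<lambda>g. inv g \<otimes> c) ((B + 1) * (2 * Di)) u"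
      by (rule rmult[OF u(2) ratmap_mono[OF ratmap_const[OF uU cU]]]) (use c(1) in \<open>auto simp: S1_def\<close>)
    moreover have "(B + 1) * (2 * Di) \<le> M * L ^ n"
    proof -
      have "(B + 1) * (2 * Di) \<le> M * 1" by (simp add: M_def)
      also have "\<dots> \<le> M * L ^ n" by (rule mult_le_mono2) (simp add: L_def)
      finally show ?thesis .
    qed
    moreover have "L ^ n \<le> M * L ^ n" by (simp add: M_def)
    ultimately have "ratmap (\<lambda>g. inv g \<otimes> c) (M * L ^ n) u" "ratmap (\<sigma> ^^ n) (M * L ^ n) u"
      using u(1) ratmap_mono by blast+
    then have "ratmap (\<lambda>g. (\<sigma> ^^ n) g \<otimes> (inv g \<otimes> c)) ((B + 1) * (2 * (M * L ^ n))) u"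
      by (intro rmult) (use c2 in \<open>auto simp: S2_def\<close>)
    from card_fixed_points_le[OF _ c(3) fin this] pow
    have "card {g \<in> carrier G. (\<sigma> ^^ n) g = g} \<le> ((B + 1) * (2 * (M * L ^ n)) + 1) ^ N" by blast
    then show ?thesis by (simp only: K_def mult.assoc)
  qed
  then show ?thesis by blast
qed

end

section \<open>Fixed points of dynamically affine maps\<close>

lemma fixed_points_exponential_bound:
  fixes X :: "('g, 'k::alg_closed_field) fun_space" and G :: "'g monoid"
  assumes X: "algebraic_group X G" "comm_group G" "connected_space (space_top X)"
    and \<sigma>: "isogeny X G \<sigma>" "confined (carrier G) \<sigma>"
  obtains C B :: nat where "C \<ge> 1" "B \<ge> 1"
    "\<And>n. n \<ge> 1 \<Longrightarrow> card {g \<in> carrier G. (\<sigma> ^^ n) g = g} \<le> C * B ^ n"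
proof -
  interpret comm_group G by fact
  interpret connected_algebraic_group G X
    by unfold_locales (use X in auto)
  have "\<one>\<^bsub>G\<^esub> \<in> points X" by (simp add: carrier_points)
  from prevariety_chart[OF prevariety_X this]
  obtain U N Z \<theta> where U: "affine_chart X U N Z \<theta>" "\<one>\<^bsub>G\<^esub> \<in> U" .
  interpret affine_chart X U N Z \<theta> by fact
  interpret group_chart G X U N Z \<theta>
    by unfold_locales (use U(2) in blast)
  obtain K L where KL: "\<And>n. finite {g \<in> carrier G. (\<sigma> ^^ n) g = g} \<Longrightarrow>
    card {g \<in> carrier G. (\<sigma> ^^ n) g = g} \<le> (K * L ^ n + 1) ^ N"
    using fixed_points_bound[OF \<sigma>(1)] by blast
  show ?thesis
  proof (rule that[of "(K + 1) ^ N" "(L + 1) ^ N"])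
    fix n :: nat assume n: "n \<ge> 1"
    have "card {g \<in> carrier G. (\<sigma> ^^ n) g = g} \<le> (K * L ^ n + 1) ^ N"
      using \<sigma>(2) n by (intro KL) (simp add: confined_def)
    \<comment> \<open>With \<open>L + 1\<close> the power is at least 1 even if \<open>L\<close> is
      0, which absorbs the summand 1.\<close>
    also have "K * L ^ n + 1 \<le> (K + 1) * (L + 1) ^ n"
    proof -
      have "K * L ^ n \<le> K * (L + 1) ^ n" by (intro mult_le_mono2 power_mono) auto
      moreover have "1 \<le> (L + 1) ^ n" by simp
      moreover have "(K + 1) * (L + 1) ^ n = K * (L + 1) ^ n + (L + 1) ^ n" by simp
      ultimately show ?thesis by linarith
    qed
    then have "(K * L ^ n + 1) ^ N \<le> ((K + 1) * (L + 1) ^ n) ^ N" by (rule power_mono) simp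
    also have "\<dots> = (K + 1) ^ N * ((L + 1) ^ N) ^ n"
      by (simp only: power_mult_distrib power_mult[symmetric] mult.commute)
    finally show "card {g \<in> carrier G. (\<sigma> ^^ n) g = g} \<le> (K + 1) ^ N * ((L + 1) ^ N) ^ n" .
  qed simp_all
qed

text \<open>Translation parts cancel in quotients, so two fixed points of the affine iterate differ
  by a fixed point of \<open>\<sigma> ^^ n\<close>. There may be none at all, hence an
  inequality.\<close>

lemma affine_map_fixed_points:
  assumes G: "comm_group G" and \<sigma>: "\<sigma> \<in> hom G G" and h: "h \<in> carrier G"
    and fin: "finite {g \<in> carrier G. (\<sigma> ^^ n) g = g}"
  shows "finite {g \<in> carrier G. (affine_map G \<sigma> h ^^ n) g = g}"
    and "card {g \<in> carrier G. (affine_map G \<sigma> h ^^ n) g = g} \<le> card {g \<in> carrier G. (\<sigma> ^^ n) g = g}"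
proof -
  interpret comm_group G by fact
  interpret hom: group_hom G G \<sigma> by unfold_locales (rule \<sigma>)
  let ?\<psi> = "affine_map G \<sigma> h"
  have \<psi>c: "(?\<psi> ^^ m) g \<in> carrier G" if "g \<in> carrier G" for m g
    using that by (induction m) (auto simp: affine_map_def h)
  have \<sigma>c: "(\<sigma> ^^ m) g \<in> carrier G" if "g \<in> carrier G" for m g
    using that by (induction m) auto
  have diff: "(?\<psi> ^^ m) g \<otimes>\<^bsub>G\<^esub> inv\<^bsub>G\<^esub> ((?\<psi> ^^ m) g0) = (\<sigma> ^^ m) (g \<otimes>\<^bsub>G\<^esub> inv\<^bsub>G\<^esub> g0)"
    if g: "g \<in> carrier G" "g0 \<in> carrier G" for m g g0
  proof (induction m)
    case (Suc m)
    define a where "a = (?\<psi> ^^ m) g"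
    define b where "b = (?\<psi> ^^ m) g0"
    have ab: "a \<in> carrier G" "b \<in> carrier G" using \<psi>c g by (auto simp: a_def b_def)
    have "(?\<psi> ^^ Suc m) g \<otimes>\<^bsub>G\<^esub> inv\<^bsub>G\<^esub> ((?\<psi> ^^ Suc m) g0)
        = (\<sigma> a \<otimes>\<^bsub>G\<^esub> h) \<otimes>\<^bsub>G\<^esub> (inv\<^bsub>G\<^esub> h \<otimes>\<^bsub>G\<^esub> inv\<^bsub>G\<^esub> (\<sigma> b))"
      using ab h by (simp add: affine_map_def a_def[symmetric] b_def[symmetric] inv_mult_group)
    also have "\<dots> = \<sigma> a \<otimes>\<^bsub>G\<^esub> ((h \<otimes>\<^bsub>G\<^esub> inv\<^bsub>G\<^esub> h) \<otimes>\<^bsub>G\<^esub> inv\<^bsub>G\<^esub> (\<sigma> b))"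
    proof -
      have ac: "(s \<otimes>\<^bsub>G\<^esub> x) \<otimes>\<^bsub>G\<^esub> (y \<otimes>\<^bsub>G\<^esub> t) = s \<otimes>\<^bsub>G\<^esub> ((x \<otimes>\<^bsub>G\<^esub> y) \<otimes>\<^bsub>G\<^esub> t)"
        if "s \<in> carrier G" "x \<in> carrier G" "y \<in> carrier G" "t \<in> carrier G" for s x y t
        using that by (simp add: m_assoc)
      show ?thesis by (rule ac) (use ab h in simp_all)
    qed
    also have "\<dots> = \<sigma> (a \<otimes>\<^bsub>G\<^esub> inv\<^bsub>G\<^esub> b)" using ab h by simp
    also have "\<dots> = (\<sigma> ^^ Suc m) (g \<otimes>\<^bsub>G\<^esub> inv\<^bsub>G\<^esub> g0)" using Suc by (simp add: a_def b_def)
    finally show ?case .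
  qed simp
  let ?F = "{g \<in> carrier G. (?\<psi> ^^ n) g = g}" and ?H = "{g \<in> carrier G. (\<sigma> ^^ n) g = g}"
  have "finite ?F \<and> card ?F \<le> card ?H"
  proof (cases "?F = {}")
    case False
    then obtain g0 where g0: "g0 \<in> carrier G" "(?\<psi> ^^ n) g0 = g0" by blast
    have sub: "?F \<subseteq> (\<lambda>k. k \<otimes>\<^bsub>G\<^esub> g0) ` ?H"
    proof
      fix g assume "g \<in> ?F"
      then have g: "g \<in> carrier G" "(?\<psi> ^^ n) g = g" by auto
      have "g \<otimes>\<^bsub>G\<^esub> inv\<^bsub>G\<^esub> g0 \<in> ?H" using diff[OF g(1) g0(1), of n] g g0 by simp
      moreover have "g = (g \<otimes>\<^bsub>G\<^esub> inv\<^bsub>G\<^esub> g0) \<otimes>\<^bsub>G\<^esub> g0" using g g0 by (simp add: m_assoc)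
      ultimately show "g \<in> (\<lambda>k. k \<otimes>\<^bsub>G\<^esub> g0) ` ?H" by blast
    qed
    have "finite ?F" using sub fin by (meson finite_imageI finite_subset)
    moreover have "card ?F \<le> card ((\<lambda>k. k \<otimes>\<^bsub>G\<^esub> g0) ` ?H)" using sub fin by (intro card_mono) auto
    moreover have "\<dots> \<le> card ?H" using fin by (rule card_image_le)
    ultimately show ?thesis by linarith
  next
    case True
    show ?thesis unfolding True by simp
  qed
  then show "finite ?F" "card ?F \<le> card ?H" by auto
qed

text \<open>A periodic point of \<open>f\<close> lifts to a periodic point of \<open>\<psi>\<close>: the lift \<open>g\<close> moves inside its
  finite \<open>\<Gamma>\<close>-orbit, so that one of its first \<open>card \<Gamma>\<close> iterates is periodic.\<close>

lemma semiconjugate_fixed_points: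
  assumes \<psi>: "\<And>g. g \<in> A \<Longrightarrow> \<psi> g \<in> A" and semi: "\<And>g. g \<in> A \<Longrightarrow> f (\<pi> g) = \<pi> (\<psi> g)"
    and fibre: "\<And>g. g \<in> A \<Longrightarrow> \<exists>S. finite S \<and> card S \<le> k \<and> {g' \<in> A. \<pi> g' = \<pi> g} \<subseteq> S"
  shows "{x \<in> \<pi> ` A. (f ^^ n) x = x} \<subseteq> \<pi> ` (\<Union>c\<in>{1..k}. {g \<in> A. (\<psi> ^^ (n * c)) g = g})"
proof
  fix x assume "x \<in> {x \<in> \<pi> ` A. (f ^^ n) x = x}"
  then obtain g where g: "g \<in> A" "x = \<pi> g" "(f ^^ n) x = x" by blast
  have \<psi>A: "(\<psi> ^^ m) y \<in> A" if "y \<in> A" for m y using that \<psi> by (induction m) auto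
  have semi': "(f ^^ m) (\<pi> y) = \<pi> ((\<psi> ^^ m) y)" if "y \<in> A" for m y
    using that by (induction m) (auto simp: semi \<psi>A)
  have periodic: "(f ^^ (n * m)) x = x" for m
  proof (induction m)
    case (Suc m)
    then show ?case using g(3) by (simp add: funpow_add)
  qed simp
  have lift: "\<pi> ((\<psi> ^^ (n * m)) g) = x" for m
    using semi'[OF g(1), of "n * m"] periodic[of m] g(2) by simp
  obtain S where S: "finite S" "card S \<le> k" "{g' \<in> A. \<pi> g' = \<pi> g} \<subseteq> S" using fibre[OF g(1)] by blast
  \<comment> \<open>Pigeonhole: the \<open>k + 1\<close> exponents from 0 to \<open>k\<close> land
    in at most \<open>k\<close> points.\<close>
  have "(\<lambda>m. (\<psi> ^^ (n * m)) g) ` {0..k} \<subseteq> S" using S(3) \<psi>A[OF g(1)] lift g(2) by auto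
  then have le: "card ((\<lambda>m. (\<psi> ^^ (n * m)) g) ` {0..k}) \<le> k"
    using S(1,2) card_mono by (meson order_trans)
  have "\<not> inj_on (\<lambda>m. (\<psi> ^^ (n * m)) g) {0..k}"
  proof
    assume "inj_on (\<lambda>m. (\<psi> ^^ (n * m)) g) {0..k}"
    from card_image[OF this] le show False by simp
  qed
  then obtain a b where ab: "a < b" "b \<le> k" "(\<psi> ^^ (n * a)) g = (\<psi> ^^ (n * b)) g"
    unfolding inj_on_def by (metis atLeastAtMost_iff linorder_neqE_nat)
  \<comment> \<open>The lift \<open>g\<close> itself need not be periodic; \<open>?y\<close> is, and
    it lies over the same point \<open>x\<close>.\<close>
  let ?y = "(\<psi> ^^ (n * a)) g"
  have "(\<psi> ^^ (n * (b - a))) ?y = (\<psi> ^^ (n * (b - a) + n * a)) g" by (simp add: funpow_add)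
  also have "n * (b - a) + n * a = n * b" using ab(1) by (simp add: diff_mult_distrib2)
  finally have "(\<psi> ^^ (n * (b - a))) ?y = ?y" using ab(3) by simp
  moreover have "b - a \<in> {1..k}" using ab by auto
  ultimately show "x \<in> \<pi> ` (\<Union>c\<in>{1..k}. {g \<in> A. (\<psi> ^^ (n * c)) g = g})"
    using lift[of a] \<psi>A[OF g(1)] by (intro image_eqI[of _ _ ?y]) auto
qed

lemma dynamically_affine_fixed_points:
  fixes V :: "('v, 'k::alg_closed_field) fun_space" and G :: "'g monoid"
  assumes da: "dynamically_affine V f X G \<sigma> h \<Gamma> \<iota>"
  defines "Q \<equiv> \<iota> ` points (quotient_space X \<Gamma>)"
  obtains C B :: nat where "C \<ge> 1" "B \<ge> 1" "f ` Q \<subseteq> Q" "Q \<subseteq> points V"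
    "\<And>n. n \<ge> 1 \<Longrightarrow> finite {x \<in> Q. (f ^^ n) x = x} \<and> card {x \<in> Q. (f ^^ n) x = x} \<le> C * B ^ n"
proof -
  have grp: "algebraic_group X G" "comm_group G" "connected_space (space_top X)"
    and \<sigma>: "isogeny X G \<sigma>" "confined (carrier G) \<sigma>" and h: "h \<in> carrier G"
    and \<Gamma>: "finite \<Gamma>" "subgroup \<Gamma> (AutoGroup G)"
    and Q_open: "open_in_space V Q"
    and iso: "isomorphism (quotient_space X \<Gamma>) (open_subspace V Q) \<iota>"
    and semi: "\<And>g. g \<in> carrier G \<Longrightarrow> f (\<iota> (orbit_map \<Gamma> g)) = \<iota> (orbit_map \<Gamma> (affine_map G \<sigma> h g))"
    using da unfolding dynamically_affine_def Q_def by blast+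
  have carr: "carrier G = points X" using grp(1) by (simp add: algebraic_group_def)
  have hom: "\<sigma> \<in> hom G G" using \<sigma>(1) by (simp add: isogeny_def algebraic_End_def)
  interpret comm_group G by fact
  have QV: "Q \<subseteq> points V" using Q_open openin_subset by blast
  let ?\<psi> = "affine_map G \<sigma> h" and ?\<pi> = "\<lambda>g. \<iota> (orbit_map \<Gamma> g)"
  have Q: "Q = ?\<pi> ` carrier G" unfolding Q_def points_quotient_space carr by auto
  have inj: "inj_on \<iota> (orbit_map \<Gamma> ` carrier G)"
    using iso unfolding isomorphism_def points_quotient_space carr bij_betw_def by blast
  have \<psi>: "?\<psi> g \<in> carrier G" if "g \<in> carrier G" for g
    using that h hom by (auto simp: affine_map_def hom_def)
  have self: "g \<in> orbit_map \<Gamma> g" if "g \<in> carrier G" for g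
  proof -
    have "\<one>\<^bsub>AutoGroup G\<^esub> \<in> \<Gamma>" by (rule subgroup.one_closed[OF \<Gamma>(2)])
    then have "(\<lambda>x\<in>carrier G. x) \<in> \<Gamma>" by (simp add: AutoGroup_def BijGroup_def)
    then show ?thesis using that unfolding orbit_map_def by (intro image_eqI[of _ _ "\<lambda>x\<in>carrier G. x"]) auto
  qed
  have fibre: "\<exists>S. finite S \<and> card S \<le> card \<Gamma> \<and> {g' \<in> carrier G. ?\<pi> g' = ?\<pi> g} \<subseteq> S" if g: "g \<in> carrier G" for g
  proof (intro exI conjI)
    show "finite (orbit_map \<Gamma> g)" "card (orbit_map \<Gamma> g) \<le> card \<Gamma>"
      unfolding orbit_map_def using \<Gamma>(1) by (auto intro: card_image_le)
    show "{g' \<in> carrier G. ?\<pi> g' = ?\<pi> g} \<subseteq> orbit_map \<Gamma> g"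
    proof
      fix g' assume "g' \<in> {g' \<in> carrier G. ?\<pi> g' = ?\<pi> g}"
      then have "g' \<in> carrier G" "orbit_map \<Gamma> g' = orbit_map \<Gamma> g" using inj g by (auto dest: inj_onD)
      then show "g' \<in> orbit_map \<Gamma> g" using self by blast
    qed
  qed
  let ?F = "\<lambda>m. {g \<in> carrier G. (?\<psi> ^^ m) g = g}"
  obtain C B :: nat where CB: "C \<ge> 1" "B \<ge> 1"
    "\<And>n. n \<ge> 1 \<Longrightarrow> card {g \<in> carrier G. (\<sigma> ^^ n) g = g} \<le> C * B ^ n"
    using fixed_points_exponential_bound[OF grp \<sigma>] by blast
  have F: "finite (?F m)" "card (?F m) \<le> C * B ^ m" if "m \<ge> 1" for m
  proof -
    have fin: "finite {g \<in> carrier G. (\<sigma> ^^ m) g = g}" using \<sigma>(2) that by (simp add: confined_def)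
    show "finite (?F m)" by (rule affine_map_fixed_points(1)[OF grp(2) hom h fin])
    show "card (?F m) \<le> C * B ^ m"
      using affine_map_fixed_points(2)[OF grp(2) hom h fin] CB(3)[OF that] by (rule order_trans)
  qed
  show ?thesis
  \<comment> \<open>At most \<open>card \<Gamma>\<close> periods \<open>n * c\<close> occur, each
    with at most \<open>C * B ^ (n * card \<Gamma>)\<close> points because \<open>B \<ge> 1\<close>.
    The summand 1 secures the lower bound on the constant.\<close>
  proof (rule that[of "card \<Gamma> * C + 1" "B ^ card \<Gamma>"])
    show "f ` Q \<subseteq> Q" unfolding Q using semi \<psi> by auto
    show "Q \<subseteq> points V" by fact
    fix n :: nat assume n: "n \<ge> 1"
    let ?U = "\<Union>c\<in>{1..card \<Gamma>}. ?F (n * c)"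
    have sub: "{x \<in> Q. (f ^^ n) x = x} \<subseteq> ?\<pi> ` ?U"
      unfolding Q using \<psi> semi fibre by (rule semiconjugate_fixed_points)
    have finU: "finite ?U" using F(1) n by auto
    have "card ?U \<le> (\<Sum>c\<in>{1..card \<Gamma>}. card (?F (n * c)))" by (rule card_UN_le) simp
    also have "\<dots> \<le> (\<Sum>c\<in>{1..card \<Gamma>}. C * B ^ (n * card \<Gamma>))"
    proof (rule sum_mono)
      fix c assume c: "c \<in> {1..card \<Gamma>}"
      have "card (?F (n * c)) \<le> C * B ^ (n * c)" using c n by (intro F(2)) auto
      also have "\<dots> \<le> C * B ^ (n * card \<Gamma>)" using c CB(2) by (intro mult_le_mono2 power_increasing) auto
      finally show "card (?F (n * c)) \<le> C * B ^ (n * card \<Gamma>)" .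
    qed
    also have "\<dots> \<le> (card \<Gamma> * C + 1) * (B ^ card \<Gamma>) ^ n"
      by (simp add: power_mult[symmetric] mult.commute)
    finally have "card ?U \<le> (card \<Gamma> * C + 1) * (B ^ card \<Gamma>) ^ n" .
    moreover have "card (?\<pi> ` ?U) \<le> card ?U" by (rule card_image_le[OF finU])
    moreover have "card {x \<in> Q. (f ^^ n) x = x} \<le> card (?\<pi> ` ?U)"
      by (rule card_mono[OF finite_imageI[OF finU] sub])
    moreover have "finite {x \<in> Q. (f ^^ n) x = x}" by (rule finite_subset[OF sub finite_imageI[OF finU]])
    ultimately show "finite {x \<in> Q. (f ^^ n) x = x} \<and>
        card {x \<in> Q. (f ^^ n) x = x} \<le> (card \<Gamma> * C + 1) * (B ^ card \<Gamma>) ^ n" by linarith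
  qed (use CB in simp_all)
qed

text \<open>A periodic point comes back to itself from \<open>(f ^^ m) x\<close> in
  \<open>n * m - m\<close> further steps, a difference that is not truncated because
  \<open>n \<ge> 1\<close>.\<close>

lemma periodic_point_in_invariant_set:
  assumes "f ` Q \<subseteq> Q" "(f ^^ n) x = x" "n \<ge> 1" "(f ^^ m) x \<in> Q"
  shows "x \<in> Q"
proof -
  have inv: "(f ^^ k) y \<in> Q" if "y \<in> Q" for k y using that assms(1) by (induction k) auto
  have "(f ^^ (n * k)) x = x" for k using assms(2) by (induction k) (auto simp: funpow_add)
  then have "(f ^^ (n * m - m + m)) x = x" using \<open>n \<ge> 1\<close> by simp
  then have "(f ^^ (n * m - m)) ((f ^^ m) x) = x" by (simp only: funpow_add o_apply)
  then show ?thesis using inv[OF assms(4), of "n * m - m"] by simp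
qed

text \<open>A periodic point whose orbit meets the invariant image of \<iota> lies in it, so the
  fixed points of every iterate are split between \<open>C\<close> and this image. Confinement
  belongs to the conclusion, because \<open>card\<close> is 0 on infinite sets and the counts would
  otherwise say nothing.\<close>

theorem theoremA1:
  fixes V :: "('v, 'k::alg_closed_field) fun_space" and f :: "'v \<Rightarrow> 'v"
    and X :: "('g, 'k) fun_space" and G :: "'g monoid"
    and \<sigma> :: "'g \<Rightarrow> 'g" and h :: 'g and \<Gamma> :: "('g \<Rightarrow> 'g) set" and \<iota> :: "'g set \<Rightarrow> 'v"
    and p :: nat and C :: "'v set"
  assumes "CHAR('k) = p" and "p > 0"
    and "dynamically_affine V f X G \<sigma> h \<Gamma> \<iota>"
    and "C = {x \<in> points V. forward_orbit f x \<inter> \<iota> ` points (quotient_space X \<Gamma>) = {}}"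
    and "confined C f" and "rational_fps (artin_mazur_zeta C f)"
  shows "confined (points V) f \<and>
    converges_to_holomorphic_near_0 (artin_mazur_zeta (points V) f) \<and>
    converges_to_holomorphic_near_0 (tame_zeta p (points V) f)"
proof -
  let ?Q = "\<iota> ` points (quotient_space X \<Gamma>)"
  obtain K B :: nat where KB: "K \<ge> 1" "B \<ge> 1" "f ` ?Q \<subseteq> ?Q" "?Q \<subseteq> points V"
    "\<And>n. n \<ge> 1 \<Longrightarrow> finite {x \<in> ?Q. (f ^^ n) x = x} \<and> card {x \<in> ?Q. (f ^^ n) x = x} \<le> K * B ^ n"
    using dynamically_affine_fixed_points[OF assms(3)] by blast
  obtain K' B' where KB': "K' > 0" "B' > 0"
    "\<And>n. n \<ge> 1 \<Longrightarrow> real (fixed_point_count C f n) \<le> K' * B' ^ n"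
    using rational_zeta_fixed_point_bound[OF assms(6)] by blast
  have split: "{x \<in> points V. (f ^^ n) x = x} \<subseteq> {x \<in> C. (f ^^ n) x = x} \<union> {x \<in> ?Q. (f ^^ n) x = x}"
    if n: "n \<ge> 1" for n
  proof
    fix x assume "x \<in> {x \<in> points V. (f ^^ n) x = x}"
    then have x: "x \<in> points V" "(f ^^ n) x = x" by auto
    show "x \<in> {x \<in> C. (f ^^ n) x = x} \<union> {x \<in> ?Q. (f ^^ n) x = x}"
    proof (cases "x \<in> C")
      case False
      then obtain m where "(f ^^ m) x \<in> ?Q"
        using x(1) unfolding assms(4) forward_orbit_def by blast
      then have "x \<in> ?Q" by (rule periodic_point_in_invariant_set[OF KB(3) x(2) n])
      then show ?thesis using x(2) by blast
    qed (use x in blast)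
  qed
  have finC: "finite {x \<in> C. (f ^^ n) x = x}" if "n \<ge> 1" for n
    using assms(5) that by (simp add: confined_def)
  have finV: "finite {x \<in> points V. (f ^^ n) x = x}" if "n \<ge> 1" for n
    by (rule finite_subset[OF split[OF that]]) (use finC[OF that] KB(5)[OF that] in blast)
  have bound: "real (fixed_point_count (points V) f n) \<le> (K' + real K) * max B' (real B) ^ n"
    if n: "n \<ge> 1" for n
  proof -
    have "fixed_point_count (points V) f n \<le> card ({x \<in> C. (f ^^ n) x = x} \<union> {x \<in> ?Q. (f ^^ n) x = x})"
      unfolding fixed_point_count_def
      by (rule card_mono[OF _ split[OF n]]) (use finC[OF n] KB(5)[OF n] in blast)
    also have "\<dots> \<le> fixed_point_count C f n + card {x \<in> ?Q. (f ^^ n) x = x}"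
      unfolding fixed_point_count_def by (rule card_Un_le)
    also have "\<dots> \<le> fixed_point_count C f n + K * B ^ n" using KB(5)[OF n] by simp
    finally have "real (fixed_point_count (points V) f n) \<le> real (fixed_point_count C f n) + real (K * B ^ n)"
      by (metis of_nat_add of_nat_le_iff)
    also have "\<dots> \<le> K' * B' ^ n + real K * real B ^ n" using KB'(3)[OF n] by simp
    also have "\<dots> \<le> K' * max B' (real B) ^ n + real K * max B' (real B) ^ n"
      using KB'(1,2) by (intro add_mono mult_left_mono power_mono) auto
    finally show ?thesis by (simp add: distrib_right)
  qed
  have "confined (points V) f" unfolding confined_def using finV by blast
  moreover have "max B' (real B) > 0" using KB'(2) by simp
  ultimately show ?thesis using zeta_converge_if_fixed_point_bound[OF _ bound] by blast
qed

end
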